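(* Let $\{b_n\}$ be a natural-scale sequence, let $\{I_n\}$ be a $b$-insensitivity sequence, let $\{h_n\}$ be a $b$-truncation sequence, and let $\{J_n\}$ be an $h$-small-steps sequence. If $h_n = O(b_n)$ and $h_n \le J_n$, then $$\lim_{n\to\infty}\ \sup_{x \ge I_n+J_n}\left|\frac{\mathsf{P}\{S_n\in x+\Delta\}}{nF(x+\Delta)}-1\right| = 0 .$$
   Context: Let $\xi,\xi_1,\xi_2,\dots$ be i.i.d. real random variables with distribution $F$, and $S_n=\xi_1+\cdots+\xi_n$. Fix $T\in(0,\infty]$; put $\Delta=(0,T]$ if $T<\infty$ and $\Delta=(0,\infty)$ if $T=\infty$, and $F(x+\Delta)=\mathsf{P}\{\xi\in x+\Delta\}$, i.e. $\mathsf{P}\{x<\xi\le x+T\}$, read as $\mathsf{P}\{\xi>x\}$ when $T=\infty$. All sequences consist of positive numbers. $f\gg g$ means $g/f\to0$. Whenever $F(x+\Delta)$ stands in a denominator in a condition below, its positivity (for all large $n$) is implicitly part of the condition. Definitions (for the fixed $F$ and $T$): - $\{b_n\}$ is a natural-scale sequence if $\{S_n/b_n\}_{n\ge1}$ is tight (degenerate limits are allowed). - Given $b=\{b_n\}$, $\{I_n\}$ is a $b$-insensitivity sequence if $I_n\gg b_n$ and $\lim_{n\to\infty}\sup_{x\ge I_n}\sup_{0\le t\le b_n}\left|\frac{F(x-t+\Delta)}{F(x+\Delta)}-1\right|=0$. - Given $b=\{b_n\}$, $\{h_n\}$ is a $b$-truncation sequence if $$\lim_{K\to\infty}\limsup_{n\to\infty}\sup_{x\ge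 h_n}\frac{n\,\mathsf{P}\{S_2\in x+\Delta,\ \xi_1,\xi_2\in(-\infty,-Kb_n)\cup(h_n,\infty)\}}{F(x+\Delta)}=0 .$$ - Given $h=\{h_n\}$, $\{J_n\}$ is an $h$-small-steps sequence if $$\lim_{n\to\infty}\sup_{x\ge J_n}\sup_{z\ge x}\frac{\mathsf{P}\{S_n\in z+\Delta,\ \xi_1\le h_n,\dots,\xi_n\le h_n\}}{nF(x+\Delta)}=0 .$$ *)

theory Defs
  imports "HOL-Probability.Probability" "HOL-Library.Landau_Symbols"
begin

text \<open>
  All sequences are indexed by \<open>n \<ge> 1\<close>; the value at index \<open>0\<close> is never constrained.
  Suprema are taken in \<^typ>\<open>ereal\<close>, since they may be infinite.
\<close>

definition Delta :: "ereal \<Rightarrow> real set" where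
  "Delta T = {t. 0 < t \<and> ereal t \<le> T}"

definition window :: "ereal \<Rightarrow> real \<Rightarrow> real set" where
  "window T x = (\<lambda>t. x + t) ` Delta T"

lemma window_finite: "window (ereal r) x = {x<..x + r}"
proof -
  have "y \<in> window (ereal r) x" if "x < y" "y \<le> x + r" for y
    unfolding window_def Delta_def using that by (intro image_eqI[of _ _ "y - x"]) auto
  then show ?thesis by (auto simp: window_def Delta_def)
qed

lemma window_infinite: "window \<infinity> x = {x<..}"
proof -
  have "y \<in> window \<infinity> x" if "x < y" for y
    unfolding window_def Delta_def using that by (intro image_eqI[of _ _ "y - x"]) auto
  then show ?thesis by (auto simp: window_def Delta_def)
qed

definition partial_sum :: "(nat \<Rightarrow> 'a \<Rightarrow> real) \<Rightarrow> nat \<Rightarrow> 'a \<Rightarrow> real" where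
  "partial_sum \<xi> n \<omega> = (\<Sum>i=1..n. \<xi> i \<omega>)"

definition positive_seq :: "(nat \<Rightarrow> real) \<Rightarrow> bool" where
  "positive_seq a \<longleftrightarrow> (\<forall>n\<ge>1. 0 < a n)"

text \<open>
  The library's \<^const>\<open>tight\<close> speaks about sequences of laws indexed from \<open>0\<close>, hence the shift
  by \<^const>\<open>Suc\<close>.
\<close>

definition natural_scale :: "'a measure \<Rightarrow> (nat \<Rightarrow> 'a \<Rightarrow> real) \<Rightarrow> (nat \<Rightarrow> real) \<Rightarrow> bool" where
  "natural_scale M \<xi> b \<longleftrightarrow>
     positive_seq b \<and>
     tight (\<lambda>n. distr M borel (\<lambda>\<omega>. partial_sum \<xi> (Suc n) \<omega> / b (Suc n)))"

text \<open>
  In the next three definitions the conjunct starting with \<open>\<forall>\<^sub>F\<close> makes the implicit positivity of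
  the denominators explicit, so that no quotient is affected by \<open>x / 0 = 0\<close> for large \<open>n\<close>.
\<close>

definition insensitivity_seq ::
    "real measure \<Rightarrow> ereal \<Rightarrow> (nat \<Rightarrow> real) \<Rightarrow> (nat \<Rightarrow> real) \<Rightarrow> bool" where
  "insensitivity_seq F T b I \<longleftrightarrow>
     positive_seq I \<and>
     (\<lambda>n. b n / I n) \<longlonglongrightarrow> 0 \<and>
     (\<forall>\<^sub>F n in sequentially. \<forall>x\<ge>I n. 0 < measure F (window T x)) \<and>
     (\<lambda>n. SUP x\<in>{I n..}. SUP t\<in>{0..b n}.
            ereal \<bar>measure F (window T (x - t)) / measure F (window T x) - 1\<bar>) \<longlonglongrightarrow> 0"

definition truncation_seq ::
    "'a measure \<Rightarrow> (nat \<Rightarrow> 'a \<Rightarrow> real) \<Rightarrow> real measure \<Rightarrow> ereal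
      \<Rightarrow> (nat \<Rightarrow> real) \<Rightarrow> (nat \<Rightarrow> real) \<Rightarrow> bool" where
  "truncation_seq M \<xi> F T b h \<longleftrightarrow>
     positive_seq h \<and>
     (\<forall>\<^sub>F n in sequentially. \<forall>x\<ge>h n. 0 < measure F (window T x)) \<and>
     ((\<lambda>K::real. limsup (\<lambda>n. SUP x\<in>{h n..}.
         ereal (real n * \<P>(\<omega> in M. partial_sum \<xi> 2 \<omega> \<in> window T x \<and>
                                  \<xi> 1 \<omega> \<in> {..< - K * b n} \<union> {h n <..} \<and>
                                  \<xi> 2 \<omega> \<in> {..< - K * b n} \<union> {h n <..})
                / measure F (window T x)))) \<longlongrightarrow> 0) at_top"

definition small_steps_seq ::
    "'a measure \<Rightarrow> (nat \<Rightarrow> 'a \<Rightarrow> real) \<Rightarrow> real measure \<Rightarrow> ereal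
      \<Rightarrow> (nat \<Rightarrow> real) \<Rightarrow> (nat \<Rightarrow> real) \<Rightarrow> bool" where
  "small_steps_seq M \<xi> F T h J \<longleftrightarrow>
     positive_seq J \<and>
     (\<forall>\<^sub>F n in sequentially. \<forall>x\<ge>J n. 0 < measure F (window T x)) \<and>
     (\<lambda>n. SUP x\<in>{J n..}. SUP z\<in>{x..}.
         ereal (\<P>(\<omega> in M. partial_sum \<xi> n \<omega> \<in> window T z \<and> (\<forall>i\<in>{1..n}. \<xi> i \<omega> \<le> h n))
                / (real n * measure F (window T x)))) \<longlonglongrightarrow> 0"

end

theory Submission
  imports Defs
begin

text \<open>
  Call a step big if it exceeds \<open>h n\<close> or is below \<open>- K * b n\<close>, and expand the law of the sum according
  to the number \<open>k\<close> of big steps. The truncation hypothesis shows by induction that \<open>k\<close> big steps land in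
  a window with probability at most \<open>k! (2 \<epsilon> / n) ^ (k - 1)\<close> times that of one step, so the terms
  \<open>k \<ge> 2\<close> form a geometric series with small ratio. Summing the truncation bound over windows also gives
  \<open>n P(\<xi> > h n) \<rightarrow> 0\<close>.

  For \<open>k \<ge> 1\<close> the sum \<open>s\<close> of the small steps shifts the window. If \<open>s \<le> J n\<close>, then the shifted window
  still lies beyond \<open>I n\<close>, and insensitivity costs a factor \<open>exp (\<eta> * (\<bar>s\<bar> / b n + 1))\<close> with \<open>\<eta> \<rightarrow> 0\<close>.
  This is harmless because \<open>exp (\<sigma> * \<bar>s\<bar> / b n)\<close> has bounded expectation for some \<open>\<sigma> > 0\<close>: tightness
  keeps the \<open>n\<close>-th power of the characteristic function \<open>\<phi>\<close> near 1 on \<open>\<bar>t\<bar> \<le> \<tau> / b n\<close>, hence by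
  continuity \<open>\<bar>\<phi> t - 1\<bar> = O(1 / n)\<close> there, and \<open>exp v \<le> 1 + sin v + 3 * (1 - cos v)\<close> for \<open>v \<le> 1\<close>.
  If \<open>s > J n\<close>, the small-steps bound replaces the small steps by one additional big step and gains a
  factor tending to 0; it extends to fewer than \<open>n\<close> steps by appending steps in a fixed interval.

  The lower bound keeps only \<open>k = 1\<close>; summing the small-steps bound over windows shows that
  \<open>P(s > J n)\<close> tends to 0.
\<close>

section \<open>Convolution powers of finite measures\<close>

text \<open>The order in which the constants are fixed matters. Truncation makes
  \<open>\<epsilon>\<close> small only for large \<open>K\<close>. A large \<open>K\<close> admits
  long negative small steps, so the exponential moment is available only at rate
  \<open>\<sigma> / b n\<close> with \<open>\<sigma> \<le> 1 / K\<close>; on the positive side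
  \<open>h = O(b)\<close> plays the part of \<open>K\<close>. A small \<open>\<sigma>\<close> does
  no harm: the insensitivity error \<open>\<eta>\<close> is chosen after it, and the price of a
  shift tends to 1 with \<open>\<eta>\<close>. The factor k! for k big steps is paid for by the
  choice of their positions: (n choose k) k! is at most n^k, against n^(1-k) from truncation, so one
  factor n survives for every k. For the same reason a loss C^k is admissible, as for supplying k
  missing small steps: C depends on \<open>F\<close> and \<open>T\<close> only, and
  \<open>\<epsilon>\<close> is chosen to beat it. Positive windows beyond \<open>h n\<close> make
  every right tail of \<open>F\<close> positive. Together with n P(\<xi> > h n) tending to 0 this
  forces \<open>h n\<close>, and hence \<open>b n\<close>, to infinity, so fixed intervals and a
  finite \<open>T\<close> are eventually short on the scale \<open>b n\<close>.\<close>

lemma mem_window: "s \<in> window T y \<longleftrightarrow> y < s \<and> ereal (s - y) \<le> T"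
proof
  assume "y < s \<and> ereal (s - y) \<le> T"
  then have "s - y \<in> Delta T" by (simp add: Delta_def)
  then have "y + (s - y) \<in> window T y" unfolding window_def by (rule imageI)
  then show "s \<in> window T y" by simp
qed (auto simp: window_def Delta_def)

lemma window_borel [measurable]: "window T y \<in> sets borel"
proof (cases T)
  case MInf
  then have "window T y = {}" by (auto simp: mem_window)
  then show ?thesis by simp
qed (simp_all add: window_finite window_infinite)

lemma window_shift: "u + s \<in> window T y \<longleftrightarrow> s \<in> window T (y - u)"
  by (auto simp: mem_window algebra_simps)

lemma measurable_window2 [measurable (raw)]:
  assumes [measurable]: "f \<in> borel_measurable N" "g \<in> borel_measurable N"
  shows "Measurable.pred N (\<lambda>x. f x \<in> window T (g x))"
  unfolding mem_window by measurable

text \<open>Keeping only big or only small steps loses mass, so the convolution calculus is set up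
  for finite measures and not for probability measures.\<close>

definition finite_borel :: "real measure \<Rightarrow> bool" where
  "finite_borel M \<longleftrightarrow> finite_measure M \<and> sets M = sets borel"

lemma finite_borelD:
  assumes "finite_borel M"
  shows "finite_measure M" "sets M = sets borel" "space M = UNIV"
proof -
  show "finite_measure M" "sets M = sets borel"
    using assms by (auto simp: finite_borel_def)
  then show "space M = UNIV" using sets_eq_imp_space_eq[of M borel] by simp
qed

lemma finite_borel_convolution:
  "finite_borel M \<Longrightarrow> finite_borel N \<Longrightarrow> finite_borel (M \<star> N)"
  unfolding finite_borel_def using convolution_finite[of M N] by auto

lemma finite_borel_fubini:
  assumes "finite_borel M" "finite_borel N"
    and f: "case_prod f \<in> borel_measurable (borel \<Otimes>\<^sub>M borel)"
  shows "(\<integral>\<^sup>+x. \<integral>\<^sup>+y. f x y \<partial>N \<partial>M) = (\<integral>\<^sup>+y. \<integral>\<^sup>+x. f x y \<partial>M \<partial>N)"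
proof -
  note [measurable_cong] = finite_borelD(2)[OF assms(1)] finite_borelD(2)[OF assms(2)]
  interpret M: finite_measure M using assms by (auto simp: finite_borel_def)
  interpret N: finite_measure N using assms by (auto simp: finite_borel_def)
  interpret pair_sigma_finite M N ..
  note [measurable] = f
  show ?thesis by (rule Fubini'[symmetric]) measurable
qed

lemma measurable_finite_borel_nn_integral:
  assumes "finite_borel N" and f: "case_prod f \<in> borel_measurable (M \<Otimes>\<^sub>M borel)"
  shows "(\<lambda>x. \<integral>\<^sup>+y. f x y \<partial>N) \<in> borel_measurable M"
proof -
  interpret N: finite_measure N using assms by (auto simp: finite_borel_def)
  note [measurable_cong] = finite_borelD(2)[OF assms(1)] and [measurable] = f
  show ?thesis by measurable
qed

lemma nn_integral_conv:
  assumes "finite_borel M" "finite_borel N" "f \<in> borel_measurable borel"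
  shows "(\<integral>\<^sup>+x. f x \<partial>(M \<star> N)) = (\<integral>\<^sup>+x. \<integral>\<^sup>+y. f (x + y) \<partial>N \<partial>M)"
  using assms by (auto simp: finite_borel_def intro!: nn_integral_convolution)

lemma emeasure_conv:
  assumes "finite_borel M" "finite_borel N" and [measurable]: "X \<in> sets borel"
  shows "emeasure (M \<star> N) X = (\<integral>\<^sup>+x. \<integral>\<^sup>+y. indicator X (x + y) \<partial>N \<partial>M)"
  using nn_integral_conv[OF assms(1,2), of "indicator X"] by simp

lemma emeasure_conv_ge:
  assumes M: "finite_borel M" and N: "finite_borel N"
    and [measurable]: "X \<in> sets borel" "Y \<in> sets borel" "Z \<in> sets borel"
    and sub: "\<And>x y. x \<in> X \<Longrightarrow> y \<in> Y \<Longrightarrow> x + y \<in> Z"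
  shows "emeasure M X * emeasure N Y \<le> emeasure (M \<star> N) Z"
proof -
  note [measurable_cong] = finite_borelD(2)[OF M] finite_borelD(2)[OF N]
  have "emeasure M X * emeasure N Y = (\<integral>\<^sup>+x. \<integral>\<^sup>+y. indicator X x * indicator Y y \<partial>N \<partial>M)"
    by (simp add: nn_integral_cmult nn_integral_multc)
  also have "\<dots> \<le> (\<integral>\<^sup>+x. \<integral>\<^sup>+y. indicator Z (x + y) \<partial>N \<partial>M)"
    using sub by (intro nn_integral_mono) (auto split: split_indicator)
  also have "\<dots> = emeasure (M \<star> N) Z" by (subst emeasure_conv[OF M N]) auto
  finally show ?thesis .
qed

lemma conv_commute:
  assumes "finite_borel M" "finite_borel N"
  shows "(M \<star> N) = (N \<star> M)"
  using assms by (intro convolution_commutative) (auto simp: finite_borel_def)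

lemma conv_assoc:
  assumes "finite_borel M" "finite_borel N" "finite_borel L"
  shows "(L \<star> (M \<star> N)) = ((L \<star> M) \<star> N)"
  using assms finite_borelD(3)[of M] finite_borelD(3)[of N]
  by (intro convolution_associative) (auto simp: finite_borel_def)

text \<open>For a restriction of the step law this is the law of the sum of \<open>k\<close> steps
  on the event that all of them lie in the restricting set. Power 0 is the point mass at 0, the law
  of the empty sum.\<close>

primrec conv_pow :: "real measure \<Rightarrow> nat \<Rightarrow> real measure" where
  "conv_pow M 0 = return borel 0"
| "conv_pow M (Suc k) = (M \<star> conv_pow M k)"

lemma finite_borel_return [simp]: "finite_borel (return borel x)"
  using prob_space_return[of x borel] by (auto simp: finite_borel_def prob_space_def)

lemma finite_borel_conv_pow: "finite_borel M \<Longrightarrow> finite_borel (conv_pow M k)"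
  by (induction k) (auto intro: finite_borel_convolution)

lemma nn_integral_conv_pow_Suc:
  assumes "finite_borel M" "f \<in> borel_measurable borel"
  shows "(\<integral>\<^sup>+x. f x \<partial>conv_pow M (Suc k)) = (\<integral>\<^sup>+x. \<integral>\<^sup>+y. f (x + y) \<partial>conv_pow M k \<partial>M)"
  using nn_integral_conv[OF assms(1) finite_borel_conv_pow[OF assms(1)] assms(2)] by simp

lemma conv_return:
  assumes "finite_borel M"
  shows "(M \<star> return borel 0) = M" "(return borel 0 \<star> M) = M"
proof -
  note [measurable_cong] = finite_borelD(2)[OF assms]
  show "(M \<star> return borel 0) = M"
  proof (rule measure_eqI)
    fix X assume "X \<in> sets (M \<star> return borel 0)"
    then have [measurable]: "X \<in> sets borel" by simp
    have "X \<in> sets M" by measurable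
    then show "emeasure (M \<star> return borel 0) X = emeasure M X"
      by (subst emeasure_conv[OF assms]) (auto simp: nn_integral_return)
  qed (simp add: finite_borelD[OF assms])
  then show "(return borel 0 \<star> M) = M" using conv_commute[OF assms, of "return borel 0"] by simp
qed

lemma conv_pow_1: "finite_borel M \<Longrightarrow> conv_pow M (Suc 0) = M"
  by (simp add: conv_return)

lemma conv_pow_2: "finite_borel M \<Longrightarrow> conv_pow M 2 = (M \<star> M)"
  by (simp add: conv_return numeral_2_eq_2)

text \<open>Not normalised: total masses are then probabilities of the restricting events, and
  splitting a measure along \<open>X\<close> and \<open>- X\<close> is additive.\<close>

definition restr :: "real measure \<Rightarrow> real set \<Rightarrow> real measure" where
  "restr M X = density M (indicator X)"

lemma nn_integral_restr:
  assumes "finite_borel M" "X \<in> sets borel" "f \<in> borel_measurable borel"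
  shows "(\<integral>\<^sup>+x. f x \<partial>restr M X) = (\<integral>\<^sup>+x. indicator X x * f x \<partial>M)"
  using assms finite_borelD(2)[OF assms(1)] measurable_cong_sets[of M borel borel borel]
  by (auto simp: restr_def intro!: nn_integral_density)

lemma emeasure_restr:
  assumes "finite_borel M" "X \<in> sets borel" "Y \<in> sets borel"
  shows "emeasure (restr M X) Y = emeasure M (X \<inter> Y)"
  using assms finite_borelD(2)[OF assms(1)]
  unfolding restr_def by (subst emeasure_density) (auto simp: indicator_inter_arith[symmetric])

lemma finite_borel_restr:
  assumes "finite_borel M" "X \<in> sets borel"
  shows "finite_borel (restr M X)"
proof -
  interpret finite_measure M using finite_borelD(1)[OF assms(1)] .
  have "emeasure (restr M X) UNIV \<noteq> \<infinity>"
    using emeasure_restr[OF assms, of UNIV] by (simp add: emeasure_finite)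
  then show ?thesis
    using finite_borelD[OF assms(1)]
    by (auto simp: finite_borel_def restr_def intro!: finite_measureI)
qed

text \<open>Stated for integrals of all nonnegative Borel functions and not for sets only, so that
  it applies directly to the inner integral of a convolution, which is again such a
  function.\<close>

definition dominated :: "real measure \<Rightarrow> real measure \<Rightarrow> bool" where
  "dominated M N \<longleftrightarrow> (\<forall>f\<in>borel_measurable borel. (\<integral>\<^sup>+x. f x \<partial>M) \<le> (\<integral>\<^sup>+x. f x \<partial>N))"

lemma dominated_refl [simp]: "dominated M M"
  by (simp add: dominated_def)

lemma dominated_emeasure:
  assumes "finite_borel M" "finite_borel N" "dominated M N" "X \<in> sets borel"
  shows "emeasure M X \<le> emeasure N X"
  using assms(3)[unfolded dominated_def, rule_format, of "indicator X"] assms(4)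
    finite_borelD[OF assms(1)] finite_borelD[OF assms(2)] by simp

lemma dominated_conv:
  assumes "finite_borel M" "finite_borel N" "finite_borel M'" "finite_borel N'"
    and MN: "dominated M M'" "dominated N N'"
  shows "dominated (M \<star> N) (M' \<star> N')"
  unfolding dominated_def
proof
  fix f :: "real \<Rightarrow> ennreal" assume [measurable]: "f \<in> borel_measurable borel"
  have [measurable]: "(\<lambda>x. \<integral>\<^sup>+y. f (x + y) \<partial>N') \<in> borel_measurable borel"
    by (rule measurable_finite_borel_nn_integral[OF assms(4)]) measurable
  have "(\<integral>\<^sup>+x. \<integral>\<^sup>+y. f (x + y) \<partial>N \<partial>M) \<le> (\<integral>\<^sup>+x. \<integral>\<^sup>+y. f (x + y) \<partial>N' \<partial>M)"
    using MN(2) by (intro nn_integral_mono) (simp add: dominated_def)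
  also have "\<dots> \<le> (\<integral>\<^sup>+x. \<integral>\<^sup>+y. f (x + y) \<partial>N' \<partial>M')"
    using MN(1) by (simp add: dominated_def)
  finally show "(\<integral>\<^sup>+x. f x \<partial>(M \<star> N)) \<le> (\<integral>\<^sup>+x. f x \<partial>(M' \<star> N'))"
    using assms by (simp add: nn_integral_conv)
qed

lemma dominated_conv_pow:
  assumes "finite_borel M" "finite_borel N" "dominated M N"
  shows "dominated (conv_pow M k) (conv_pow N k)"
  by (induction k) (auto intro!: dominated_conv assms finite_borel_conv_pow)

lemma dominated_restr:
  assumes "finite_borel M" "X \<in> sets borel" "Y \<in> sets borel" "X \<subseteq> Y"
  shows "dominated (restr M X) (restr M Y)"
  unfolding dominated_def using assms
  by (auto simp: nn_integral_restr intro!: nn_integral_mono split: split_indicator)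

lemma restr_UNIV: "finite_borel M \<Longrightarrow> restr M UNIV = M"
  by (simp add: restr_def density_1)

lemma nn_integral_restr_split:
  assumes M: "finite_borel M" and [measurable]: "X \<in> sets borel" "f \<in> borel_measurable borel"
  shows "(\<integral>\<^sup>+x. f x \<partial>M) = (\<integral>\<^sup>+x. f x \<partial>restr M X) + (\<integral>\<^sup>+x. f x \<partial>restr M (- X))"
proof -
  note [measurable_cong] = finite_borelD(2)[OF M]
  have "(\<integral>\<^sup>+x. f x \<partial>M) = (\<integral>\<^sup>+x. indicator X x * f x + indicator (- X) x * f x \<partial>M)"
    by (intro nn_integral_cong) (auto split: split_indicator)
  also have "\<dots> = (\<integral>\<^sup>+x. f x \<partial>restr M X) + (\<integral>\<^sup>+x. f x \<partial>restr M (- X))"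
    using M by (subst nn_integral_add) (auto simp: nn_integral_restr)
  finally show ?thesis .
qed

text \<open>Each step lies in \<open>X\<close> or in \<open>- X\<close>, and by commutativity of
  convolution only the number \<open>k\<close> of steps in \<open>X\<close> matters, not their
  positions. The function \<open>f\<close> is arbitrary because the induction splits off the first
  step \<open>u\<close> and needs the hypothesis for \<open>f\<close> shifted by
  \<open>u\<close>.\<close>

lemma nn_integral_conv_pow_binomial:
  assumes M: "finite_borel M" and X[measurable]: "X \<in> sets borel"
  shows "f \<in> borel_measurable borel \<Longrightarrow> (\<integral>\<^sup>+x. f x \<partial>conv_pow M n) =
    (\<Sum>k\<le>n. of_nat (n choose k) *
      (\<integral>\<^sup>+x. f x \<partial>(conv_pow (restr M X) k \<star> conv_pow (restr M (- X)) (n - k))))"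
proof (induction n arbitrary: f)
  case 0
  then show ?case by (simp add: conv_return)
next
  case (Suc n)
  note [measurable] = Suc.prems
  let ?A = "restr M X" and ?B = "restr M (- X)"
  have A: "finite_borel ?A" and B: "finite_borel ?B"
    using M by (auto intro!: finite_borel_restr)
  note fb = A B finite_borel_conv_pow finite_borel_convolution
  define N where "N k j = (conv_pow ?A k \<star> conv_pow ?B j)" for k j
  have N: "finite_borel (N k j)" for k j unfolding N_def by (intro fb)
  have meas[measurable]: "(\<lambda>u. \<integral>\<^sup>+s. f (u + s) \<partial>L) \<in> borel_measurable borel" if "finite_borel L" for L
    by (rule measurable_finite_borel_nn_integral[OF that]) measurable
  have measM: "(\<lambda>u. \<integral>\<^sup>+s. f (u + s) \<partial>N k j) \<in> borel_measurable M" for k j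
    using meas[OF N] measurable_cong_sets[OF finite_borelD(2)[OF M] refl] by blast
  have AN: "(?A \<star> N k j) = N (Suc k) j" for k j
    unfolding N_def by (simp add: conv_assoc fb)
  have BN: "(?B \<star> N k j) = N k (Suc j)" for k j
  proof -
    have "(?B \<star> N k j) = ((?B \<star> conv_pow ?A k) \<star> conv_pow ?B j)"
      unfolding N_def by (intro conv_assoc fb)
    also have "(?B \<star> conv_pow ?A k) = (conv_pow ?A k \<star> ?B)" by (intro conv_commute fb)
    also have "(\<dots> \<star> conv_pow ?B j) = N k (Suc j)"
      unfolding N_def by (simp add: conv_assoc[symmetric] fb)
    finally show ?thesis .
  qed
  have sp: "(\<integral>\<^sup>+u. \<integral>\<^sup>+s. f (u + s) \<partial>L \<partial>M) = (\<integral>\<^sup>+x. f x \<partial>(?A \<star> L)) + (\<integral>\<^sup>+x. f x \<partial>(?B \<star> L))"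
    if "finite_borel L" for L
    using that by (subst nn_integral_restr_split[OF M X]) (auto simp: nn_integral_conv fb)
  have "(\<integral>\<^sup>+x. f x \<partial>conv_pow M (Suc n)) = (\<integral>\<^sup>+u. \<integral>\<^sup>+s. f (u + s) \<partial>conv_pow M n \<partial>M)"
    by (rule nn_integral_conv_pow_Suc[OF M]) measurable
  also have "\<dots> = (\<integral>\<^sup>+u. (\<Sum>k\<le>n. of_nat (n choose k) * (\<integral>\<^sup>+s. f (u + s) \<partial>N k (n - k))) \<partial>M)"
    unfolding N_def by (intro nn_integral_cong Suc.IH) measurable
  also have "\<dots> = (\<Sum>k\<le>n. of_nat (n choose k) * (\<integral>\<^sup>+u. \<integral>\<^sup>+s. f (u + s) \<partial>N k (n - k) \<partial>M))"
    using measM by (subst nn_integral_sum) (simp_all add: nn_integral_cmult)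
  also have "\<dots> = (\<Sum>k\<le>n. of_nat (n choose k) * (\<integral>\<^sup>+x. f x \<partial>N (Suc k) (n - k))) +
      (\<Sum>k\<le>n. of_nat (n choose k) * (\<integral>\<^sup>+x. f x \<partial>N k (Suc (n - k))))"
    by (simp add: sp N AN BN distrib_left sum.distrib)
  \<comment> \<open>Pascal's rule: the first sum is shifted by one, and in the second the added term
    at \<open>k = Suc n\<close> vanishes.\<close>
  also have "\<dots> = (\<Sum>k\<le>Suc n. of_nat (Suc n choose k) * (\<integral>\<^sup>+x. f x \<partial>N k (Suc n - k)))"
  proof -
    let ?a = "\<lambda>k. \<integral>\<^sup>+x. f x \<partial>N k (Suc n - k)"
    have "(\<Sum>k\<le>Suc n. of_nat (Suc n choose k) * ?a k) =
        ?a 0 + (\<Sum>k\<le>n. of_nat (Suc n choose Suc k) * ?a (Suc k))"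
      by (subst sum.atMost_Suc_shift) simp
    also have "\<dots> = ?a 0 + (\<Sum>k\<le>n. of_nat (n choose Suc k) * ?a (Suc k)) +
        (\<Sum>k\<le>n. of_nat (n choose k) * ?a (Suc k))"
      by (simp add: distrib_right sum.distrib algebra_simps)
    also have "?a 0 + (\<Sum>k\<le>n. of_nat (n choose Suc k) * ?a (Suc k)) =
        (\<Sum>k\<le>Suc n. of_nat (n choose k) * ?a k)"
      by (subst sum.atMost_Suc_shift) simp
    also have "\<dots> = (\<Sum>k\<le>n. of_nat (n choose k) * ?a k)"
      by simp
    also have "\<dots> = (\<Sum>k\<le>n. of_nat (n choose k) * (\<integral>\<^sup>+x. f x \<partial>N k (Suc (n - k))))"
      by (intro sum.cong) (auto simp: Suc_diff_le)
    finally show ?thesis by (simp add: add.commute)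
  qed
  finally show ?case unfolding N_def .
qed

lemma emeasure_conv_pow_UNIV:
  assumes "finite_borel M"
  shows "emeasure (conv_pow M k) UNIV = emeasure M UNIV ^ k"
proof (induction k)
  case (Suc k)
  show ?case
    using emeasure_conv[OF assms finite_borel_conv_pow[OF assms], of UNIV k]
      finite_borelD[OF assms] finite_borelD[OF finite_borel_conv_pow[OF assms], of k] Suc.IH
    by (simp add: mult.commute)
qed simp

lemma nn_integral_conv_pow_exp:
  assumes "finite_borel M"
  shows "(\<integral>\<^sup>+x. ennreal (exp (c * x)) \<partial>conv_pow M k) = (\<integral>\<^sup>+x. ennreal (exp (c * x)) \<partial>M) ^ k"
proof (induction k)
  case 0
  show ?case by (simp add: nn_integral_return)
next
  case (Suc k)
  note [measurable_cong] = finite_borelD(2)[OF assms] finite_borelD(2)[OF finite_borel_conv_pow[OF assms]]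
  have "(\<integral>\<^sup>+x. ennreal (exp (c * x)) \<partial>conv_pow M (Suc k)) =
      (\<integral>\<^sup>+x. \<integral>\<^sup>+y. ennreal (exp (c * x)) * ennreal (exp (c * y)) \<partial>conv_pow M k \<partial>M)"
    by (subst nn_integral_conv_pow_Suc[OF assms])
       (auto simp: exp_add distrib_left ennreal_mult intro!: nn_integral_cong)
  also have "\<dots> = (\<integral>\<^sup>+x. ennreal (exp (c * x)) \<partial>M) * (\<integral>\<^sup>+y. ennreal (exp (c * y)) \<partial>conv_pow M k)"
    by (simp add: nn_integral_cmult nn_integral_multc)
  finally show ?case using Suc.IH by simp
qed

section \<open>Sums of big jumps\<close>

text \<open>Consecutive windows of length \<open>r\<close>, the first one at \<open>z\<close>, cover
  the wide window; each begins at or after \<open>z\<close>, where \<open>bound\<close>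
  applies.\<close>

lemma emeasure_window_widen:
  assumes M: "finite_borel M" and T: "0 < T"
    and bound: "\<And>z'. z \<le> z' \<Longrightarrow> emeasure M (window T z') \<le> \<beta>"
    and r: "T = ereal r"
  shows "emeasure M (window (T + ereal (real m * r)) z) \<le> of_nat (Suc m) * \<beta>"
proof -
  have "0 < r" using T r by simp
  note [measurable_cong] = finite_borelD(2)[OF M]
  show "emeasure M (window (T + ereal (real m * r)) z) \<le> of_nat (Suc m) * \<beta>"
  proof (induction m)
    case 0
    then show ?case using bound[of z] by (simp add: zero_ereal_def[symmetric])
  next
    case (Suc m)
    have "0 \<le> real m * r" using \<open>0 < r\<close> by simp
    have "window (T + ereal (real (Suc m) * r)) z \<subseteq>
        window (T + ereal (real m * r)) z \<union> window T (z + real (Suc m) * r)"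
      using r by (auto simp: mem_window algebra_simps)
    then have "emeasure M (window (T + ereal (real (Suc m) * r)) z) \<le>
        emeasure M (window (T + ereal (real m * r)) z \<union> window T (z + real (Suc m) * r))"
      by (intro emeasure_mono) (auto simp: finite_borelD[OF M])
    also have "\<dots> \<le> emeasure M (window (T + ereal (real m * r)) z) + emeasure M (window T (z + real (Suc m) * r))"
      by (intro emeasure_subadditive) (auto simp: finite_borelD[OF M])
    also have "\<dots> \<le> of_nat (Suc m) * \<beta> + \<beta>"
      using \<open>0 < r\<close> by (intro add_mono Suc.IH bound) simp
    finally show ?case by (simp add: distrib_right add.commute add.left_commute)
  qed
qed

text \<open>For finite \<open>T\<close> the half-line is a disjoint union of consecutive windows,
  over which the bounds add up; for infinite \<open>T\<close> it is itself a window.\<close>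

lemma emeasure_window_le_tail:
  assumes N: "finite_borel N" and F: "finite_borel F" and T: "0 < T"
    and le: "\<And>z. c \<le> z \<Longrightarrow> emeasure N (window T z) \<le> \<beta> * emeasure F (window T z)"
  shows "emeasure N {c<..} \<le> \<beta> * emeasure F {c<..}"
proof (cases T)
  case PInf
  then show ?thesis using le[of c] by (simp add: window_infinite)
next
  case MInf
  then show ?thesis using T by simp
next
  case (real r)
  then have r: "0 < r" using T by simp
  let ?W = "\<lambda>j::nat. window T (c + real j * r)"
  have disj: "disjoint_family ?W"
  proof -
    have "?W i \<inter> ?W j = {}" if "i < j" for i j
    proof -
      have "real i * r + r \<le> real j * r"
        using that r mult_right_mono[of "real i + 1" "real j" r] by (simp add: distrib_right)
      then show ?thesis using real by (auto simp: mem_window)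
    qed
    then show ?thesis
      unfolding disjoint_family_on_def by (metis inf_commute linorder_neqE_nat)
  qed
  have un: "(\<Union>j. ?W j) = {c<..}"
  proof
    show "(\<Union>j. ?W j) \<subseteq> {c<..}" using r
      by (auto simp: mem_window) (smt (verit, best) mult_nonneg_nonneg of_nat_0_le_iff)
    show "{c<..} \<subseteq> (\<Union>j. ?W j)"
    proof
      fix s assume "s \<in> {c<..}"
      then have s: "0 < (s - c) / r" using r by simp
      \<comment> \<open>Windows are open on the left and closed on the right, so the index is a
        ceiling minus one and not a floor.\<close>
      define j where "j = nat (\<lceil>(s - c) / r\<rceil> - 1)"
      have cl: "1 \<le> \<lceil>(s - c) / r\<rceil>" using s by linarith
      then have j: "real j = of_int \<lceil>(s - c) / r\<rceil> - 1" by (simp add: j_def)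
      have "real j < (s - c) / r" "(s - c) / r \<le> real j + 1" using j by linarith+
      then have "real j * r < s - c" "s - c \<le> real j * r + r"
        using r by (auto simp: field_simps)
      then have "s \<in> ?W j" using real by (auto simp: mem_window)
      then show "s \<in> (\<Union>j. ?W j)" by blast
    qed
  qed
  have "emeasure N {c<..} = (\<Sum>j. emeasure N (?W j))"
    unfolding un[symmetric] using disj
    by (intro suminf_emeasure[symmetric]) (auto simp: finite_borelD[OF N])
  also have "\<dots> \<le> (\<Sum>j. \<beta> * emeasure F (?W j))"
    using r by (intro suminf_le le) auto
  also have "\<dots> = \<beta> * (\<Sum>j. emeasure F (?W j))" by simp
  also have "(\<Sum>j. emeasure F (?W j)) = emeasure F {c<..}"
    unfolding un[symmetric] using disj
    by (intro suminf_emeasure) (auto simp: finite_borelD[OF F])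
  finally show ?thesis .
qed

lemma measurable_emeasure_window [measurable]:
  assumes "finite_borel N"
  shows "(\<lambda>u. emeasure N (window T (y - u))) \<in> borel_measurable borel"
proof -
  have "(\<lambda>u. \<integral>\<^sup>+s. indicator (window T (y - u)) s \<partial>N) \<in> borel_measurable borel"
    by (rule measurable_finite_borel_nn_integral[OF assms]) measurable
  then show ?thesis by (simp add: finite_borelD[OF assms])
qed

lemma emeasure_conv_window:
  assumes "finite_borel M" "finite_borel N"
  shows "emeasure (M \<star> N) (window T y) = (\<integral>\<^sup>+u. emeasure N (window T (y - u)) \<partial>M)"
proof -
  have "(\<integral>\<^sup>+s. indicator (window T y) (u + s) \<partial>N) = emeasure N (window T (y - u))" for u
  proof -
    have "(\<integral>\<^sup>+s. indicator (window T y) (u + s) \<partial>N) = (\<integral>\<^sup>+s. indicator (window T (y - u)) s \<partial>N)"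
      by (intro nn_integral_cong) (auto simp: window_shift split: split_indicator)
    then show ?thesis using finite_borelD[OF assms(2)] by simp
  qed
  then show ?thesis using assms by (simp add: emeasure_conv)
qed

text \<open>Either all steps lie in \<open>X\<close> or at least one does not. A union bound over
  the position of such a step gives \<open>Suc k\<close> equal terms, in which the other steps are
  unconstrained.\<close>

lemma conv_pow_peel:
  assumes A: "finite_borel A" and [measurable]: "X \<in> sets borel"
  shows "f \<in> borel_measurable borel \<Longrightarrow> (\<integral>\<^sup>+x. f x \<partial>conv_pow A (Suc k)) \<le> (\<integral>\<^sup>+x. f x \<partial>conv_pow (restr A X) (Suc k)) +
     of_nat (Suc k) * (\<integral>\<^sup>+x. f x \<partial>(restr A (- X) \<star> conv_pow A k))"
proof (induction k arbitrary: f)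
  case 0
  then show ?case
    using A by (simp add: conv_return finite_borel_restr nn_integral_restr_split[of A X])
next
  case (Suc k)
  note [measurable] = Suc.prems
  let ?R = "restr A X" and ?L = "restr A (- X)"
  have R: "finite_borel ?R" and L: "finite_borel ?L"
    using A by (auto intro!: finite_borel_restr)
  note fb = A R L finite_borel_conv_pow finite_borel_convolution
  have meas[measurable]: "(\<lambda>u. \<integral>\<^sup>+s. f (u + s) \<partial>N) \<in> borel_measurable borel" if "finite_borel N" for N
    by (rule measurable_finite_borel_nn_integral[OF that]) measurable
  have meas': "(\<lambda>u. \<integral>\<^sup>+s. f (u + s) \<partial>N) \<in> borel_measurable ?R" if "finite_borel N" for N
    using meas[OF that] measurable_cong_sets[OF finite_borelD(2)[OF R] refl] by blast
  have ps: "(\<integral>\<^sup>+x. f x \<partial>conv_pow N (Suc (Suc k))) = (\<integral>\<^sup>+u. \<integral>\<^sup>+s. f (u + s) \<partial>conv_pow N (Suc k) \<partial>N)"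
    if "finite_borel N" for N
    by (rule nn_integral_conv_pow_Suc[OF that Suc.prems])
  have "(\<integral>\<^sup>+x. f x \<partial>conv_pow A (Suc (Suc k))) =
      (\<integral>\<^sup>+u. \<integral>\<^sup>+s. f (u + s) \<partial>conv_pow A (Suc k) \<partial>?R) + (\<integral>\<^sup>+x. f x \<partial>(?L \<star> conv_pow A (Suc k)))"
    unfolding ps[OF A] by (subst nn_integral_restr_split[OF A, of X])
      (simp_all add: meas fb nn_integral_conv del: conv_pow.simps)
  also have "(\<integral>\<^sup>+u. \<integral>\<^sup>+s. f (u + s) \<partial>conv_pow A (Suc k) \<partial>?R) \<le>
     (\<integral>\<^sup>+u. ((\<integral>\<^sup>+s. f (u + s) \<partial>conv_pow ?R (Suc k)) +
       of_nat (Suc k) * (\<integral>\<^sup>+s. f (u + s) \<partial>(?L \<star> conv_pow A k))) \<partial>?R)"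
    by (intro nn_integral_mono Suc.IH) measurable
  also have "\<dots> = (\<integral>\<^sup>+x. f x \<partial>conv_pow ?R (Suc (Suc k))) +
       of_nat (Suc k) * (\<integral>\<^sup>+x. f x \<partial>(?R \<star> (?L \<star> conv_pow A k)))"
    unfolding ps[OF R]
    using meas'[of "conv_pow ?R (Suc k)"] meas'[of "?L \<star> conv_pow A k"]
      nn_integral_conv[of ?R "?L \<star> conv_pow A k" f]
    by (subst nn_integral_add) (simp_all add: nn_integral_cmult fb del: conv_pow.simps)
  also have "(?R \<star> (?L \<star> conv_pow A k)) = (?L \<star> (?R \<star> conv_pow A k))"
    using conv_assoc[of ?L "conv_pow A k" ?R] conv_assoc[of ?R "conv_pow A k" ?L]
      conv_commute[of ?R ?L] by (simp add: fb)
  finally have le: "(\<integral>\<^sup>+x. f x \<partial>conv_pow A (Suc (Suc k))) \<le>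
      ((\<integral>\<^sup>+x. f x \<partial>conv_pow ?R (Suc (Suc k))) +
      of_nat (Suc k) * (\<integral>\<^sup>+x. f x \<partial>(?L \<star> (?R \<star> conv_pow A k)))) +
      (\<integral>\<^sup>+x. f x \<partial>(?L \<star> conv_pow A (Suc k)))"
    by (simp add: add_right_mono del: conv_pow.simps)
  \<comment> \<open>Forgetting that the first step lies in \<open>X\<close> only increases the
    measure; the term then joins the one whose first step is exceptional.\<close>
  have "dominated (?L \<star> (?R \<star> conv_pow A k)) (?L \<star> conv_pow A (Suc k))"
    using dominated_restr[of A X UNIV] A
    by (simp add: restr_UNIV) (intro dominated_conv fb dominated_refl)
  then have "(\<integral>\<^sup>+x. f x \<partial>(?L \<star> (?R \<star> conv_pow A k))) \<le> (\<integral>\<^sup>+x. f x \<partial>(?L \<star> conv_pow A (Suc k)))"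
    using Suc.prems unfolding dominated_def by blast
  then have "((\<integral>\<^sup>+x. f x \<partial>conv_pow ?R (Suc (Suc k))) +
      of_nat (Suc k) * (\<integral>\<^sup>+x. f x \<partial>(?L \<star> (?R \<star> conv_pow A k)))) +
      (\<integral>\<^sup>+x. f x \<partial>(?L \<star> conv_pow A (Suc k))) \<le>
      ((\<integral>\<^sup>+x. f x \<partial>conv_pow ?R (Suc (Suc k))) +
      of_nat (Suc k) * (\<integral>\<^sup>+x. f x \<partial>(?L \<star> conv_pow A (Suc k)))) +
      (\<integral>\<^sup>+x. f x \<partial>(?L \<star> conv_pow A (Suc k)))"
    by (intro add_mono mult_left_mono order_refl) auto
  from order_trans[OF le this] show ?case
    by (simp add: distrib_right add.assoc add.commute add.left_commute del: conv_pow.simps)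
qed

text \<open>With all steps above \<open>z\<close> and \<open>y \<le> 2 * z\<close>, two of them
  already pass the left end of the window, so only the upper constraint is active. That constraint
  survives the removal of a positive step, and each removed step costs at most the total mass
  \<open>e\<close>.\<close>

lemma conv_pow_window_all_large:
  assumes F: "finite_borel R" and pos: "emeasure R {..z} = 0" "y \<le> 2 * z" "0 \<le> z"
    and e: "emeasure R UNIV \<le> e"
  shows "emeasure (conv_pow R (Suc (Suc k))) (window T y) \<le> e ^ k * emeasure (R \<star> R) (window T y)"
proof -
  \<comment> \<open>The window without its left end; for infinite \<open>T\<close> this is the whole
    line.\<close>
  define U where "U = {s. ereal (s - y) \<le> T}"
  have [measurable]: "U \<in> sets borel" unfolding U_def by measurable
  note fb = F finite_borel_conv_pow finite_borel_convolution
  have AE: "AE u in R. z < u"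
  proof (rule AE_I)
    show "{u \<in> space R. \<not> z < u} \<subseteq> {..z}" by auto
    show "emeasure R {..z} = 0" by fact
    show "{..z} \<in> sets R" using finite_borelD(2)[OF F] by simp
  qed
  have "emeasure (conv_pow R (Suc (Suc k))) U \<le> e ^ k * emeasure (R \<star> R) U"
  proof (induction k)
    case 0
    then show ?case using conv_pow_2[OF F] by (simp add: numeral_2_eq_2)
  next
    case (Suc k)
    let ?P = "conv_pow R (Suc (Suc k))"
    have P: "finite_borel ?P" by (intro fb)
    have "emeasure (conv_pow R (Suc (Suc (Suc k)))) U = (\<integral>\<^sup>+u. \<integral>\<^sup>+s. indicator U (u + s) \<partial>?P \<partial>R)"
      using emeasure_conv[OF F P, of U] by simp
    also have "\<dots> \<le> (\<integral>\<^sup>+u. emeasure ?P U \<partial>R)"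
    proof (rule nn_integral_mono_AE)
      show "AE u in R. (\<integral>\<^sup>+s. indicator U (u + s) \<partial>?P) \<le> emeasure ?P U"
        using AE
      proof eventually_elim
        case (elim u)
        have "(\<integral>\<^sup>+s. indicator U (u + s) \<partial>?P) \<le> (\<integral>\<^sup>+s. indicator U s \<partial>?P)"
        proof (rule nn_integral_mono)
          fix s
          have "u + s \<in> U \<Longrightarrow> s \<in> U"
          proof -
            assume "u + s \<in> U"
            then have "ereal (u + s - y) \<le> T" by (simp add: U_def)
            moreover have "ereal (s - y) \<le> ereal (u + s - y)" using elim pos by simp
            ultimately show "s \<in> U" unfolding U_def using order_trans by blast
          qed
          then show "(indicator U (u + s) :: ennreal) \<le> indicator U s" by (auto split: split_indicator)
        qed
        also have "\<dots> = emeasure ?P U"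
          using finite_borelD(2)[OF P] by (simp del: conv_pow.simps)
        finally show ?case .
      qed
    qed
    also have "\<dots> = emeasure ?P U * emeasure R UNIV"
      using finite_borelD(3)[OF F] by (simp del: conv_pow.simps)
    also have "\<dots> \<le> (e ^ k * emeasure (R \<star> R) U) * e"
      by (intro mult_mono Suc.IH e) auto
    finally show ?case by (simp add: mult_ac)
  qed
  moreover have "emeasure (R \<star> R) U = emeasure (R \<star> R) (window T y)"
  proof -
    have "(\<integral>\<^sup>+u. \<integral>\<^sup>+s. indicator U (u + s) \<partial>R \<partial>R) = (\<integral>\<^sup>+u. \<integral>\<^sup>+s. indicator (window T y) (u + s) \<partial>R \<partial>R)"
    proof (intro nn_integral_cong_AE)
      show "AE u in R. (\<integral>\<^sup>+s. indicator U (u + s) \<partial>R) = (\<integral>\<^sup>+s. indicator (window T y) (u + s) \<partial>R)"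
        using AE
      proof eventually_elim
        case (elim u)
        show ?case
          by (rule nn_integral_cong_AE, use AE in eventually_elim)
             (use elim pos in \<open>auto simp: U_def mem_window split: split_indicator\<close>)
      qed
    qed
    then show ?thesis using emeasure_conv[OF F F] by simp
  qed
  moreover have "emeasure (conv_pow R (Suc (Suc k))) (window T y) \<le> emeasure (conv_pow R (Suc (Suc k))) U"
  proof (rule emeasure_mono)
    show "window T y \<subseteq> U" by (auto simp: U_def mem_window)
    show "U \<in> sets (conv_pow R (Suc (Suc k)))" by simp
  qed
  ultimately show ?thesis by simp
qed

text \<open>A step \<open>u \<le> y - h\<close> leaves the others with a window at
  \<open>y - u \<ge> h\<close>. There the induction hypothesis replaces them by a single step, and
  \<open>pair\<close> bounds the two that remain. If no step is that small,
  \<open>conv_pow_window_all_large\<close> applies.\<close>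

lemma conv_pow_big_window:
  assumes F: "finite_borel F" and c: "0 \<le> c" and h: "0 \<le> h"
    and A_def: "A = restr F ({..< - c} \<union> {h<..})"
    and pair: "\<And>y. h \<le> y \<Longrightarrow> emeasure (A \<star> A) (window T y) \<le> e * emeasure F (window T y)"
    and tail: "emeasure F {h<..} \<le> e"
    and y: "h \<le> y"
  shows "emeasure (conv_pow A (Suc k)) (window T y) \<le> fact (Suc k) * (2 * e) ^ k * emeasure F (window T y)"
  using y
proof (induction k arbitrary: y)
  let ?D = "{..< - c} \<union> {h<..}"
  have D: "?D \<in> sets borel" by measurable
  have A: "finite_borel A" unfolding A_def by (intro finite_borel_restr F D)
  {
    case 0
    show ?case
      using emeasure_restr[OF F D, of "window T y"] A
      by (simp add: conv_pow_1[unfolded One_nat_def] conv_return A_def[symmetric])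
         (auto intro!: emeasure_mono simp: finite_borelD[OF F])
  next
    case (Suc k)
    let ?w = "\<lambda>y. emeasure F (window T y)"
    let ?C = "fact (Suc k) * (2 * e) ^ k"
    let ?R = "restr A {y - h<..}" and ?L = "restr A (- {y - h<..})"
    have R: "finite_borel ?R" and L: "finite_borel ?L" using A by (auto intro!: finite_borel_restr)
    note fb = A R L finite_borel_conv_pow finite_borel_convolution
    have big: "emeasure A (window T z) = ?w z" if "h \<le> z" for z
    proof -
      have "?D \<inter> window T z = window T z" using that by (auto simp: mem_window)
      then show ?thesis using emeasure_restr[OF F D, of "window T z"] by (simp add: A_def)
    qed
    have "emeasure (conv_pow A (Suc (Suc k))) (window T y) \<le>
        emeasure (conv_pow ?R (Suc (Suc k))) (window T y) +
        of_nat (Suc (Suc k)) * emeasure (?L \<star> conv_pow A (Suc k)) (window T y)"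
      using conv_pow_peel[OF A, of "{y - h<..}" "indicator (window T y)" "Suc k"]
      by (simp add: emeasure_conv fb)
    also have "emeasure (?L \<star> conv_pow A (Suc k)) (window T y) \<le> ?C * emeasure (A \<star> A) (window T y)"
    proof -
      have "emeasure (?L \<star> conv_pow A (Suc k)) (window T y) =
          (\<integral>\<^sup>+u. emeasure (conv_pow A (Suc k)) (window T (y - u)) \<partial>?L)"
        by (intro emeasure_conv_window fb)
      also have "\<dots> = (\<integral>\<^sup>+u. indicator (- {y - h<..}) u * emeasure (conv_pow A (Suc k)) (window T (y - u)) \<partial>A)"
        using measurable_emeasure_window[of "conv_pow A (Suc k)"]
        by (intro nn_integral_restr[OF A]) (auto simp: fb)
      also have "\<dots> \<le> (\<integral>\<^sup>+u. ?C * emeasure A (window T (y - u)) \<partial>A)"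
      proof (rule nn_integral_mono)
        fix u
        show "indicator (- {y - h<..}) u * emeasure (conv_pow A (Suc k)) (window T (y - u)) \<le>
            ?C * emeasure A (window T (y - u))"
          using Suc.IH[of "y - u"] big[of "y - u"] by (cases "y - h < u") auto
      qed
      also have "\<dots> = ?C * emeasure (A \<star> A) (window T y)"
        using measurable_emeasure_window[OF A, of T y] measurable_cong_sets[OF finite_borelD(2)[OF A] refl]
        by (subst nn_integral_cmult) (auto simp: emeasure_conv_window[OF A A])
      finally show ?thesis .
    qed
    also have "emeasure (conv_pow ?R (Suc (Suc k))) (window T y) \<le> e ^ k * emeasure (?R \<star> ?R) (window T y)"
    \<comment> \<open>As \<open>h\<close> and \<open>y - h\<close> sum to \<open>y\<close>, their
      maximum is at least half of \<open>y\<close>. A big step above \<open>y - h \<ge> 0\<close> is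
      not below \<open>- c\<close>, so it exceeds \<open>h\<close> too.\<close>
    proof (rule conv_pow_window_all_large[OF R, of "max h (y - h)"])
      have "{y - h<..} \<inter> {..max h (y - h)} \<inter> ?D = {}" using c Suc.prems by auto
      then have "?D \<inter> ({y - h<..} \<inter> {..max h (y - h)}) = {}" by blast
      then show "emeasure ?R {..max h (y - h)} = 0"
        using emeasure_restr[OF A, of "{y - h<..}" "{..max h (y - h)}"]
          emeasure_restr[OF F D, of "{y - h<..} \<inter> {..max h (y - h)}"] by (simp add: A_def)
      have "emeasure ?R UNIV = emeasure F (?D \<inter> {y - h<..})"
        using emeasure_restr[OF A, of "{y - h<..}" UNIV] emeasure_restr[OF F D, of "{y - h<..}"]
        by (simp add: A_def)
      also have "\<dots> \<le> emeasure F {h<..}"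
        using c Suc.prems by (intro emeasure_mono) (auto simp: finite_borelD[OF F])
      finally show "emeasure ?R UNIV \<le> e" using tail by simp
    qed (use h Suc.prems in \<open>auto simp: max_def\<close>)
    also have "emeasure (?R \<star> ?R) (window T y) \<le> emeasure (A \<star> A) (window T y)"
      using dominated_restr[of A "{y - h<..}" UNIV] A
      by (intro dominated_emeasure dominated_conv fb) (simp_all add: restr_UNIV)
    also have "emeasure (A \<star> A) (window T y) \<le> e * ?w y" using pair Suc.prems by simp
    finally have "emeasure (conv_pow A (Suc (Suc k))) (window T y) \<le>
        e ^ k * (e * ?w y) + of_nat (Suc (Suc k)) * (?C * (e * ?w y))"
      by (simp add: add_mono mult_left_mono del: conv_pow.simps of_nat_Suc fact_Suc)
    also have "\<dots> = (1 + fact (Suc (Suc k)) * 2 ^ k) * (e ^ Suc k * ?w y)"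
      by (simp add: algebra_simps power_mult_distrib)
    \<comment> \<open>The 2 in \<open>2 * e\<close> absorbs the contribution of the case where all
      steps are large.\<close>
    also have "\<dots> \<le> (2 * (fact (Suc (Suc k)) * 2 ^ k)) * (e ^ Suc k * ?w y)"
    proof (rule mult_right_mono)
      have "1 \<le> fact (Suc (Suc k)) * (2 ^ k :: nat)" by (simp add: Suc_le_eq)
      then have "(1 :: ennreal) \<le> of_nat (fact (Suc (Suc k)) * 2 ^ k)"
        by (metis of_nat_1 of_nat_mono)
      then have "(1 :: ennreal) \<le> fact (Suc (Suc k)) * 2 ^ k"
        by (simp only: of_nat_mult of_nat_power of_nat_fact of_nat_numeral)
      then show "1 + fact (Suc (Suc k)) * 2 ^ k \<le> 2 * (fact (Suc (Suc k)) * (2 ^ k :: ennreal))"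
        by (simp only: mult_2 add_right_mono)
    qed simp
    also have "\<dots> = fact (Suc (Suc k)) * (2 * e) ^ Suc k * ?w y"
      by (simp add: power_mult_distrib mult_ac)
    finally show ?case .
  }
qed

text \<open>
  When the two summands exceed \<open>J\<close> and \<open>x - J\<close>, a sum in the window at \<open>x\<close> forces each of them into
  a window of its own, for finite and infinite \<open>T\<close> alike.
\<close>

lemma emeasure_conv_window_split:
  assumes V: "finite_borel V" and N: "finite_borel N"
  shows "emeasure (N \<star> V) (window T x) \<le>
    (\<integral>\<^sup>+s. indicator {..J} s * emeasure N (window T (x - s)) \<partial>V) +
    (\<integral>\<^sup>+y. indicator {..x - J} y * emeasure V (window T (x - y)) \<partial>N) +
    emeasure V (window T J) * emeasure N (window T (x - J))"
proof -
  note [measurable_cong] = finite_borelD(2)[OF V] finite_borelD(2)[OF N]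
  have [measurable]: "(\<lambda>u. emeasure L (window T (y - u))) \<in> borel_measurable borel" if "finite_borel L" for L y
    using measurable_emeasure_window[OF that] .
  let ?a = "\<lambda>s y. indicator {..J} s * indicator (window T (x - s)) y :: ennreal"
  let ?b = "\<lambda>s y. indicator {..x - J} y * indicator (window T (x - y)) s :: ennreal"
  let ?c = "\<lambda>s y. indicator (window T J) s * indicator (window T (x - J)) y :: ennreal"
  have pt: "indicator (window T x) (s + y) \<le> ?a s y + ?b s y + ?c s y" for s y
  proof -
    consider "s \<le> J" | "y \<le> x - J" | "J < s" "x - J < y" by linarith
    then show ?thesis
    proof cases
      case 1
      then show ?thesis by (auto simp: window_shift split: split_indicator)
    next
      case 2
      then show ?thesis by (auto simp: window_shift add.commute[of s] split: split_indicator)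
    next
      case 3
      have "s \<in> window T J" "y \<in> window T (x - J)" if "s + y \<in> window T x"
      proof -
        have *: "ereal (s + y - x) \<le> T" using that by (simp add: mem_window)
        have "ereal (s - J) \<le> ereal (s + y - x)" "ereal (y - (x - J)) \<le> ereal (s + y - x)" using 3 by auto
        then show "s \<in> window T J" "y \<in> window T (x - J)"
          using 3 order_trans[OF _ *] by (auto simp: mem_window)
      qed
      then show ?thesis by (auto split: split_indicator)
    qed
  qed
  have "emeasure (N \<star> V) (window T x) = (\<integral>\<^sup>+s. \<integral>\<^sup>+y. indicator (window T x) (s + y) \<partial>N \<partial>V)"
    using conv_commute[OF V N] emeasure_conv[OF V N, of "window T x"] by simp
  also have "\<dots> \<le> (\<integral>\<^sup>+s. \<integral>\<^sup>+y. ?a s y + ?b s y + ?c s y \<partial>N \<partial>V)"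
    by (intro nn_integral_mono pt)
  also have "\<dots> = (\<integral>\<^sup>+s. (\<integral>\<^sup>+y. ?a s y \<partial>N) + (\<integral>\<^sup>+y. ?b s y \<partial>N) + (\<integral>\<^sup>+y. ?c s y \<partial>N) \<partial>V)"
    by (simp add: nn_integral_add)
  also have "\<dots> = (\<integral>\<^sup>+s. (\<integral>\<^sup>+y. ?a s y \<partial>N) \<partial>V) + (\<integral>\<^sup>+s. (\<integral>\<^sup>+y. ?b s y \<partial>N) \<partial>V) +
      (\<integral>\<^sup>+s. (\<integral>\<^sup>+y. ?c s y \<partial>N) \<partial>V)"
  proof -
    have m: "(\<lambda>s. \<integral>\<^sup>+y. g s y \<partial>N) \<in> borel_measurable V"
      if "case_prod g \<in> borel_measurable (borel \<Otimes>\<^sub>M borel)" for g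
      using measurable_finite_borel_nn_integral[OF N that] by simp
    have [measurable]: "(\<lambda>s. \<integral>\<^sup>+y. ?a s y \<partial>N) \<in> borel_measurable V"
      "(\<lambda>s. \<integral>\<^sup>+y. ?b s y \<partial>N) \<in> borel_measurable V" "(\<lambda>s. \<integral>\<^sup>+y. ?c s y \<partial>N) \<in> borel_measurable V"
      by (rule m; measurable)+
    show ?thesis by (simp add: nn_integral_add)
  qed
  also have "(\<integral>\<^sup>+s. (\<integral>\<^sup>+y. ?a s y \<partial>N) \<partial>V) = (\<integral>\<^sup>+s. indicator {..J} s * emeasure N (window T (x - s)) \<partial>V)"
    by (simp add: nn_integral_cmult)
  also have "(\<integral>\<^sup>+s. (\<integral>\<^sup>+y. ?b s y \<partial>N) \<partial>V) = (\<integral>\<^sup>+y. (\<integral>\<^sup>+s. ?b s y \<partial>V) \<partial>N)"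
    by (rule finite_borel_fubini[OF V N]) measurable
  also have "\<dots> = (\<integral>\<^sup>+y. indicator {..x - J} y * emeasure V (window T (x - y)) \<partial>N)"
    by (simp add: nn_integral_cmult)
  also have "(\<integral>\<^sup>+s. (\<integral>\<^sup>+y. ?c s y \<partial>N) \<partial>V) = emeasure V (window T J) * emeasure N (window T (x - J))"
    by (simp add: nn_integral_cmult nn_integral_multc)
  finally show ?thesis .
qed

text \<open>Two summands from windows of length \<open>r\<close> have a sum in the window at
  \<open>x\<close> or in the adjacent one at \<open>x + r\<close>. For infinite \<open>T\<close> the
  window at \<open>x\<close> already contains the sum, and \<open>V\<close> is empty.\<close>

lemma emeasure_window_pair:
  assumes A: "finite_borel A" and T: "0 < T"
    and next_le: "\<And>r. T = ereal r \<Longrightarrow> emeasure (A \<star> A) (window T (x + r)) \<le> \<beta>"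
    and \<alpha>: "emeasure (A \<star> A) (window T x) \<le> \<alpha>"
  shows "emeasure A (window T J) * emeasure A (window T (x - J)) \<le> \<alpha> + \<beta>"
proof -
  define V where "V = (case T of ereal r \<Rightarrow> window T (x + r) | _ \<Rightarrow> {})"
  have V[measurable]: "V \<in> sets borel" by (auto simp: V_def split: ereal.split)
  have "emeasure A (window T J) * emeasure A (window T (x - J)) \<le> emeasure (A \<star> A) (window T x \<union> V)"
  proof (rule emeasure_conv_ge[OF A A])
    fix s y assume "s \<in> window T J" "y \<in> window T (x - J)"
    then show "s + y \<in> window T x \<union> V"
      using T by (cases T) (auto simp: mem_window V_def)
  qed auto
  also have "\<dots> \<le> emeasure (A \<star> A) (window T x) + emeasure (A \<star> A) V"
    by (intro emeasure_subadditive) auto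
  also have "\<dots> \<le> \<alpha> + \<beta>"
    using \<alpha> next_le T by (intro add_mono) (auto simp: V_def split: ereal.split)
  finally show ?thesis .
qed

text \<open>Two steps above \<open>h \<ge> 0\<close> have a sum above \<open>h\<close>, so the
  square of the tail is at most \<open>e\<close> times the tail; positivity allows division by
  it.\<close>

lemma tail_le_of_pair:
  assumes F: "finite_borel F" and T: "0 < T" and c: "0 \<le> c" and h: "0 \<le> h"
    and A_def: "A = restr F ({..< - c} \<union> {h<..})"
    and pair: "\<And>y. h \<le> y \<Longrightarrow> emeasure (A \<star> A) (window T y) \<le> e * emeasure F (window T y)"
    and pos: "emeasure F {h<..} \<noteq> 0"
  shows "emeasure F {h<..} \<le> e"
proof -
  have A: "finite_borel A" unfolding A_def by (intro finite_borel_restr F) measurable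
  have "emeasure A {h<..} = emeasure F {h<..}"
  proof -
    have "({..< - c} \<union> {h<..}) \<inter> {h<..} = {h<..}" by auto
    then show ?thesis unfolding A_def by (subst emeasure_restr[OF F]) auto
  qed
  then have "emeasure F {h<..} * emeasure F {h<..} \<le> emeasure (A \<star> A) {h<..}"
    using h emeasure_conv_ge[OF A A, of "{h<..}" "{h<..}" "{h<..}"] by auto
  also have "\<dots> \<le> e * emeasure F {h<..}"
    by (intro emeasure_window_le_tail[OF _ F T] finite_borel_convolution A pair)
  finally have "emeasure F {h<..} * emeasure F {h<..} \<le> emeasure F {h<..} * e" by (simp add: mult.commute)
  moreover have "emeasure F {h<..} \<noteq> \<infinity>"
    using finite_measure.emeasure_finite[OF finite_borelD(1)[OF F]] by simp
  ultimately show ?thesis using pos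
    by (metis ennreal_mult_le_mult_iff infinity_ennreal_def)
qed

text \<open>Each appended step from \<open>{0..a}\<close> moves the sum to the right by at most
  \<open>a\<close>, so the left end of the window is kept and only the right end moves.\<close>

lemma conv_pow_step_into:
  assumes B: "finite_borel B" and a: "p \<le> emeasure B {0..a}"
  shows "p ^ k * emeasure (conv_pow B m) (window L z) \<le> emeasure (conv_pow B (m + k)) (window (L + ereal (real k * a)) z)"
proof (induction k)
  case 0
  then show ?case by (simp add: zero_ereal_def[symmetric])
next
  case (Suc k)
  let ?W = "window (L + ereal (real k * a)) z" and ?W' = "window (L + ereal (real (Suc k) * a)) z"
  let ?P = "conv_pow B (m + k)"
  have P: "finite_borel ?P" using B by (rule finite_borel_conv_pow)
  have "p ^ Suc k * emeasure (conv_pow B m) (window L z) \<le> p * emeasure ?P ?W"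
    using mult_left_mono[OF Suc.IH, of p] by (simp add: mult_ac)
  also have "\<dots> \<le> emeasure B {0..a} * emeasure ?P ?W" by (intro mult_right_mono a) simp
  also have "\<dots> \<le> emeasure (B \<star> ?P) ?W'"
    by (rule emeasure_conv_ge[OF B P]) (cases L; auto simp: mem_window algebra_simps)+
  also have "(B \<star> ?P) = conv_pow B (m + Suc k)" by simp
  finally show ?case .
qed

text \<open>\<open>d\<close> is the small-steps factor, \<open>C ^ k\<close> the price for having
  \<open>k\<close> small steps fewer than \<open>n\<close>, and \<open>G\<close> the price of
  shifting the window by the small sum. Each term is split into three cases: small sum at most
  \<open>J\<close> (\<open>mid\<close>), big sum at most \<open>x - J\<close> (one further big
  step), or neither (\<open>prodJ\<close>).\<close>

lemma emeasure_conv_pow_window_upper: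
  assumes F: "finite_borel F" and c: "0 \<le> c" and h: "0 \<le> h"
    and A_def: "A = restr F ({..< - c} \<union> {h<..})"
    and B_def: "B = restr F (- ({..< - c} \<union> {h<..}))"
    and pair: "\<And>y. h \<le> y \<Longrightarrow> emeasure (A \<star> A) (window T y) \<le> e * emeasure F (window T y)"
    and tail: "emeasure F {h<..} \<le> e"
    and J: "h \<le> J" "h \<le> x - J"
    and small: "\<And>k z. k \<le> n \<Longrightarrow> J \<le> z \<Longrightarrow>
      emeasure (conv_pow B (n - k)) (window T z) \<le> C ^ k * d * emeasure F (window T z)"
    and mid: "\<And>k. k \<le> n \<Longrightarrow> 1 \<le> k \<Longrightarrow>
      (\<integral>\<^sup>+s. indicator {..J} s * emeasure F (window T (x - s)) \<partial>conv_pow B (n - k)) \<le> G * emeasure F (window T x)"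
    and prodJ: "emeasure F (window T J) * emeasure F (window T (x - J)) \<le> 3 * e * emeasure F (window T x)"
  shows "emeasure (conv_pow F n) (window T x) \<le>
    (d + (\<Sum>k=1..n. of_nat (n choose k) * (fact k * (2 * e) ^ (k - 1) * G +
      C ^ k * d * (fact (k + 1) * (2 * e) ^ k) + C ^ k * d * (fact k * (2 * e) ^ (k - 1)) * (3 * e)))) *
    emeasure F (window T x)"
proof -
  let ?D = "{..< - c} \<union> {h<..}"
  let ?w = "\<lambda>y. emeasure F (window T y)"
  have D[measurable]: "?D \<in> sets borel" by measurable
  have A: "finite_borel A" and B: "finite_borel B"
    unfolding A_def B_def by (auto intro!: finite_borel_restr F)
  note fb = F A B finite_borel_conv_pow finite_borel_convolution
  have meas[measurable]: "(\<lambda>u. emeasure N (window T (y - u))) \<in> borel_measurable borel"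
    if "finite_borel N" for N y
    using that by (rule measurable_emeasure_window)
  have big: "emeasure A (window T z) = ?w z" if "h \<le> z" for z
  proof -
    have "?D \<inter> window T z = window T z" using that by (auto simp: mem_window)
    then show ?thesis using emeasure_restr[OF F D, of "window T z"] by (simp add: A_def)
  qed
  have pow: "emeasure (conv_pow A k) (window T y) \<le> fact k * (2 * e) ^ (k - 1) * ?w y" if "1 \<le> k" "h \<le> y" for k y
    using conv_pow_big_window[OF F c h A_def pair tail, of y "k - 1"] that by (cases k) auto
  define t where "t k = fact k * (2 * e) ^ (k - 1) * G +
      C ^ k * d * (fact (k + 1) * (2 * e) ^ k) + C ^ k * d * (fact k * (2 * e) ^ (k - 1)) * (3 * e)" for k
  have term_le: "emeasure (conv_pow A k \<star> conv_pow B (n - k)) (window T x) \<le> t k * ?w x"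
    if k: "1 \<le> k" "k \<le> n" for k
  proof -
    let ?N = "conv_pow A k" and ?V = "conv_pow B (n - k)"
    have N: "finite_borel ?N" and V: "finite_borel ?V" by (intro fb)+
    note [measurable_cong] = finite_borelD(2)[OF N] finite_borelD(2)[OF V]
    have [measurable]: "(\<lambda>u. ?w (x - u)) \<in> borel_measurable borel" "(\<lambda>u. emeasure A (window T (x - u))) \<in> borel_measurable borel"
      by (rule meas, rule fb)+
    have "(\<integral>\<^sup>+s. indicator {..J} s * emeasure ?N (window T (x - s)) \<partial>?V) \<le>
        (\<integral>\<^sup>+s. (fact k * (2 * e) ^ (k - 1)) * (indicator {..J} s * ?w (x - s)) \<partial>?V)"
      using pow[OF k(1)] J by (intro nn_integral_mono) (auto split: split_indicator)
    also have "\<dots> = (fact k * (2 * e) ^ (k - 1)) * (\<integral>\<^sup>+s. indicator {..J} s * ?w (x - s) \<partial>?V)"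
      by (rule nn_integral_cmult) measurable
    also have "\<dots> \<le> (fact k * (2 * e) ^ (k - 1)) * (G * ?w x)"
      using k by (intro mult_left_mono mid) auto
    finally have 1: "(\<integral>\<^sup>+s. indicator {..J} s * emeasure ?N (window T (x - s)) \<partial>?V) \<le>
       (fact k * (2 * e) ^ (k - 1)) * (G * ?w x)" .
    have "(\<integral>\<^sup>+y. indicator {..x - J} y * emeasure ?V (window T (x - y)) \<partial>?N) \<le>
        (\<integral>\<^sup>+y. (C ^ k * d) * emeasure A (window T (x - y)) \<partial>?N)"
      \<comment> \<open>Here \<open>x - y \<ge> J \<ge> h\<close>, so the window lies among the big
        values and \<open>F\<close> may be replaced by \<open>A\<close>; the integral then belongs
        to \<open>k + 1\<close> big steps.\<close>
      using small[OF k(2)] big J(1) by (intro nn_integral_mono) (auto split: split_indicator)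
    also have "\<dots> = (C ^ k * d) * (\<integral>\<^sup>+y. emeasure A (window T (x - y)) \<partial>?N)"
      by (rule nn_integral_cmult) measurable
    also have "(\<integral>\<^sup>+y. emeasure A (window T (x - y)) \<partial>?N) = emeasure (conv_pow A (Suc k)) (window T x)"
      using emeasure_conv_window[OF N A] conv_commute[OF N A] by simp
    also have "\<dots> \<le> fact (k + 1) * (2 * e) ^ k * ?w x"
      using pow[of "Suc k" x] h J by simp
    finally have 2: "(\<integral>\<^sup>+y. indicator {..x - J} y * emeasure ?V (window T (x - y)) \<partial>?N) \<le>
        (C ^ k * d) * (fact (k + 1) * (2 * e) ^ k * ?w x)"
      by (simp add: mult_left_mono)
    \<comment> \<open>Both factors are reduced to one step each; \<open>prodJ\<close> then leads
      back to a single window at \<open>x\<close>.\<close>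
    have "emeasure ?V (window T J) * emeasure ?N (window T (x - J)) \<le>
       (C ^ k * d * ?w J) * (fact k * (2 * e) ^ (k - 1) * ?w (x - J))"
      by (intro mult_mono small pow k J) auto
    also have "\<dots> = (C ^ k * d * (fact k * (2 * e) ^ (k - 1))) * (?w J * ?w (x - J))" by (simp add: mult_ac)
    also have "\<dots> \<le> (C ^ k * d * (fact k * (2 * e) ^ (k - 1))) * (3 * e * ?w x)"
      by (intro mult_left_mono prodJ) auto
    finally have 3: "emeasure ?V (window T J) * emeasure ?N (window T (x - J)) \<le>
      (C ^ k * d * (fact k * (2 * e) ^ (k - 1))) * (3 * e * ?w x)" .
    have "emeasure (?N \<star> ?V) (window T x) \<le> (fact k * (2 * e) ^ (k - 1)) * (G * ?w x) +
      (C ^ k * d) * (fact (k + 1) * (2 * e) ^ k * ?w x) +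
      (C ^ k * d * (fact k * (2 * e) ^ (k - 1))) * (3 * e * ?w x)"
      by (rule order_trans[OF emeasure_conv_window_split[OF V N, of T x J]]) (intro add_mono 1 2 3)
    also have "\<dots> = t k * ?w x" unfolding t_def by (simp only: distrib_right mult.assoc)
    finally show ?thesis .
  qed
  have term0: "emeasure (conv_pow A 0 \<star> conv_pow B n) (window T x) \<le> d * ?w x"
    using small[of 0 x] conv_return(2)[of "conv_pow B n"] h J fb by simp
  have "emeasure (conv_pow F n) (window T x) =
    (\<Sum>k\<le>n. of_nat (n choose k) * emeasure (conv_pow A k \<star> conv_pow B (n - k)) (window T x))"
    using nn_integral_conv_pow_binomial[OF F D, of "indicator (window T x)" n]
      finite_borelD(2)[OF finite_borel_conv_pow[OF F]]
    by (simp add: A_def B_def)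
  also have "{..n} = insert 0 {1..n}" by auto
  also have "(\<Sum>k\<in>insert 0 {1..n}. of_nat (n choose k) * emeasure (conv_pow A k \<star> conv_pow B (n - k)) (window T x)) =
     emeasure (conv_pow A 0 \<star> conv_pow B n) (window T x) +
     (\<Sum>k=1..n. of_nat (n choose k) * emeasure (conv_pow A k \<star> conv_pow B (n - k)) (window T x))"
    by (simp del: conv_pow.simps)
  also have "\<dots> \<le> d * ?w x + (\<Sum>k=1..n. of_nat (n choose k) * (t k * ?w x))"
    using term0 term_le by (intro add_mono sum_mono mult_left_mono) auto
  also have "\<dots> = (d + (\<Sum>k=1..n. of_nat (n choose k) * t k)) * ?w x"
    by (simp add: distrib_right sum_distrib_right mult.assoc)
  finally show ?thesis unfolding t_def .
qed

text \<open>As \<open>(n choose k) * fact k \<le> n ^ k\<close>, the factorials and all powers of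
  \<open>n\<close> but one disappear. What remains are geometric series with ratios
  \<open>2 * \<epsilon>\<close> and \<open>4 * q\<close>.\<close>

lemma upper_constant_bound:
  fixes n :: nat and \<epsilon> \<delta> c g :: real
  assumes n: "1 \<le> n" and nonneg: "0 \<le> \<epsilon>" "0 \<le> \<delta>" "1 \<le> c" "0 \<le> g" and \<epsilon>: "16 * c * \<epsilon> \<le> 1"
  shows "\<delta> * n + (\<Sum>k=1..n. (n choose k) * (fact k * (2 * (\<epsilon> / n)) ^ (k - 1) * g +
      c ^ k * (\<delta> * n) * (fact (k + 1) * (2 * (\<epsilon> / n)) ^ k) +
      c ^ k * (\<delta> * n) * (fact k * (2 * (\<epsilon> / n)) ^ (k - 1)) * (3 * (\<epsilon> / n)))) \<le>
    n * (2 * \<delta> + g * (1 + 4 * \<epsilon>))"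
proof -
  have n0: "0 < real n" using n by simp
  have "\<epsilon> \<le> c * \<epsilon>" using nonneg mult_right_mono[of 1 c \<epsilon>] by simp
  then have \<epsilon>16: "\<epsilon> \<le> 1 / 16" using \<epsilon> by simp
  \<comment> \<open>The hypothesis gives \<open>4 * q \<le> 1 / 2\<close>, which keeps the second
    series at most 1.\<close>
  define q where "q = 2 * c * \<epsilon>"
  have q: "0 \<le> q" "8 * q \<le> 1" using nonneg \<epsilon> by (auto simp: q_def)
  have term_le: "(n choose k) * (fact k * (2 * (\<epsilon> / n)) ^ (k - 1) * g +
      c ^ k * (\<delta> * n) * (fact (k + 1) * (2 * (\<epsilon> / n)) ^ k) +
      c ^ k * (\<delta> * n) * (fact k * (2 * (\<epsilon> / n)) ^ (k - 1)) * (3 * (\<epsilon> / n))) \<le>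
      n * g * (2 * \<epsilon>) ^ (k - 1) + \<delta> * n * (4 * q) ^ k" if "k \<in> {1..n}" for k
  proof -
    obtain j where k: "k = Suc j" using \<open>k \<in> {1..n}\<close> by (cases k) auto
    define P where "P = real ((n choose k) * fact k) / real n ^ k"
    have P: "0 \<le> P" "P \<le> 1"
      using binomial_fact_pow[of n k] n0 by (auto simp: P_def divide_le_eq simp flip: of_nat_power of_nat_mult)
    have key: "real (n choose k) * fact k = P * real n ^ k" using n0 by (simp add: P_def)
    have e1: "real (n choose k) * (fact k * (2 * (\<epsilon> / n)) ^ j * g) = P * (n * g * (2 * \<epsilon>) ^ j)"
    proof -
      have "real (n choose k) * (fact k * (2 * (\<epsilon> / n)) ^ j * g) =
         (real (n choose k) * fact k) * (2 * \<epsilon> / n) ^ j * g" by simp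
      also have "\<dots> = P * (n * g * (2 * \<epsilon>) ^ j)" unfolding key using n0 by (simp add: k power_divide)
      finally show ?thesis .
    qed
    have e2: "real (n choose k) * (c ^ k * (\<delta> * n) * (fact (k + 1) * (2 * (\<epsilon> / n)) ^ k)) =
        P * (\<delta> * n * ((k + 1) * q ^ k))"
    proof -
      have "real (n choose k) * (c ^ k * (\<delta> * n) * (fact (k + 1) * (2 * (\<epsilon> / n)) ^ k)) =
         (real (n choose k) * fact k) * (c ^ k * (2 * (\<epsilon> / n)) ^ k) * (\<delta> * n * (k + 1))"
        by (simp add: algebra_simps)
      also have "\<dots> = P * (\<delta> * n * ((k + 1) * q ^ k))"
        unfolding key q_def using n0 by (simp add: power_divide power_mult_distrib)
      finally show ?thesis .
    qed
    have e3: "real (n choose k) * (c ^ k * (\<delta> * n) * (fact k * (2 * (\<epsilon> / n)) ^ j) * (3 * (\<epsilon> / n))) =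
        P * (\<delta> * n * (3 / 2 * q ^ k))"
    proof -
      have "real (n choose k) * (c ^ k * (\<delta> * n) * (fact k * (2 * (\<epsilon> / n)) ^ j) * (3 * (\<epsilon> / n))) =
         (real (n choose k) * fact k) * (c ^ k * (2 * (\<epsilon> / n)) ^ k) * (\<delta> * n * (3 / 2))"
        by (simp add: k)
      also have "\<dots> = P * (\<delta> * n * (3 / 2 * q ^ k))"
        unfolding key q_def using n0 by (simp add: power_divide power_mult_distrib)
      finally show ?thesis .
    qed
    \<comment> \<open>The part \<open>k + 1\<close> comes from \<open>fact (k + 1)\<close>, the part
      \<open>3 / 2\<close> from writing \<open>3 * (\<epsilon> / n)\<close> as a multiple of
      \<open>2 * (\<epsilon> / n)\<close>.\<close>
    have four: "real k + 5 / 2 \<le> 4 ^ k"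
      unfolding k by (induction j) auto
    have "(real k + 1) * q ^ k + 3 / 2 * q ^ k = (real k + 5 / 2) * q ^ k" by (simp add: algebra_simps)
    also have "\<dots> \<le> 4 ^ k * q ^ k" using four q by (intro mult_right_mono) auto
    finally have kq: "(real k + 1) * q ^ k + 3 / 2 * q ^ k \<le> (4 * q) ^ k" by (simp add: power_mult_distrib)
    let ?Z = "n * g * (2 * \<epsilon>) ^ j + \<delta> * n * ((k + 1) * q ^ k + 3 / 2 * q ^ k)"
    have "(n choose k) * (fact k * (2 * (\<epsilon> / n)) ^ (k - 1) * g +
      c ^ k * (\<delta> * n) * (fact (k + 1) * (2 * (\<epsilon> / n)) ^ k) +
      c ^ k * (\<delta> * n) * (fact k * (2 * (\<epsilon> / n)) ^ (k - 1)) * (3 * (\<epsilon> / n))) = P * ?Z"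
      using e1 e2 e3 by (simp only: distrib_left k diff_Suc_1 add.assoc)
    also have "\<dots> \<le> 1 * ?Z"
      using P nonneg q by (intro mult_right_mono) auto
    also have "\<dots> \<le> n * g * (2 * \<epsilon>) ^ j + \<delta> * n * (4 * q) ^ k"
      unfolding mult_1 using kq nonneg by (intro add_left_mono mult_left_mono) (auto simp: add.commute)
    finally show ?thesis by (simp add: k)
  qed
  have geo: "(\<Sum>k=1..n. r ^ (k - 1)) \<le> 1 / (1 - r)" if "0 \<le> r" "r < 1" for r :: real
  proof -
    have "(\<Sum>k=1..n. r ^ (k - 1)) = (\<Sum>k<n. r ^ k)"
      by (rule sum.reindex_bij_witness[of _ Suc "\<lambda>k. k - 1"]) auto
    also have "\<dots> = (1 - r ^ n) / (1 - r)" using that by (simp add: sum_gp_strict)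
    also have "\<dots> \<le> 1 / (1 - r)" using that by (intro divide_right_mono) auto
    finally show ?thesis .
  qed
  have "(\<Sum>k=1..n. (2 * \<epsilon>) ^ (k - 1)) \<le> 1 / (1 - 2 * \<epsilon>)" using nonneg \<epsilon>16 by (intro geo) auto
  also have "\<dots> \<le> 1 + 4 * \<epsilon>"
  proof -
    have "0 \<le> \<epsilon> * (2 - 8 * \<epsilon>)" using nonneg \<epsilon>16 by (intro mult_nonneg_nonneg) auto
    then show ?thesis using \<epsilon>16 by (simp add: divide_le_eq algebra_simps)
  qed
  finally have g1: "(\<Sum>k=1..n. (2 * \<epsilon>) ^ (k - 1)) \<le> 1 + 4 * \<epsilon>" .
  have "(\<Sum>k=1..n. (4 * q) ^ k) = 4 * q * (\<Sum>k=1..n. (4 * q) ^ (k - 1))"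
    unfolding sum_distrib_left by (intro sum.cong) (auto simp: power_eq_if)
  also have "\<dots> \<le> 4 * q * (1 / (1 - 4 * q))" using q by (intro mult_left_mono geo) auto
  also have "\<dots> \<le> 1" using q by (simp add: field_simps)
  finally have g2: "(\<Sum>k=1..n. (4 * q) ^ k) \<le> 1" .
  have "\<delta> * n + (\<Sum>k=1..n. (n choose k) * (fact k * (2 * (\<epsilon> / n)) ^ (k - 1) * g +
      c ^ k * (\<delta> * n) * (fact (k + 1) * (2 * (\<epsilon> / n)) ^ k) +
      c ^ k * (\<delta> * n) * (fact k * (2 * (\<epsilon> / n)) ^ (k - 1)) * (3 * (\<epsilon> / n)))) \<le>
      \<delta> * n + (\<Sum>k=1..n. n * g * (2 * \<epsilon>) ^ (k - 1) + \<delta> * n * (4 * q) ^ k)"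
    by (intro add_left_mono sum_mono term_le)
  also have "\<dots> = \<delta> * n + n * g * (\<Sum>k=1..n. (2 * \<epsilon>) ^ (k - 1)) + \<delta> * n * (\<Sum>k=1..n. (4 * q) ^ k)"
    by (simp add: sum.distrib sum_distrib_left)
  also have "\<dots> \<le> \<delta> * n + n * g * (1 + 4 * \<epsilon>) + \<delta> * n * 1"
    using nonneg by (intro add_mono mult_left_mono g1 g2 order_refl) auto
  finally show ?thesis by (simp add: algebra_simps)
qed

section \<open>Exponential moments of truncated sums\<close>

lemma exp_le_quadratic:
  fixes v :: real
  assumes "\<bar>v\<bar> \<le> 1"
  shows "exp v \<le> 1 + v + v\<^sup>2"
proof (cases "0 \<le> v")
  case True
  then show ?thesis using exp_bound[of v] assms by simp
next
  case False
  define x where "x = - v"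
  have x: "0 \<le> x" using False by (simp add: x_def)
  have "1 \<le> (1 + x + x\<^sup>2 / 2) * (1 - x + x\<^sup>2)"
  proof -
    have "(1 + x + x\<^sup>2 / 2) * (1 - x + x\<^sup>2) = 1 + x\<^sup>2 / 2 + x ^ 3 / 2 + x ^ 4 / 2"
      by (simp add: field_simps power2_eq_square power3_eq_cube power4_eq_xxxx)
    then show ?thesis using x by simp
  qed
  moreover have "0 < 1 + x + x\<^sup>2 / 2" using x by (simp add: add_pos_nonneg)
  ultimately have "inverse (1 + x + x\<^sup>2 / 2) \<le> 1 - x + x\<^sup>2"
    by (simp add: field_simps)
  moreover have "inverse (exp x) \<le> inverse (1 + x + x\<^sup>2 / 2)"
    using exp_lower_Taylor_quadratic[OF x] \<open>0 < 1 + x + x\<^sup>2 / 2\<close> by (intro le_imp_inverse_le)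
  ultimately show ?thesis by (simp add: x_def exp_minus)
qed

text \<open>
  This inequality turns control of a characteristic function near 0 into control of an
  exponential moment, with no separate treatment of truncated means and variances.
\<close>

lemma exp_le_trig:
  fixes v :: real
  assumes "v \<le> 1"
  shows "exp v \<le> 1 + sin v + 3 * (1 - cos v)"
proof (cases "- 1 \<le> v")
  case True
  then have v: "\<bar>v\<bar> \<le> 1" using assms by auto
  have sin3: "\<bar>sin y - y\<bar> \<le> \<bar>y\<bar> ^ 3 / 6" for y :: real
    using Maclaurin_sin_bound[of y 3] by (simp add: numeral_3_eq_3 sin_coeff_def fact_numeral)
  have cube: "\<bar>v\<bar> ^ 3 \<le> \<bar>v\<bar>\<^sup>2" "\<bar>v\<bar> ^ 3 \<le> \<bar>v\<bar>"
    using v power_decreasing[of 2 3 "\<bar>v\<bar>"] power_decreasing[of 1 3 "\<bar>v\<bar>"] by auto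
  have s: "v - v\<^sup>2 / 6 \<le> sin v" using sin3[of v] cube power2_abs[of v] by linarith
  have "\<bar>v\<bar> / 2 - \<bar>v\<bar> ^ 3 / 48 \<le> \<bar>sin (v / 2)\<bar>"
  proof -
    have "\<bar>sin (v / 2) - v / 2\<bar> \<le> \<bar>v\<bar> ^ 3 / 48" using sin3[of "v / 2"] by (simp add: power_divide)
    then show ?thesis by linarith
  qed
  then have "9 / 20 * \<bar>v\<bar> \<le> \<bar>sin (v / 2)\<bar>" using cube by simp
  then have "(9 / 20 * \<bar>v\<bar>)\<^sup>2 \<le> \<bar>sin (v / 2)\<bar>\<^sup>2" by (intro power_mono) auto
  then have "81 / 400 * v\<^sup>2 \<le> (sin (v / 2))\<^sup>2" by (simp add: power_mult_distrib power_divide)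
  moreover have "cos v = 1 - 2 * (sin (v / 2))\<^sup>2" using cos_double_sin[of "v / 2"] by simp
  \<comment> \<open>The target 7/6 is the coefficient 1 of \<open>v\<^sup>2\<close> in the bound for
    \<open>exp\<close> plus the 1/6 lost in replacing \<open>v\<close> by \<open>sin v\<close>. It
    is met because 6 times 81/400 exceeds 7/6.\<close>
  moreover have "7 / 6 * p \<le> 3 * (1 - r)" if "81 / 400 * p \<le> q" "r = 1 - 2 * q" "0 \<le> p" for p q r :: real
    using that by (simp add: algebra_simps)
  ultimately have "7 / 6 * v\<^sup>2 \<le> 3 * (1 - cos v)" by (metis zero_le_power2)
  then show ?thesis using s exp_le_quadratic[OF v] by linarith
next
  case False
  have "exp v \<le> exp (- 1)" using False by simp
  also have "\<dots> \<le> 2 / 5"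
    using exp_lower_Taylor_quadratic[of 1] by (simp add: exp_minus field_simps)
  finally have "exp v \<le> 2 / 5" .
  \<comment> \<open>With \<open>exp v\<close> at most 2/5 this is exactly what is left to prove;
    comparing squares makes it polynomial in \<open>1 - cos v\<close>.\<close>
  moreover have "- sin v \<le> 3 / 5 + 3 * (1 - cos v)"
  proof (rule power2_le_imp_le)
    define w where "w = 1 - cos v"
    have w: "0 \<le> w" by (simp add: w_def)
    have "(- sin v)\<^sup>2 = w * (2 - w)"
      using sin_cos_squared_add[of v] by (simp add: w_def power2_eq_square algebra_simps)
    also have "\<dots> \<le> w * (2 - w) + (10 * (w * w) + 8 / 5 * w + 9 / 25)"
      using w by (simp add: add_nonneg_nonneg)
    also have "\<dots> = (3 / 5 + 3 * w)\<^sup>2" by (simp add: power2_eq_square algebra_simps)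
    finally show "(- sin v)\<^sup>2 \<le> (3 / 5 + 3 * (1 - cos v))\<^sup>2" by (simp add: w_def)
  qed (intro add_nonneg_nonneg mult_nonneg_nonneg; simp)
  ultimately show ?thesis by simp
qed

text \<open>The expansion of the remainder in \<open>u\<close> has nonnegative coefficients, so
  replacing \<open>u\<close> by \<open>norm u\<close> bounds its norm.\<close>

lemma norm_one_plus_power_remainder:
  fixes u :: complex
  shows "norm ((1 + u) ^ n - 1 - of_nat n * u) \<le> (1 + norm u) ^ n - 1 - of_nat n * norm u"
proof (induction n)
  case (Suc n)
  have "(1 + u) ^ Suc n - 1 - of_nat (Suc n) * u = (1 + u) * ((1 + u) ^ n - 1 - of_nat n * u) + of_nat n * u\<^sup>2"
    by (simp add: algebra_simps power2_eq_square)
  also have "norm \<dots> \<le> norm (1 + u) * norm ((1 + u) ^ n - 1 - of_nat n * u) + of_nat n * (norm u)\<^sup>2"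
    by (rule order_trans[OF norm_triangle_ineq]) (simp add: norm_mult norm_power)
  also have "\<dots> \<le> (1 + norm u) * ((1 + norm u) ^ n - 1 - of_nat n * norm u) + of_nat n * (norm u)\<^sup>2"
    using norm_triangle_ineq[of 1 u] by (intro add_right_mono mult_mono Suc.IH) auto
  also have "\<dots> = (1 + norm u) ^ Suc n - 1 - of_nat (Suc n) * norm u"
    by (simp add: algebra_simps power2_eq_square)
  finally show ?case .
qed simp

text \<open>With \<open>v = n * norm (w - 1)\<close> the power differs from its linear part by at
  most \<open>v\<^sup>2\<close>, so \<open>v - v\<^sup>2 \<le> 1 / 8\<close>. This excludes values
  between 1/4 and 1/2, a gap that a continuous function cannot cross.\<close>

lemma near_one_of_power_near_one:
  fixes w :: complex
  assumes n: "1 \<le> n" and w: "norm (w ^ n - 1) \<le> 1 / 8" "n * norm (w - 1) \<le> 1 / 2"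
  shows "n * norm (w - 1) \<le> 1 / 4"
proof -
  define u where "u = w - 1"
  define v where "v = n * norm u"
  have v: "0 \<le> v" "v \<le> 1 / 2" using w by (auto simp: v_def u_def)
  have "(1 + norm u) ^ n \<le> exp (norm u) ^ n" by (intro power_mono) auto
  also have "\<dots> = exp v" by (simp add: v_def exp_of_nat_mult)
  also have "\<dots> \<le> 1 + v + v\<^sup>2" using v by (intro exp_le_quadratic) auto
  finally have "norm ((1 + u) ^ n - 1 - of_nat n * u) \<le> v\<^sup>2"
    using norm_one_plus_power_remainder[of u n] by (simp add: v_def)
  moreover have "v \<le> norm ((1 + u) ^ n - 1) + norm ((1 + u) ^ n - 1 - of_nat n * u)"
    using norm_triangle_ineq4[of "(1 + u) ^ n - 1" "(1 + u) ^ n - 1 - of_nat n * u"]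
    by (simp add: v_def norm_mult)
  ultimately have "v - v\<^sup>2 \<le> 1 / 8" using w by (simp add: u_def)
  then have "\<not> 1 / 4 < v"
  proof (rule contrapos_pn)
    assume "1 / 4 < v"
    then have "0 < (v - 1 / 4) * (3 / 4 - v)" using v by (intro mult_pos_pos) auto
    moreover have "(v - 1 / 4) * (3 / 4 - v) = v - v\<^sup>2 - 3 / 16"
      by (simp add: field_simps power2_eq_square)
    ultimately show "\<not> v - v\<^sup>2 \<le> 1 / 8" by linarith
  qed
  then show ?thesis by (simp add: v_def u_def)
qed

text \<open>
  \<^const>\<open>char\<close> is continuous with value 1 at 0, so it cannot leave the neighbourhood of 1 for that
  of another \<open>n\<close>-th root of unity.
\<close>

lemma char_near_one_of_power:
  assumes F: "real_distribution F" and n: "1 \<le> n"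
    and pow: "\<And>s. \<bar>s\<bar> \<le> \<tau> \<Longrightarrow> norm (char F s ^ n - 1) \<le> 1 / 8" and s: "\<bar>s\<bar> \<le> \<tau>"
  shows "n * norm (char F s - 1) \<le> 1 / 4"
proof (rule near_one_of_power_near_one[OF n pow[OF s]], rule ccontr)
  interpret real_distribution F by fact
  define f where "f r = n * norm (char F (r * s) - 1)" for r
  assume "\<not> n * norm (char F s - 1) \<le> 1 / 2"
  \<comment> \<open>The level 3/8 lies inside the gap between 1/4 and 1/2, and \<open>f\<close>
    starts at 0.\<close>
  then have "f 0 \<le> 3 / 8" "3 / 8 \<le> f 1" by (auto simp: f_def char_zero)
  moreover have "continuous_on {0..1} f" unfolding f_def
  proof (intro continuous_at_imp_continuous_on ballI continuous_intros)
    fix r :: real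
    show "isCont (\<lambda>r. char F (r * s)) r"
      by (rule isCont_o2[OF _ isCont_char]) (intro continuous_intros)
  qed
  ultimately obtain r where r: "0 \<le> r" "r \<le> 1" "f r = 3 / 8"
    using IVT'[of f 0 "3 / 8" 1] by auto
  have "\<bar>r * s\<bar> \<le> \<tau>" using r s mult_left_le_one_le[of "\<bar>s\<bar>" r] by (simp add: abs_mult)
  then have "n * norm (char F (r * s) - 1) \<le> 1 / 4"
    using r n by (intro near_one_of_power_near_one pow) (auto simp: f_def)
  then show False using r by (simp add: f_def)
qed

lemma nn_integral_exp_restr_le:
  assumes F: "real_distribution F" and X: "X \<in> sets borel" "\<And>x. x \<in> X \<Longrightarrow> s * x \<le> 1"
    and near: "norm (char F s - 1) \<le> r"
  shows "(\<integral>\<^sup>+x. ennreal (exp (s * x)) \<partial>restr F X) \<le> ennreal (1 + 4 * r)"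
proof -
  interpret real_distribution F by fact
  have fb: "finite_borel F" using finite_measure_axioms by (auto simp: finite_borel_def)
  have ic: "integrable F (\<lambda>x. cos (s * x))" and isn: "integrable F (\<lambda>x. sin (s * x))"
    by (intro integrable_const_bound[of _ 1]; simp)+
  have int: "integrable F (\<lambda>x. iexp (s * x))" by (rule integrable_iexp) auto
  have Re: "Re (char F s) = (\<integral>x. cos (s * x) \<partial>F)" and Im: "Im (char F s) = (\<integral>x. sin (s * x) \<partial>F)"
    unfolding char_def using int by (auto simp flip: integral_Re integral_Im simp: Re_exp Im_exp)
  have "(\<integral>\<^sup>+x. ennreal (exp (s * x)) \<partial>restr F X) = (\<integral>\<^sup>+x. indicator X x * ennreal (exp (s * x)) \<partial>F)"
    by (rule nn_integral_restr[OF fb X(1)]) measurable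
  also have "\<dots> \<le> (\<integral>\<^sup>+x. ennreal (1 + sin (s * x) + 3 * (1 - cos (s * x))) \<partial>F)"
    using exp_le_trig[OF X(2)] by (intro nn_integral_mono) (auto split: split_indicator intro!: ennreal_leI)
  also have "\<dots> = ennreal (\<integral>x. 1 + sin (s * x) + 3 * (1 - cos (s * x)) \<partial>F)"
  proof (rule nn_integral_eq_integral)
    show "integrable F (\<lambda>x. 1 + sin (s * x) + 3 * (1 - cos (s * x)))" using ic isn by simp
    show "AE x in F. 0 \<le> 1 + sin (s * x) + 3 * (1 - cos (s * x))"
    proof (rule AE_I2)
      fix x
      show "0 \<le> 1 + sin (s * x) + 3 * (1 - cos (s * x))"
        by (smt (verit) cos_le_one sin_ge_minus_one)
    qed
  qed
  also have "(\<integral>x. 1 + sin (s * x) + 3 * (1 - cos (s * x)) \<partial>F) = 1 + Im (char F s - 1) - 3 * Re (char F s - 1)"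
    using ic isn by (simp add: Re Im prob_space[unfolded space_eq_univ])
  also have "\<dots> \<le> 1 + 4 * r"
    using abs_Re_le_cmod[of "char F s - 1"] abs_Im_le_cmod[of "char F s - 1"] near by linarith
  finally show ?thesis by (simp add: ennreal_leI)
qed

text \<open>One restricted step has moment at most \<open>1 + 1 / n\<close>, so
  \<open>m \<le> n\<close> steps have at most \<open>exp 1 \<le> 3\<close>. Adding the bounds for
  \<open>s\<close> and \<open>- s\<close> gives 6 for the absolute value.\<close>

lemma nn_integral_exp_conv_pow_le:
  assumes F: "real_distribution F" and n: "1 \<le> n" and m: "m \<le> n"
    and pow: "\<And>s. \<bar>s\<bar> \<le> \<tau> \<Longrightarrow> norm (char F s ^ n - 1) \<le> 1 / 8"
    and X: "X \<in> sets borel" "\<And>x. x \<in> X \<Longrightarrow> s * \<bar>x\<bar> \<le> 1" and s: "0 \<le> s" "s \<le> \<tau>"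
  shows "(\<integral>\<^sup>+x. ennreal (exp (s * \<bar>x\<bar>)) \<partial>conv_pow (restr F X) m) \<le> 6"
proof -
  interpret real_distribution F by fact
  have fb: "finite_borel F" using finite_measure_axioms by (auto simp: finite_borel_def)
  have R: "finite_borel (restr F X)" using X by (intro finite_borel_restr fb)
  have one: "(\<integral>\<^sup>+x. ennreal (exp (s' * x)) \<partial>conv_pow (restr F X) m) \<le> 3"
    if s': "s' = s \<or> s' = - s" for s'
  proof -
    have "n * norm (char F s' - 1) \<le> 1 / 4"
      using s s' by (intro char_near_one_of_power[OF F n pow]) auto
    then have near: "norm (char F s' - 1) \<le> 1 / (4 * n)" using n by (simp add: field_simps)
    have "(\<integral>\<^sup>+x. ennreal (exp (s' * x)) \<partial>restr F X) \<le> ennreal (1 + 4 * (1 / (4 * n)))"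
    proof (rule nn_integral_exp_restr_le[OF F X(1) _ near])
      fix x assume "x \<in> X"
      moreover have "s' * x \<le> s * \<bar>x\<bar>"
        using s' s mult_left_mono[of x "\<bar>x\<bar>" s] mult_left_mono[of "- x" "\<bar>x\<bar>" s] by auto
      ultimately show "s' * x \<le> 1" using X(2)[of x] by linarith
    qed
    also have "\<dots> \<le> ennreal (exp (1 / n))" using exp_ge_add_one_self[of "1 / n"] by (intro ennreal_leI) simp
    finally have "(\<integral>\<^sup>+x. ennreal (exp (s' * x)) \<partial>restr F X) ^ m \<le> ennreal (exp (1 / n)) ^ m"
      by (rule power_mono) simp
    also have "\<dots> = ennreal (exp (m / n))"
      by (simp add: ennreal_power exp_of_nat_mult[symmetric])
    also have "\<dots> \<le> ennreal (exp 1)" using m n by (intro ennreal_leI) simp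
    also have "\<dots> \<le> 3" using exp_le by (metis ennreal_leI ennreal_numeral zero_le_numeral)
    finally show ?thesis by (simp add: nn_integral_conv_pow_exp[OF R])
  qed
  have P: "finite_borel (conv_pow (restr F X) m)" using R by (rule finite_borel_conv_pow)
  note [measurable_cong] = finite_borelD(2)[OF P]
  have "(\<integral>\<^sup>+x. ennreal (exp (s * \<bar>x\<bar>)) \<partial>conv_pow (restr F X) m) \<le>
     (\<integral>\<^sup>+x. ennreal (exp (s * x)) + ennreal (exp (- s * x)) \<partial>conv_pow (restr F X) m)"
    by (intro nn_integral_mono) (auto simp: abs_if)
  also have "\<dots> = (\<integral>\<^sup>+x. ennreal (exp (s * x)) \<partial>conv_pow (restr F X) m) +
      (\<integral>\<^sup>+x. ennreal (exp (- s * x)) \<partial>conv_pow (restr F X) m)"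
    by (rule nn_integral_add) measurable
  also have "\<dots> \<le> 3 + 3" by (intro add_mono one) auto
  finally show ?thesis by simp
qed

section \<open>Consequences of insensitivity and small steps\<close>

text \<open>Walking from one point to the other in steps of length at most \<open>b\<close> costs a
  factor \<open>exp \<eta>\<close> per step; rounding up their number produces the
  \<open>+ 1\<close>. Both directions of \<open>step\<close> occur because \<open>r\<close> may lie
  on either side of \<open>r'\<close>.\<close>

lemma insensitive_chain:
  fixes w :: "real \<Rightarrow> real"
  assumes b: "0 < b" and \<eta>: "0 \<le> \<eta>"
    and step: "\<And>x t. I \<le> x \<Longrightarrow> 0 \<le> t \<Longrightarrow> t \<le> b \<Longrightarrow> w (x - t) \<le> exp \<eta> * w x \<and> w x \<le> exp \<eta> * w (x - t)"
    and nonneg: "\<And>x. 0 \<le> w x"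
    and r: "I \<le> r" "I \<le> r'"
  shows "w r \<le> exp (\<eta> * (\<bar>r - r'\<bar> / b + 1)) * w r'"
proof -
  have chain: "w (y - t) \<le> exp (m * \<eta>) * w y \<and> w y \<le> exp (m * \<eta>) * w (y - t)"
    if "I \<le> y - t" "0 \<le> t" "t \<le> m * b" for m :: nat and y t
    using that
  proof (induction m arbitrary: y t)
    case (Suc m)
    show ?case
    proof (cases "t \<le> b")
      case True
      have "exp \<eta> \<le> exp (Suc m * \<eta>)" using \<eta> by (simp add: distrib_right)
      then have "exp \<eta> * w z \<le> exp (Suc m * \<eta>) * w z" for z
        using nonneg by (rule mult_right_mono)
      from order_trans[OF _ this] show ?thesis
        using step[of y t] Suc.prems True by auto
    next
      case False
      let ?y = "y - b" and ?t = "t - b"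
      have eq: "?y - ?t = y - t" by simp
      have IH: "w (y - t) \<le> exp (m * \<eta>) * w ?y" "w ?y \<le> exp (m * \<eta>) * w (y - t)"
        using Suc.IH[of ?y ?t] Suc.prems False by (auto simp: algebra_simps)
      have "I \<le> y" using Suc.prems by linarith
      then have st: "w ?y \<le> exp \<eta> * w y" "w y \<le> exp \<eta> * w ?y" using step[of y b] b by auto
      have ex: "exp (real (Suc m) * \<eta>) = exp (m * \<eta>) * exp \<eta>" by (simp add: distrib_right exp_add)
      have "exp (m * \<eta>) * w ?y \<le> exp (m * \<eta>) * (exp \<eta> * w y)"
        "exp \<eta> * w ?y \<le> exp \<eta> * (exp (m * \<eta>) * w (y - t))"
        using st IH by (auto intro!: mult_left_mono)
      from order_trans[OF IH(1) this(1)] order_trans[OF st(2) this(2)]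
      show ?thesis unfolding ex by (simp add: mult_ac)
    qed
  qed simp
  have main: "w (y - t) \<le> exp (\<eta> * (t / b + 1)) * w y" "w y \<le> exp (\<eta> * (t / b + 1)) * w (y - t)"
    if t: "I \<le> y - t" "0 \<le> t" for y t
  proof -
    define m where "m = nat \<lceil>t / b\<rceil>"
    have m: "t / b \<le> real m" "real m \<le> t / b + 1" using t b by (auto simp: m_def)
    have "t \<le> m * b" using m b by (simp add: field_simps)
    note ch = chain[OF t this]
    have "exp (m * \<eta>) \<le> exp (\<eta> * (t / b + 1))" using m \<eta> by (simp add: mult.commute mult_left_mono)
    then have "exp (m * \<eta>) * w z \<le> exp (\<eta> * (t / b + 1)) * w z" for z
      using nonneg by (rule mult_right_mono)
    then show "w (y - t) \<le> exp (\<eta> * (t / b + 1)) * w y" "w y \<le> exp (\<eta> * (t / b + 1)) * w (y - t)"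
      using ch order_trans by blast+
  qed
  show ?thesis
    using main(1)[of r' "r' - r"] main(2)[of r "r - r'"] r by (cases "r \<le> r'") auto
qed

lemma exp_mult_le_convex:
  fixes \<theta> z :: real
  assumes "0 \<le> \<theta>" "\<theta> \<le> 1"
  shows "exp (\<theta> * z) \<le> 1 + \<theta> * exp z"
proof -
  have "exp ((1 - \<theta>) *\<^sub>R 0 + \<theta> *\<^sub>R z) \<le> (1 - \<theta>) * exp 0 + \<theta> * exp z"
    using convex_onD[OF exp_convex, of \<theta> 0 z] assms by simp
  then show ?thesis using assms by simp
qed

text \<open>The shift by \<open>s\<close> costs \<open>exp (\<eta> * \<bar>s\<bar> / b)\<close> up
  to \<open>exp \<eta>\<close>, a power \<open>\<theta> = \<eta> / (\<tau> * b)\<close> of the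
  function whose moment is at most 6. Convexity interpolates between the total mass and that moment,
  so the price tends to 1 with \<open>\<eta>\<close> although 6 is not small.\<close>

lemma nn_integral_window_shift_le:
  fixes w :: "real \<Rightarrow> real"
  assumes V: "finite_borel V" and mass: "emeasure V UNIV \<le> 1"
    and moment: "(\<integral>\<^sup>+s. ennreal (exp (\<tau> * \<bar>s\<bar>)) \<partial>V) \<le> 6"
    and b: "0 < b" and \<tau>: "0 < \<tau>" and \<eta>: "0 \<le> \<eta>" "\<eta> \<le> \<tau> * b"
    and w: "\<And>r. I \<le> r \<Longrightarrow> w r \<le> exp (\<eta> * (\<bar>r - x\<bar> / b + 1)) * w x" "0 \<le> w x"
    and x: "I \<le> x - J"
  shows "(\<integral>\<^sup>+s. indicator {..J} s * ennreal (w (x - s)) \<partial>V) \<le>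
    ennreal (exp \<eta> * (1 + 6 * (\<eta> / (\<tau> * b)))) * ennreal (w x)"
proof -
  note [measurable_cong] = finite_borelD(2)[OF V]
  define \<theta> where "\<theta> = \<eta> / (\<tau> * b)"
  have \<theta>: "0 \<le> \<theta>" "\<theta> \<le> 1" using assms by (auto simp: \<theta>_def)
  have "indicator {..J} s * ennreal (w (x - s)) \<le>
      ennreal (exp \<eta> * w x) * (1 + ennreal \<theta> * ennreal (exp (\<tau> * \<bar>s\<bar>)))" for s
  proof (cases "s \<le> J")
    case True
    have "exp (\<eta> * (\<bar>s\<bar> / b + 1)) = exp \<eta> * exp (\<theta> * (\<tau> * \<bar>s\<bar>))"
      using b \<tau> by (simp add: \<theta>_def distrib_left exp_add mult.commute)
    also have "\<dots> \<le> exp \<eta> * (1 + \<theta> * exp (\<tau> * \<bar>s\<bar>))"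
      using exp_mult_le_convex[OF \<theta>] by (intro mult_left_mono) auto
    finally have "exp (\<eta> * (\<bar>s\<bar> / b + 1)) * w x \<le> exp \<eta> * (1 + \<theta> * exp (\<tau> * \<bar>s\<bar>)) * w x"
      using w(2) by (rule mult_right_mono)
    moreover have "w (x - s) \<le> exp (\<eta> * (\<bar>s\<bar> / b + 1)) * w x"
      using w(1)[of "x - s"] x True by simp
    ultimately have "w (x - s) \<le> (exp \<eta> * w x) * (1 + \<theta> * exp (\<tau> * \<bar>s\<bar>))" by (simp add: mult_ac)
    then have "ennreal (w (x - s)) \<le> ennreal ((exp \<eta> * w x) * (1 + \<theta> * exp (\<tau> * \<bar>s\<bar>)))" by (rule ennreal_leI)
    also have "\<dots> = ennreal (exp \<eta> * w x) * (1 + ennreal \<theta> * ennreal (exp (\<tau> * \<bar>s\<bar>)))"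
      using w(2) \<theta> by (simp only: ennreal_mult ennreal_plus ennreal_1 exp_ge_zero mult_nonneg_nonneg zero_le_one add_nonneg_nonneg)
    finally show ?thesis using True by simp
  qed simp
  then have "(\<integral>\<^sup>+s. indicator {..J} s * ennreal (w (x - s)) \<partial>V) \<le>
      (\<integral>\<^sup>+s. ennreal (exp \<eta> * w x) * (1 + ennreal \<theta> * ennreal (exp (\<tau> * \<bar>s\<bar>))) \<partial>V)"
    by (intro nn_integral_mono)
  also have "\<dots> = ennreal (exp \<eta> * w x) * (emeasure V UNIV + ennreal \<theta> * (\<integral>\<^sup>+s. ennreal (exp (\<tau> * \<bar>s\<bar>)) \<partial>V))"
    by (simp add: nn_integral_cmult nn_integral_add finite_borelD(3)[OF V])
  also have "\<dots> \<le> ennreal (exp \<eta> * w x) * (1 + ennreal \<theta> * 6)"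
    by (intro mult_left_mono add_mono mass moment) auto
  also have "\<dots> = ennreal (exp \<eta> * w x) * ennreal (1 + 6 * \<theta>)"
    using \<theta> by (simp add: ennreal_mult mult.commute)
  also have "\<dots> = ennreal (exp \<eta> * (1 + 6 * \<theta>)) * ennreal (w x)"
  proof -
    have "ennreal (exp \<eta> * w x) * ennreal (1 + 6 * \<theta>) = ennreal ((exp \<eta> * w x) * (1 + 6 * \<theta>))"
      using \<theta> w(2) by (intro ennreal_mult[symmetric]) auto
    also have "\<dots> = ennreal ((exp \<eta> * (1 + 6 * \<theta>)) * w x)" by (simp only: mult_ac)
    also have "\<dots> = ennreal (exp \<eta> * (1 + 6 * \<theta>)) * ennreal (w x)"
      using \<theta> w(2) by (intro ennreal_mult) auto
    finally show ?thesis .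
  qed
  finally show ?thesis by (simp add: \<theta>_def)
qed

text \<open>Appending \<open>k\<close> steps from \<open>{0..a}\<close>, each of mass at least
  \<open>p\<close>, restores \<open>n\<close> steps but widens the window. As \<open>a\<close> is
  \<open>q\<close> window lengths, \<open>1 + k * q\<close> windows cover it; the cruder
  \<open>(1 + q) ^ k\<close> keeps the loss geometric in \<open>k\<close>. For infinite
  \<open>T\<close> the window does not grow.\<close>

lemma small_steps_fewer:
  assumes B: "finite_borel B" and T: "0 < T" and k: "k \<le> n"
    and p: "0 < p" "ennreal p \<le> emeasure B {0..a}" and a: "\<And>r. T = ereal r \<Longrightarrow> a = real q * r"
    and full: "\<And>z'. z \<le> z' \<Longrightarrow> emeasure (conv_pow B n) (window T z') \<le> \<beta>"
  shows "emeasure (conv_pow B (n - k)) (window T z) \<le> ennreal ((1 + real q) / p) ^ k * \<beta>"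
proof -
  have P: "finite_borel (conv_pow B n)" using B by (rule finite_borel_conv_pow)
  have "ennreal p ^ k * emeasure (conv_pow B (n - k)) (window T z) \<le>
      emeasure (conv_pow B n) (window (T + ereal (real k * a)) z)"
    using conv_pow_step_into[OF B p(2), of k "n - k" T z] k by simp
  also have "\<dots> \<le> of_nat (1 + q) ^ k * \<beta>"
  proof (cases T)
    case (real r)
    have "emeasure (conv_pow B n) (window (T + ereal (real (k * q) * r)) z) \<le> of_nat (Suc (k * q)) * \<beta>"
      by (rule emeasure_window_widen[OF P T full real])
    also have "\<dots> \<le> of_nat ((1 + q) ^ k) * \<beta>"
    proof (intro mult_right_mono of_nat_mono)
      show "Suc (k * q) \<le> (1 + q) ^ k"
      proof (induction k)
        case (Suc k)
        have "q * 1 \<le> q * (1 + q) ^ k" by (intro mult_left_mono one_le_power) auto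
        from add_mono[OF Suc this] show ?case by simp
      qed simp
    qed simp
    finally show ?thesis using a[OF real] by (simp add: mult.assoc)
  next
    case PInf
    have "emeasure (conv_pow B n) (window (T + ereal (real k * a)) z) \<le> 1 * \<beta>"
      using full[of z] PInf by simp
    also have "\<dots> \<le> of_nat ((1 + q) ^ k) * \<beta>"
      by (intro mult_right_mono) (auto simp: one_le_power simp del: of_nat_power)
    finally show ?thesis by simp
  qed (use T in simp)
  also have "of_nat (1 + q) ^ k = ennreal p ^ k * ennreal ((1 + real q) / p) ^ k"
  proof -
    have "ennreal p * ennreal ((1 + real q) / p) = of_nat (1 + q)"
      using p by (simp add: ennreal_mult[symmetric] ennreal_of_nat_eq_real_of_nat del: of_nat_add)
    then show ?thesis by (simp add: power_mult_distrib[symmetric])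
  qed
  finally have "ennreal p ^ k * emeasure (conv_pow B (n - k)) (window T z) \<le>
      ennreal p ^ k * (ennreal ((1 + real q) / p) ^ k * \<beta>)" by (simp add: mult.assoc)
  then show ?thesis
    using p by (simp add: ennreal_power ennreal_mult_le_mult_iff)
qed

text \<open>Here the only cut is at \<open>h\<close>. The small sum is confined to
  \<open>\<bar>s\<bar> \<le> L * b\<close>, which bounds the price of the shift, and to
  \<open>s \<le> J\<close>, which gives \<open>x - s \<ge> I \<ge> h\<close> and keeps the shifted
  window above \<open>h\<close>.\<close>

lemma emeasure_conv_pow_window_lower:
  fixes w :: "real \<Rightarrow> real"
  assumes F: "finite_borel F" and n: "1 \<le> n" and b: "0 < b"
    and w_def: "\<And>y. emeasure F (window T y) = ennreal (w y)" and w0: "\<And>y. 0 \<le> w y"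
    and w: "\<And>r. I \<le> r \<Longrightarrow> w x \<le> exp (\<eta> * (\<bar>r - x\<bar> / b + 1)) * w r"
    and \<eta>: "0 \<le> \<eta>" and h: "h \<le> I" and x: "I \<le> x - J"
  shows "of_nat n * (ennreal (exp (- \<eta> * (L + 1)) * w x) *
    emeasure (conv_pow (restr F {..h}) (n - 1)) {- L * b..min J (L * b)}) \<le> emeasure (conv_pow F n) (window T x)"
proof -
  let ?V = "conv_pow (restr F {..h}) (n - 1)" and ?G = "{- L * b..min J (L * b)}"
  have A: "finite_borel (restr F {h<..})" and B: "finite_borel (restr F {..h})"
    by (auto intro!: finite_borel_restr F)
  have V: "finite_borel ?V" using B by (rule finite_borel_conv_pow)
  note [measurable_cong] = finite_borelD(2)[OF V]
  have "- {h<..} = {..h}" by auto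
  then have bin: "emeasure (conv_pow F n) (window T x) = (\<Sum>k\<le>n. of_nat (n choose k) *
      emeasure (conv_pow (restr F {h<..}) k \<star> conv_pow (restr F {..h}) (n - k)) (window T x))"
    using nn_integral_conv_pow_binomial[OF F, of "{h<..}" "indicator (window T x)" n]
      finite_borelD(2)[OF finite_borel_conv_pow[OF F]] by simp
  have "ennreal (exp (- \<eta> * (L + 1)) * w x) * emeasure ?V ?G =
      (\<integral>\<^sup>+s. ennreal (exp (- \<eta> * (L + 1)) * w x) * indicator ?G s \<partial>?V)"
    by (rule nn_integral_cmult_indicator[symmetric]) (subst finite_borelD(2)[OF V], simp)
  also have "\<dots> \<le> (\<integral>\<^sup>+s. emeasure (restr F {h<..}) (window T (x - s)) \<partial>?V)"
  proof (rule nn_integral_mono)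
    fix s
    show "ennreal (exp (- \<eta> * (L + 1)) * w x) * indicator ?G s \<le> emeasure (restr F {h<..}) (window T (x - s))"
    proof (cases "s \<in> ?G")
      case True
      then have s: "\<bar>s\<bar> \<le> L * b" "I \<le> x - s" using x by auto
      have "window T (x - s) \<subseteq> {h<..}" using s h by (auto simp: mem_window)
      then have "{h<..} \<inter> window T (x - s) = window T (x - s)" by blast
      then have e: "emeasure (restr F {h<..}) (window T (x - s)) = ennreal (w (x - s))"
        by (subst emeasure_restr[OF F]) (auto simp: w_def)
      have "\<bar>s\<bar> / b \<le> L" using s b by (simp add: field_simps)
      then have "exp (\<eta> * (\<bar>s\<bar> / b + 1)) \<le> exp (\<eta> * (L + 1))" using \<eta> by (simp add: mult_left_mono)
      then have "exp (\<eta> * (\<bar>s\<bar> / b + 1)) * w (x - s) \<le> exp (\<eta> * (L + 1)) * w (x - s)"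
        using w0 by (rule mult_right_mono)
      then have "w x \<le> exp (\<eta> * (L + 1)) * w (x - s)" using w[OF s(2)] by simp
      then have "exp (- \<eta> * (L + 1)) * w x \<le> exp (- \<eta> * (L + 1)) * (exp (\<eta> * (L + 1)) * w (x - s))"
        by (rule mult_left_mono) simp
      also have "\<dots> = w (x - s)" by (simp add: mult.assoc[symmetric] exp_add[symmetric])
      finally show ?thesis using True e by (simp add: ennreal_leI)
    qed simp
  qed
  also have "\<dots> = emeasure (?V \<star> restr F {h<..}) (window T x)"
    by (rule emeasure_conv_window[OF V A, symmetric])
  also have "\<dots> = emeasure (conv_pow (restr F {h<..}) 1 \<star> ?V) (window T x)"
    using conv_commute[OF V A] conv_pow_1[OF A] by simp
  finally have "of_nat n * (ennreal (exp (- \<eta> * (L + 1)) * w x) * emeasure ?V ?G) \<le>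
      of_nat (n choose 1) * emeasure (conv_pow (restr F {h<..}) 1 \<star> ?V) (window T x)"
    by (simp add: mult_left_mono)
  also have "\<dots> \<le> emeasure (conv_pow F n) (window T x)"
    unfolding bin using n by (intro member_le_sum[of 1]) auto
  finally show ?thesis .
qed

section \<open>The law of the partial sums and bounds for fixed n\<close>

text \<open>Splitting off the last coordinate contributes one factor of the convolution power, and
  its indicator becomes the restriction. An arbitrary \<open>f\<close> is needed to absorb the shift
  by that coordinate.\<close>

lemma nn_integral_PiM_conv_pow:
  assumes F: "prob_space F" "sets F = sets borel" and D[measurable]: "D \<in> sets borel"
  shows "f \<in> borel_measurable borel \<Longrightarrow>
    (\<integral>\<^sup>+x. (\<Prod>i\<in>{1..n}. indicator D (x i)) * f (\<Sum>i\<in>{1..n}. x i) \<partial>PiM {1..n} (\<lambda>_. F)) =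
    (\<integral>\<^sup>+s. f s \<partial>conv_pow (restr F D) n)"
proof (induction n arbitrary: f)
  case 0
  then show ?case by (simp add: PiM_empty nn_integral_return nn_integral_count_space_finite)
next
  case (Suc n)
  note [measurable] = Suc.prems
  note [measurable_cong] = F(2)
  interpret F: prob_space F by fact
  interpret product_sigma_finite "\<lambda>_::nat. F" ..
  have fb: "finite_borel F" using F F.finite_measure_axioms by (auto simp: finite_borel_def)
  have R: "finite_borel (restr F D)" using fb D by (rule finite_borel_restr)
  have P: "finite_borel (conv_pow (restr F D) n)" using R by (rule finite_borel_conv_pow)
  have [measurable]: "(\<lambda>u. \<integral>\<^sup>+s. f (u + s) \<partial>conv_pow (restr F D) n) \<in> borel_measurable borel"
    by (rule measurable_finite_borel_nn_integral[OF P]) measurable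
  have I: "{1..Suc n} = insert (Suc n) {1..n}" by auto
  let ?g = "\<lambda>x. (\<Prod>i\<in>{1..n}. indicator D (x i)) :: ennreal"
  have "(\<integral>\<^sup>+x. (\<Prod>i\<in>{1..Suc n}. indicator D (x i)) * f (\<Sum>i\<in>{1..Suc n}. x i) \<partial>PiM {1..Suc n} (\<lambda>_. F)) =
      (\<integral>\<^sup>+y. \<integral>\<^sup>+x. indicator D y * (?g x * f (y + (\<Sum>i\<in>{1..n}. x i))) \<partial>PiM {1..n} (\<lambda>_. F) \<partial>F)"
  proof -
    have eq: "(\<Prod>i\<in>insert (Suc n) {1..n}. indicator D ((x(Suc n := y)) i)) *
        f (\<Sum>i\<in>insert (Suc n) {1..n}. (x(Suc n := y)) i) =
        indicator D y * (?g x * f (y + (\<Sum>i\<in>{1..n}. x i)))" for x :: "nat \<Rightarrow> real" and y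
    proof -
      have "(\<Prod>i\<in>{1..n}. indicator D ((x(Suc n := y)) i)) = ?g x" by (intro prod.cong) auto
      moreover have "(\<Sum>i\<in>{1..n}. (x(Suc n := y)) i) = (\<Sum>i\<in>{1..n}. x i)" by (intro sum.cong) auto
      ultimately show ?thesis by (simp add: mult.assoc)
    qed
    show ?thesis
      unfolding I by (subst product_nn_integral_insert_rev) (simp_all only: eq, auto)
  qed
  also have "\<dots> = (\<integral>\<^sup>+y. indicator D y * (\<integral>\<^sup>+x. ?g x * f (y + (\<Sum>i\<in>{1..n}. x i)) \<partial>PiM {1..n} (\<lambda>_. F)) \<partial>F)"
    by (intro nn_integral_cong nn_integral_cmult) measurable
  also have "\<dots> = (\<integral>\<^sup>+y. indicator D y * (\<integral>\<^sup>+s. f (y + s) \<partial>conv_pow (restr F D) n) \<partial>F)"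
    by (intro nn_integral_cong) (subst Suc.IH, auto)
  also have "\<dots> = (\<integral>\<^sup>+s. f s \<partial>conv_pow (restr F D) (Suc n))"
    unfolding nn_integral_conv_pow_Suc[OF R Suc.prems]
    by (rule nn_integral_restr[OF fb D, symmetric]) measurable
  finally show ?case .
qed

text \<open>The bridge from events to measures: \<open>D = UNIV\<close> gives the law of the sum,
  \<open>D = {..h n}\<close> the event in the small-steps condition, and two steps with a two-sided
  \<open>D\<close> the event in the truncation condition.\<close>

lemma (in prob_space) partial_sum_law:
  fixes \<xi> :: "nat \<Rightarrow> 'a \<Rightarrow> real"
  assumes ind: "indep_vars (\<lambda>_. borel) \<xi> {1..}"
    and law: "\<And>i. 1 \<le> i \<Longrightarrow> distr M borel (\<xi> i) = F"
    and n: "1 \<le> n" and [measurable]: "D \<in> sets borel" "X \<in> sets borel"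
  shows "\<P>(\<omega> in M. partial_sum \<xi> n \<omega> \<in> X \<and> (\<forall>i\<in>{1..n}. \<xi> i \<omega> \<in> D)) = measure (conv_pow (restr F D) n) X"
proof -
  have rv: "random_variable borel (\<xi> i)" if "1 \<le> i" for i
    using ind that by (auto simp: indep_vars_def)
  have F: "prob_space F" "sets F = sets borel"
    using law[of 1] prob_space_distr[OF rv[of 1]] by auto
  interpret F: prob_space F by (rule F)
  note [measurable_cong] = F(2)
  have fb: "finite_borel F" using F F.finite_measure_axioms by (auto simp: finite_borel_def)
  have P: "finite_borel (conv_pow (restr F D) n)"
    by (intro finite_borel_conv_pow finite_borel_restr fb) measurable
  let ?I = "{1..n}"
  have ind': "indep_vars (\<lambda>_. borel) \<xi> ?I" using ind by (rule indep_vars_subset) auto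
  have joint: "distr M (PiM ?I (\<lambda>_. borel)) (\<lambda>x. \<lambda>i\<in>?I. \<xi> i x) = PiM ?I (\<lambda>_. F)"
    using ind' n rv law by (subst (asm) indep_vars_iff_distr_eq_PiM') (auto intro!: PiM_cong)
  have meas: "(\<lambda>x. \<lambda>i\<in>?I. \<xi> i x) \<in> measurable M (PiM ?I (\<lambda>_. borel))"
    using rv by (intro measurable_restrict) auto
  have [measurable]: "\<xi> i \<in> borel_measurable M" if "i \<in> ?I" for i using rv that by auto
  have ps[measurable]: "(\<lambda>\<omega>. \<Sum>i\<in>?I. \<xi> i \<omega>) \<in> borel_measurable M" by measurable
  let ?E = "{\<omega> \<in> space M. partial_sum \<xi> n \<omega> \<in> X \<and> (\<forall>i\<in>?I. \<xi> i \<omega> \<in> D)}"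
  have E[measurable]: "?E \<in> sets M" unfolding partial_sum_def by measurable
  have prod_ind: "(\<Prod>i\<in>?I. indicator D (x i)) = (if \<forall>i\<in>?I. x i \<in> D then 1 else 0 :: ennreal)" for x :: "nat \<Rightarrow> real"
    by (auto simp: prod_zero_iff split: split_indicator)
  have "emeasure M ?E = (\<integral>\<^sup>+\<omega>. indicator ?E \<omega> \<partial>M)" by (rule nn_integral_indicator[OF E, symmetric])
  also have "\<dots> = (\<integral>\<^sup>+\<omega>. (\<Prod>i\<in>?I. indicator D ((\<lambda>i\<in>?I. \<xi> i \<omega>) i)) * indicator X (\<Sum>i\<in>?I. (\<lambda>i\<in>?I. \<xi> i \<omega>) i) \<partial>M)"
    unfolding prod_ind partial_sum_def by (intro nn_integral_cong) (auto split: split_indicator)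
  also have "\<dots> = (\<integral>\<^sup>+x. (\<Prod>i\<in>?I. indicator D (x i)) * indicator X (\<Sum>i\<in>?I. x i)
      \<partial>distr M (PiM ?I (\<lambda>_. borel)) (\<lambda>x. \<lambda>i\<in>?I. \<xi> i x))"
    by (rule nn_integral_distr[OF meas, symmetric]) measurable
  also have "\<dots> = (\<integral>\<^sup>+s. indicator X s \<partial>conv_pow (restr F D) n)"
    unfolding joint by (rule nn_integral_PiM_conv_pow[OF F]) measurable
  also have "\<dots> = emeasure (conv_pow (restr F D) n) X"
    by (rule nn_integral_indicator) (simp add: finite_borelD[OF P])
  finally show ?thesis by (simp add: measure_def)
qed

lemma emeasure_finite_borel: "finite_borel N \<Longrightarrow> emeasure N X = ennreal (measure N X)"
  using finite_measure.emeasure_eq_measure[OF finite_borelD(1)] .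

lemma scaled_tail_le:
  assumes F: "finite_borel F" and T: "0 < T" and n: "1 \<le> n" and c: "0 \<le> c" and h: "0 \<le> h"
    and \<epsilon>: "0 \<le> \<epsilon>" and A_def: "A = restr F ({..< - c} \<union> {h<..})"
    and pair: "\<And>y. h \<le> y \<Longrightarrow> real n * measure (conv_pow A 2) (window T y) \<le> \<epsilon> * measure F (window T y)"
    and tail_pos: "measure F {h<..} \<noteq> 0"
  shows "\<And>y. h \<le> y \<Longrightarrow> emeasure (A \<star> A) (window T y) \<le> ennreal (\<epsilon> / n) * emeasure F (window T y)"
    and "n * measure F {h<..} \<le> \<epsilon>"
proof -
  note em = emeasure_finite_borel
  have A: "finite_borel A" unfolding A_def by (auto intro!: finite_borel_restr F)
  have AA: "finite_borel (A \<star> A)" using A A by (rule finite_borel_convolution)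
  have n0: "0 < real n" using n by simp
  show pair': "emeasure (A \<star> A) (window T y) \<le> ennreal (\<epsilon> / n) * emeasure F (window T y)" if "h \<le> y" for y
  proof -
    have "measure (A \<star> A) (window T y) \<le> \<epsilon> / n * measure F (window T y)"
      using pair[OF that] n0 by (simp add: conv_pow_2[OF A] field_simps)
    then show ?thesis using \<epsilon>
      by (simp add: em[OF AA] em[OF F] ennreal_mult[symmetric] ennreal_leI)
  qed
  have "emeasure F {h<..} \<le> ennreal (\<epsilon> / n)"
    using tail_pos h by (intro tail_le_of_pair[OF F T c _ A_def pair']) (auto simp: em[OF F])
  then show "n * measure F {h<..} \<le> \<epsilon>"
    using n0 \<epsilon> by (simp add: em[OF F] field_simps)
qed

text \<open>Uses the abstract bound with \<open>e = \<epsilon> / n\<close>,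
  \<open>d = \<delta> * n\<close>, \<open>C = (1 + q) / p\<close> and \<open>c = K * b\<close>. The
  conditions on \<open>\<sigma>\<close> make \<open>\<sigma> / b\<close> times the size of any small
  step at most 1, as the exponential moment requires.\<close>

lemma conv_pow_window_upper_bound:
  fixes F T
  defines "w y \<equiv> measure F (window T y)"
  assumes F: "real_distribution F" and T: "0 < T" and n: "1 \<le> n" and b: "0 < b"
    and h: "0 < h" "h \<le> J" "h \<le> I" and x: "I + J \<le> x" and K: "0 \<le> K"
    and \<sigma>: "0 < \<sigma>" "\<sigma> * K \<le> 1" "\<sigma> * h \<le> b" and \<eta>: "0 \<le> \<eta>" "\<eta> \<le> \<sigma>" "exp \<eta> \<le> 2"
    and step: "\<And>x t. I \<le> x \<Longrightarrow> 0 \<le> t \<Longrightarrow> t \<le> b \<Longrightarrow> w (x - t) \<le> exp \<eta> * w x \<and> w x \<le> exp \<eta> * w (x - t)"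
    and Tb: "\<And>r. T = ereal r \<Longrightarrow> r \<le> b"
    and pow: "\<And>s. \<bar>s\<bar> \<le> \<sigma> / b \<Longrightarrow> norm (char F s ^ n - 1) \<le> 1 / 8"
    and A_def: "A = restr F ({..< - K * b} \<union> {h<..})"
    and pair: "\<And>y. h \<le> y \<Longrightarrow> n * measure (conv_pow A 2) (window T y) \<le> \<epsilon> * w y"
    and tail_pos: "measure F {h<..} \<noteq> 0"
    and small: "\<And>z z'. J \<le> z \<Longrightarrow> z \<le> z' \<Longrightarrow>
      measure (conv_pow (restr F {..h}) n) (window T z') \<le> \<delta> * (n * w z)"
    and p: "0 < p" "p \<le> measure (restr F {..h}) {0..a}" and a: "\<And>r. T = ereal r \<Longrightarrow> a = real q * r"
    and nonneg: "0 \<le> \<epsilon>" "0 \<le> \<delta>" and \<epsilon>: "16 * ((1 + real q) / p) * \<epsilon> \<le> 1"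
  shows "measure (conv_pow F n) (window T x) \<le> n * (2 * \<delta> + exp \<eta> * (1 + 6 * (\<eta> / \<sigma>)) * (1 + 4 * \<epsilon>)) * w x"
proof -
  interpret real_distribution F by fact
  have fb: "finite_borel F" using finite_measure_axioms by (auto simp: finite_borel_def)
  note em = emeasure_finite_borel
  have w0: "0 \<le> w y" for y by (simp add: w_def)
  have ew: "emeasure F (window T y) = ennreal (w y)" for y using em[OF fb] by (simp add: w_def)
  define c where "c = K * b"
  have c: "0 \<le> c" using K b by (simp add: c_def)
  let ?D = "{..< - c} \<union> {h<..}"
  have A_def': "A = restr F ?D" using A_def by (simp add: c_def)
  define B where "B = restr F (- ?D)"
  let ?B' = "restr F {..h}"
  have A: "finite_borel A" and B: "finite_borel B" and B': "finite_borel ?B'"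
    unfolding A_def' B_def by (auto intro!: finite_borel_restr fb)
  note fbs = fb A B B' finite_borel_conv_pow finite_borel_convolution
  have n0: "0 < real n" using n by simp
  note pair' = scaled_tail_le(1)[OF fb T n c _ nonneg(1) A_def' pair[unfolded w_def] tail_pos]
    and tail_n = scaled_tail_le(2)[OF fb T n c _ nonneg(1) A_def' pair[unfolded w_def] tail_pos]
  have pair': "emeasure (A \<star> A) (window T y) \<le> ennreal (\<epsilon> / n) * emeasure F (window T y)" if "h \<le> y" for y
    using pair' that h by simp
  have tail: "emeasure F {h<..} \<le> ennreal (\<epsilon> / n)"
    using tail_n h n0 by (simp add: em[OF fb] field_simps ennreal_leI)
  have step': "w r \<le> exp (\<eta> * (\<bar>r - r'\<bar> / b + 1)) * w r'" if "I \<le> r" "I \<le> r'" for r r'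
    by (rule insensitive_chain[OF b \<eta>(1) step w0 that])
  define C where "C = (1 + real q) / p"
  have "measure ?B' {0..a} \<le> 1"
  proof -
    have "emeasure ?B' {0..a} = emeasure F ({..h} \<inter> {0..a})" by (rule emeasure_restr[OF fb]) auto
    then show ?thesis by (simp add: em[OF fb] em[OF B'] )
  qed
  then have C1: "1 \<le> C" using p by (simp add: C_def field_simps)
  have small': "emeasure (conv_pow B (n - k)) (window T z) \<le>
      ennreal C ^ k * ennreal (\<delta> * n) * emeasure F (window T z)" if "k \<le> n" "J \<le> z" for k z
  proof -
    \<comment> \<open>The small-steps hypothesis restricts steps from above only; cutting also at
      \<open>- c\<close> makes the measure smaller.\<close>
    have "emeasure (conv_pow B (n - k)) (window T z) \<le> emeasure (conv_pow ?B' (n - k)) (window T z)"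
      unfolding B_def by (intro dominated_emeasure dominated_conv_pow dominated_restr fbs(1,4,5) finite_borel_restr) auto
    also have "\<dots> \<le> ennreal ((1 + real q) / p) ^ k * ennreal (\<delta> * n * w z)"
    proof (rule small_steps_fewer[OF B' T that(1) p(1)])
      show "a = real q * r" if "T = ereal r" for r using a[OF that] .
      show "ennreal p \<le> emeasure ?B' {0..a}" using p by (simp add: em[OF B'] ennreal_leI)
      fix z' assume "z \<le> z'"
      then show "emeasure (conv_pow ?B' n) (window T z') \<le> ennreal (\<delta> * n * w z)"
        using small[OF that(2), of z'] by (simp add: em[OF fbs(5)[OF B']] ennreal_leI mult_ac)
    qed
    also have "\<dots> = ennreal C ^ k * ennreal (\<delta> * n) * emeasure F (window T z)"
      using nonneg w0[of z] by (simp add: C_def ew ennreal_mult mult.assoc)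
    finally show ?thesis .
  qed
  define g where "g = exp \<eta> * (1 + 6 * (\<eta> / \<sigma>))"
  have g: "0 \<le> g" using \<eta> \<sigma> by (simp add: g_def)
  have xJ: "I \<le> x - J" using x by simp
  have Ix: "I \<le> x" using x h by simp
  have mid: "(\<integral>\<^sup>+s. indicator {..J} s * emeasure F (window T (x - s)) \<partial>conv_pow B (n - k)) \<le> ennreal g * emeasure F (window T x)" for k
  proof -
    have V: "finite_borel (conv_pow B (n - k))" by (intro fbs)
    have mass: "emeasure (conv_pow B (n - k)) UNIV \<le> 1"
    proof -
      have "emeasure B UNIV \<le> 1"
        using emeasure_restr[OF fb, of "- ?D" UNIV] by (simp add: B_def em[OF fb])
      then show ?thesis unfolding emeasure_conv_pow_UNIV[OF B] by (rule power_le_one[rotated]) simp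
    qed
    have moment: "(\<integral>\<^sup>+s. ennreal (exp (\<sigma> / b * \<bar>s\<bar>)) \<partial>conv_pow B (n - k)) \<le> 6"
      unfolding B_def
    proof (rule nn_integral_exp_conv_pow_le[OF F n _ pow])
      fix y assume "y \<in> - ?D"
      then have "\<sigma> * \<bar>y\<bar> \<le> b"
      proof -
        have "\<sigma> * c \<le> b" using \<sigma>(2) b mult_right_mono[of "\<sigma> * K" 1 b] by (simp add: c_def mult.assoc)
        moreover have "\<bar>y\<bar> \<le> c \<or> \<bar>y\<bar> \<le> h" using \<open>y \<in> - ?D\<close> by auto
        then have "\<sigma> * \<bar>y\<bar> \<le> \<sigma> * c \<or> \<sigma> * \<bar>y\<bar> \<le> \<sigma> * h" using \<sigma>(1) by auto
        ultimately show ?thesis using \<sigma>(3) by linarith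
      qed
      then show "\<sigma> / b * \<bar>y\<bar> \<le> 1" using b by (simp add: field_simps)
    qed (use \<sigma> b in auto)
    have "(\<integral>\<^sup>+s. indicator {..J} s * ennreal (w (x - s)) \<partial>conv_pow B (n - k)) \<le>
      ennreal (exp \<eta> * (1 + 6 * (\<eta> / (\<sigma> / b * b)))) * ennreal (w x)"
      by (rule nn_integral_window_shift_le[OF V mass moment b _ \<eta>(1) _ step' w0 xJ])
         (use \<sigma> b \<eta> Ix in auto)
    then show ?thesis using b by (simp add: ew g_def)
  qed
  have prodJ: "emeasure F (window T J) * emeasure F (window T (x - J)) \<le> 3 * ennreal (\<epsilon> / n) * emeasure F (window T x)"
  proof -
    have big: "emeasure A (window T z) = emeasure F (window T z)" if "h \<le> z" for z
    proof -
      have "?D \<inter> window T z = window T z" using that by (auto simp: mem_window)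
      then show ?thesis unfolding A_def' by (subst emeasure_restr[OF fb]) auto
    qed
    have hx: "h \<le> x" using h Ix by simp
    \<comment> \<open>For finite \<open>T\<close> the adjacent window at \<open>x + r\<close> arises
      by a shift \<open>r \<le> b\<close> and has at most \<open>exp \<eta> \<le> 2\<close> times
      the mass at \<open>x\<close>; hence the total factor 1 + 2 = 3.\<close>
    have "emeasure A (window T J) * emeasure A (window T (x - J)) \<le>
        ennreal (\<epsilon> / n) * ennreal (w x) + ennreal (\<epsilon> / n) * ennreal (2 * w x)"
    proof (rule emeasure_window_pair[OF A T])
      show "emeasure (A \<star> A) (window T x) \<le> ennreal (\<epsilon> / n) * ennreal (w x)"
        using pair'[OF hx] by (simp add: ew)
      fix r assume r: "T = ereal r"
      then have r0: "0 < r" using T by simp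
      have "w (x + r) \<le> exp \<eta> * w (x + r - r)" using step[of "x + r" r] r0 Ix Tb[OF r] by auto
      also have "\<dots> \<le> 2 * w x" using \<eta>(3) w0[of x] by (simp add: mult_right_mono)
      finally have "w (x + r) \<le> 2 * w x" .
      then have "ennreal (\<epsilon> / n) * ennreal (w (x + r)) \<le> ennreal (\<epsilon> / n) * ennreal (2 * w x)"
        by (intro mult_left_mono ennreal_leI) auto
      then show "emeasure (A \<star> A) (window T (x + r)) \<le> ennreal (\<epsilon> / n) * ennreal (2 * w x)"
        using pair'[of "x + r"] hx r0 by (simp add: ew)
    qed
    also have "\<dots> = 3 * ennreal (\<epsilon> / n) * emeasure F (window T x)"
    proof -
      define e where "e = \<epsilon> / n"
      have e: "0 \<le> e" using nonneg by (simp add: e_def)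
      have "ennreal e * ennreal (w x) + ennreal e * ennreal (2 * w x) = ennreal (e * w x) + ennreal (e * (2 * w x))"
        using e w0[of x] ennreal_mult[of e "w x"] ennreal_mult[of e "2 * w x"] by simp
      also have "\<dots> = ennreal (e * w x + e * (2 * w x))"
        using e w0[of x] by (intro ennreal_plus[symmetric]) auto
      also have "e * w x + e * (2 * w x) = 3 * (e * w x)" by simp
      also have "ennreal (3 * (e * w x)) = 3 * ennreal e * ennreal (w x)"
        using e w0[of x] by (simp add: ennreal_mult mult.assoc)
      finally show ?thesis by (simp add: ew e_def)
    qed
    finally show ?thesis using big[of J] big[of "x - J"] h xJ by simp
  qed
  have "emeasure (conv_pow F n) (window T x) \<le>
    (ennreal (\<delta> * n) + (\<Sum>k=1..n. of_nat (n choose k) * (fact k * (2 * ennreal (\<epsilon> / n)) ^ (k - 1) * ennreal g +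
      ennreal C ^ k * ennreal (\<delta> * n) * (fact (k + 1) * (2 * ennreal (\<epsilon> / n)) ^ k) +
      ennreal C ^ k * ennreal (\<delta> * n) * (fact k * (2 * ennreal (\<epsilon> / n)) ^ (k - 1)) * (3 * ennreal (\<epsilon> / n))))) *
    emeasure F (window T x)"
    by (rule emeasure_conv_pow_window_upper[OF fb c _ A_def' B_def pair' tail h(2) _ small' mid prodJ])
       (use h xJ in auto)
  also have "ennreal (\<delta> * n) + (\<Sum>k=1..n. of_nat (n choose k) * (fact k * (2 * ennreal (\<epsilon> / n)) ^ (k - 1) * ennreal g +
      ennreal C ^ k * ennreal (\<delta> * n) * (fact (k + 1) * (2 * ennreal (\<epsilon> / n)) ^ k) +
      ennreal C ^ k * ennreal (\<delta> * n) * (fact k * (2 * ennreal (\<epsilon> / n)) ^ (k - 1)) * (3 * ennreal (\<epsilon> / n)))) =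
    ennreal (\<delta> * n + (\<Sum>k=1..n. (n choose k) * (fact k * (2 * (\<epsilon> / n)) ^ (k - 1) * g +
      C ^ k * (\<delta> * n) * (fact (k + 1) * (2 * (\<epsilon> / n)) ^ k) +
      C ^ k * (\<delta> * n) * (fact k * (2 * (\<epsilon> / n)) ^ (k - 1)) * (3 * (\<epsilon> / n)))))"
  proof -
    have fact: "(fact m :: ennreal) = ennreal (fact m)" for m
      by (metis ennreal_of_nat_eq_real_of_nat of_nat_fact)
    have num: "2 * ennreal e = ennreal (2 * e)" "3 * ennreal e = ennreal (3 * e)" if "0 \<le> e" for e
      using that by (simp_all add: ennreal_mult)
    have "of_nat (n choose k) * (fact k * (2 * ennreal e) ^ (k - 1) * ennreal g +
        ennreal C ^ k * ennreal d * (fact (k + 1) * (2 * ennreal e) ^ k) +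
        ennreal C ^ k * ennreal d * (fact k * (2 * ennreal e) ^ (k - 1)) * (3 * ennreal e)) =
      ennreal ((n choose k) * (fact k * (2 * e) ^ (k - 1) * g + C ^ k * d * (fact (k + 1) * (2 * e) ^ k) +
        C ^ k * d * (fact k * (2 * e) ^ (k - 1)) * (3 * e)))" if "0 \<le> e" "0 \<le> d" for e d k
      unfolding num[OF that(1)] fact ennreal_of_nat_eq_real_of_nat
      using that g C1
      by (simp add: ennreal_power ennreal_mult[symmetric] ennreal_plus[symmetric] del: ennreal_plus fact_Suc)
    note * = this[of "\<epsilon> / n" "\<delta> * n"]
    have en: "0 \<le> \<epsilon> / n" "0 \<le> \<delta> * n" using nonneg by auto
    have sum: "ennreal d + (\<Sum>k=1..n. ennreal (f k)) = ennreal (d + (\<Sum>k=1..n. f k))"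
      if "0 \<le> d" "\<And>k. 0 \<le> f k" for d and f :: "nat \<Rightarrow> real"
      using that by (simp add: sum_nonneg)
    show ?thesis
      unfolding *[OF en]
      by (rule sum) (use en g C1 in \<open>auto intro!: mult_nonneg_nonneg add_nonneg_nonneg zero_le_power simp del: fact_Suc times_divide_eq_right times_divide_eq_left\<close>)
  qed
  also have "\<dots> \<le> ennreal (n * (2 * \<delta> + g * (1 + 4 * \<epsilon>)))"
    by (intro ennreal_leI upper_constant_bound n nonneg C1 g) (use \<epsilon> in \<open>simp add: C_def\<close>)
  finally have "emeasure (conv_pow F n) (window T x) \<le> ennreal (n * (2 * \<delta> + g * (1 + 4 * \<epsilon>))) * ennreal (w x)"
    by (simp add: ew mult_right_mono)
  then have "ennreal (measure (conv_pow F n) (window T x)) \<le> ennreal (n * (2 * \<delta> + g * (1 + 4 * \<epsilon>)) * w x)"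
    using nonneg g w0[of x] by (simp add: em[OF fbs(5)[OF fb]] ennreal_mult)
  then show "measure (conv_pow F n) (window T x) \<le> n * (2 * \<delta> + exp \<eta> * (1 + 6 * (\<eta> / \<sigma>)) * (1 + 4 * \<epsilon>)) * w x"
    using nonneg g w0[of x] unfolding g_def[symmetric] by (subst (asm) ennreal_le_iff) auto
qed

text \<open>\<open>\<epsilon>\<close>, \<open>2 * \<kappa>\<close> and
  \<open>\<delta> * \<epsilon> / p\<close> bound the mass that \<open>n - 1\<close> steps lose to a
  step above \<open>h\<close>, to a sum beyond \<open>L * b\<close> in absolute value, and to a sum
  above \<open>J\<close>.\<close>

lemma conv_pow_window_lower_bound:
  fixes F T
  defines "w y \<equiv> measure F (window T y)"
  assumes F: "real_distribution F" and T: "0 < T" and n: "1 \<le> n" and b: "0 < b"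
    and h: "0 < h" "h \<le> J" "h \<le> I" and x: "I + J \<le> x" and \<eta>: "0 \<le> \<eta>"
    and step: "\<And>x t. I \<le> x \<Longrightarrow> 0 \<le> t \<Longrightarrow> t \<le> b \<Longrightarrow> w (x - t) \<le> exp \<eta> * w x \<and> w x \<le> exp \<eta> * w (x - t)"
    and small: "\<And>z. J \<le> z \<Longrightarrow> measure (conv_pow (restr F {..h}) n) (window T z) \<le> \<delta> * (n * w z)"
    and p: "0 < p" "p \<le> measure (restr F {..h}) {0..a}" and \<delta>: "0 \<le> \<delta>"
    and tail: "n * measure F {h<..} \<le> \<epsilon>"
    and tight: "measure (conv_pow F n) {s. L / 2 * b < \<bar>s\<bar>} \<le> \<kappa>"
    and half: "1 / 2 \<le> measure F {u. \<bar>u\<bar> \<le> L / 2 * b}"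
  shows "n * (exp (- \<eta> * (L + 1)) * (1 - \<epsilon> - 2 * \<kappa> - \<delta> * \<epsilon> / p)) * w x \<le> measure (conv_pow F n) (window T x)"
proof -
  interpret real_distribution F by fact
  have fb: "finite_borel F" using finite_measure_axioms by (auto simp: finite_borel_def)
  note em = emeasure_finite_borel
  have w0: "0 \<le> w y" for y by (simp add: w_def)
  have ew: "emeasure F (window T y) = ennreal (w y)" for y using em[OF fb] by (simp add: w_def)
  let ?B = "restr F {..h}"
  have B: "finite_borel ?B" by (intro finite_borel_restr fb) auto
  note fbs = fb B finite_borel_conv_pow finite_borel_convolution
  let ?V = "conv_pow ?B (n - 1)"
  have V: "finite_borel ?V" by (intro fbs)
  interpret V: finite_measure ?V by (rule finite_borelD[OF V])
  have n': "Suc (n - 1) = n" using n by simp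
  have mono_le: "measure M X * measure N Y \<le> measure (M \<star> N) Z"
    if "finite_borel M" "finite_borel N" "X \<in> sets borel" "Y \<in> sets borel" "Z \<in> sets borel"
      "\<And>x y. x \<in> X \<Longrightarrow> y \<in> Y \<Longrightarrow> x + y \<in> Z" for M N X Y Z
    using emeasure_conv_ge[OF that]
    by (simp add: em[OF that(1)] em[OF that(2)] em[OF finite_borel_convolution[OF that(1,2)]]
      ennreal_mult[symmetric])
  have mass: "1 - \<epsilon> \<le> measure ?V UNIV"
  proof -
    have "emeasure ?B UNIV = emeasure F ({..h} \<inter> UNIV)" by (rule emeasure_restr[OF fb]) auto
    then have "measure ?B UNIV = measure F {..h}" by (simp add: em[OF fb] em[OF B])
    moreover have "{..h} = space F - {h<..}" by auto
    moreover have "measure F (space F - {h<..}) = 1 - measure F {h<..}" by (rule prob_compl) simp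
    ultimately have B1: "measure ?B UNIV = 1 - measure F {h<..}" by metis
    have "ennreal (measure ?V UNIV) = ennreal (measure ?B UNIV ^ (n - 1))"
      using emeasure_conv_pow_UNIV[OF B, of "n - 1"] unfolding em[OF V] em[OF B] by (simp only: ennreal_power measure_nonneg)
    then have V1: "measure ?V UNIV = (1 - measure F {h<..}) ^ (n - 1)" using B1
      by (metis ennreal_inj measure_nonneg zero_le_power)
    have "1 + real (n - 1) * (- measure F {h<..}) \<le> (1 + (- measure F {h<..})) ^ (n - 1)"
      by (rule Bernoulli_inequality) simp
    moreover have "real (n - 1) * measure F {h<..} \<le> n * measure F {h<..}"
      by (intro mult_right_mono) auto
    ultimately show ?thesis using tail V1 by simp
  qed
  \<comment> \<open>\<open>tight\<close> concerns \<open>n\<close> steps. A further step of size at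
    most \<open>L / 2 * b\<close>, which has probability at least 1/2, cannot bring the sum from
    beyond \<open>L * b\<close> back within \<open>L / 2 * b\<close>; hence the factor 2.\<close>
  have far: "measure ?V {s. L * b < \<bar>s\<bar>} \<le> 2 * \<kappa>"
  proof -
    have "measure ?V {s. L * b < \<bar>s\<bar>} \<le> measure (conv_pow F (n - 1)) {s. L * b < \<bar>s\<bar>}"
    proof -
      have "dominated (restr F {..h}) (restr F UNIV)" by (rule dominated_restr[OF fb]) auto
      then have "emeasure ?V {s. L * b < \<bar>s\<bar>} \<le> emeasure (conv_pow F (n - 1)) {s. L * b < \<bar>s\<bar>}"
        by (intro dominated_emeasure dominated_conv_pow fbs) (simp_all add: restr_UNIV[OF fb])
      then show ?thesis unfolding em[OF V] em[OF fbs(3)[OF fb]] by (simp only: ennreal_le_iff measure_nonneg)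
    qed
    moreover have "measure F {u. \<bar>u\<bar> \<le> L / 2 * b} * measure (conv_pow F (n - 1)) {s. L * b < \<bar>s\<bar>} \<le>
        measure (F \<star> conv_pow F (n - 1)) {s. L / 2 * b < \<bar>s\<bar>}"
    proof (intro mono_le fbs)
      fix u s assume "u \<in> {u. \<bar>u\<bar> \<le> L / 2 * b}" "s \<in> {s. L * b < \<bar>s\<bar>}"
      moreover have "L / 2 * b = (L * b) / 2" by simp
      ultimately have "(L * b) / 2 < \<bar>u + s\<bar>" by (simp only: mem_Collect_eq)
      then show "u + s \<in> {s. L / 2 * b < \<bar>s\<bar>}" by simp
    qed auto
    moreover have "(F \<star> conv_pow F (n - 1)) = conv_pow F n" using conv_pow.simps(2)[of F "n - 1"] n' by simp
    moreover have "1 / 2 * measure (conv_pow F (n - 1)) {s. L * b < \<bar>s\<bar>} \<le>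
        measure F {u. \<bar>u\<bar> \<le> L / 2 * b} * measure (conv_pow F (n - 1)) {s. L * b < \<bar>s\<bar>}"
      by (intro mult_right_mono half) auto
    ultimately show ?thesis using tight by simp
  qed
  \<comment> \<open>Appending one step from \<open>{0..a}\<close> to reach \<open>n\<close> steps
    costs \<open>1 / p\<close>; the small-steps bound is then summed over the windows beyond
    \<open>J\<close>.\<close>
  have high: "measure ?V {J<..} \<le> \<delta> * \<epsilon> / p"
  proof -
    have Pn: "finite_borel (conv_pow ?B n)" by (intro fbs)
    have "p * measure ?V {J<..} \<le> measure ?B {0..a} * measure ?V {J<..}"
      by (intro mult_right_mono p) auto
    also have "\<dots> \<le> measure (?B \<star> ?V) {J<..}" by (intro mono_le fbs) auto
    also have "(?B \<star> ?V) = conv_pow ?B n" using conv_pow.simps(2)[of ?B "n - 1"] n' by simp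
    also have "measure (conv_pow ?B n) {J<..} \<le> \<delta> * n * measure F {J<..}"
    proof -
      have "emeasure (conv_pow ?B n) {J<..} \<le> ennreal (\<delta> * n) * emeasure F {J<..}"
      proof (rule emeasure_window_le_tail[OF Pn fb T])
        fix z assume "J \<le> z"
        then show "emeasure (conv_pow ?B n) (window T z) \<le> ennreal (\<delta> * n) * emeasure F (window T z)"
          using small[of z] \<delta> w0[of z]
          by (simp add: em[OF Pn] ew ennreal_mult[symmetric] ennreal_leI mult.assoc)
      qed
      then show ?thesis using \<delta> by (simp add: em[OF Pn] em[OF fb] ennreal_mult[symmetric])
    qed
    also have "\<dots> \<le> \<delta> * (n * measure F {h<..})"
      unfolding mult.assoc using \<delta> h by (intro mult_left_mono finite_measure_mono) auto
    also have "\<dots> \<le> \<delta> * \<epsilon>" by (intro mult_left_mono tail \<delta>)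
    finally show ?thesis using p by (simp add: field_simps)
  qed
  let ?G = "{- L * b..min J (L * b)}"
  have "measure ?V UNIV \<le> measure ?V (?G \<union> ({s. L * b < \<bar>s\<bar>} \<union> {J<..}))"
    by (intro V.finite_measure_mono) (simp_all only: finite_borelD(2)[OF V], auto)
  also have "\<dots> \<le> measure ?V ?G + measure ?V ({s. L * b < \<bar>s\<bar>} \<union> {J<..})"
    by (intro measure_Un_le) (simp_all only: finite_borelD(2)[OF V], auto)
  also have "measure ?V ({s. L * b < \<bar>s\<bar>} \<union> {J<..}) \<le> measure ?V {s. L * b < \<bar>s\<bar>} + measure ?V {J<..}"
    by (intro measure_Un_le) (simp_all only: finite_borelD(2)[OF V], auto)
  finally have G: "1 - \<epsilon> - 2 * \<kappa> - \<delta> * \<epsilon> / p \<le> measure ?V ?G" using mass far high by simp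
  have "of_nat n * (ennreal (exp (- \<eta> * (L + 1)) * w x) * emeasure ?V ?G) \<le> emeasure (conv_pow F n) (window T x)"
  proof (rule emeasure_conv_pow_window_lower[OF fb n b ew w0 _ \<eta> h(3)])
    show "I \<le> x - J" using x by simp
    fix r assume r: "I \<le> r"
    have Ix: "I \<le> x" using x h by simp
    have "w x \<le> exp (\<eta> * (\<bar>x - r\<bar> / b + 1)) * w r"
      by (rule insensitive_chain[OF b \<eta> step w0 Ix r])
    then show "w x \<le> exp (\<eta> * (\<bar>r - x\<bar> / b + 1)) * w r" by (simp only: abs_minus_commute)
  qed
  then have "ennreal (n * (exp (- \<eta> * (L + 1)) * w x * measure ?V ?G)) \<le> ennreal (measure (conv_pow F n) (window T x))"
    using w0[of x] unfolding em[OF V] em[OF fbs(3)[OF fb]]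
    by (simp add: ennreal_of_nat_eq_real_of_nat ennreal_mult)
  then have "n * (exp (- \<eta> * (L + 1)) * w x * measure ?V ?G) \<le> measure (conv_pow F n) (window T x)"
    by simp
  moreover have "n * (exp (- \<eta> * (L + 1)) * w x * (1 - \<epsilon> - 2 * \<kappa> - \<delta> * \<epsilon> / p)) \<le>
      n * (exp (- \<eta> * (L + 1)) * w x * measure ?V ?G)"
    using G w0[of x] by (intro mult_left_mono) auto
  ultimately show ?thesis by (simp only: mult_ac)
qed

section \<open>Choice of the constants and passage to large \<open>n\<close>\<close>

lemma exp_step_of_ratio:
  fixes u v \<eta> :: real
  assumes "\<bar>u / v - 1\<bar> \<le> \<eta> / 2" "0 < v" "0 \<le> \<eta>" "\<eta> \<le> 1"
  shows "u \<le> exp \<eta> * v \<and> v \<le> exp \<eta> * u"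
proof
  have r: "u / v \<le> 1 + \<eta> / 2" "1 - \<eta> / 2 \<le> u / v" using assms(1) by linarith+
  then have "u \<le> (1 + \<eta> / 2) * v" "(1 - \<eta> / 2) * v \<le> u"
    using assms(2) by (auto simp: field_simps)
  moreover have e: "1 + \<eta> \<le> exp \<eta>" by (rule exp_ge_add_one_self)
  moreover have "(1 + \<eta> / 2) * v \<le> exp \<eta> * v" using order_trans[OF _ e, of "1 + \<eta> / 2"] assms
    by (intro mult_right_mono) auto
  ultimately show "u \<le> exp \<eta> * v" by linarith
  \<comment> \<open>The inverse ratio is at most \<open>1 / (1 - \<eta> / 2)\<close>, which is at
    most \<open>1 + \<eta>\<close> because \<open>\<eta> \<le> 1\<close>.\<close>
  have "1 \<le> (1 + \<eta>) * (1 - \<eta> / 2)"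
  proof -
    have "0 \<le> \<eta> / 2 * (1 - \<eta>)" using assms by (intro mult_nonneg_nonneg) auto
    then show ?thesis by (simp add: algebra_simps)
  qed
  then have "1 * v \<le> ((1 + \<eta>) * (1 - \<eta> / 2)) * v" using assms by (intro mult_right_mono) auto
  also have "\<dots> \<le> exp \<eta> * u"
    unfolding mult.assoc using e assms \<open>(1 - \<eta> / 2) * v \<le> u\<close> by (intro mult_mono) auto
  finally show "v \<le> exp \<eta> * u" by simp
qed

lemma small_eta_exists:
  fixes \<sigma> L \<theta> :: real
  assumes "0 < \<sigma>" "0 < \<theta>"
  shows "\<exists>\<eta>>0. \<eta> \<le> \<sigma> \<and> \<eta> \<le> 1 / 2 \<and> exp \<eta> * (1 + 6 * (\<eta> / \<sigma>)) \<le> 1 + \<theta> \<and> 1 - \<theta> \<le> exp (- \<eta> * (L + 1))"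
proof -
  have "((\<lambda>\<eta>. exp \<eta> * (1 + 6 * (\<eta> / \<sigma>))) \<longlongrightarrow> exp 0 * (1 + 6 * (0 / \<sigma>))) (at_right 0)"
    "((\<lambda>\<eta>. exp (- \<eta> * (L + 1))) \<longlongrightarrow> exp (- 0 * (L + 1))) (at_right 0)"
    using assms by (auto intro!: tendsto_eq_intros)
  then have "eventually (\<lambda>\<eta>. exp \<eta> * (1 + 6 * (\<eta> / \<sigma>)) < 1 + \<theta>) (at_right 0)"
    "eventually (\<lambda>\<eta>. 1 - \<theta> < exp (- \<eta> * (L + 1))) (at_right 0)"
    using assms by (auto elim!: order_tendstoD)
  moreover have "eventually (\<lambda>\<eta>. 0 < \<eta> \<and> \<eta> < min \<sigma> (1 / 2)) (at_right (0::real))"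
    using assms eventually_at_right_less[of 0] eventually_at_right_real[of 0 "min \<sigma> (1/2)"]
    by (auto elim!: eventually_mono)
  ultimately have "eventually (\<lambda>\<eta>. 0 < \<eta> \<and> \<eta> \<le> \<sigma> \<and> \<eta> \<le> 1 / 2 \<and>
      exp \<eta> * (1 + 6 * (\<eta> / \<sigma>)) \<le> 1 + \<theta> \<and> 1 - \<theta> \<le> exp (- \<eta> * (L + 1))) (at_right 0)"
    by eventually_elim auto
  then show ?thesis using eventually_happens[of _ "at_right (0::real)"] by (auto simp: trivial_limit_at_right_real)
qed

text \<open>Besides fixing constants, the proof derives what the bounds for fixed \<open>n\<close>
  take for granted: \<open>h n\<close> and \<open>b n\<close> exceed any constant,
  \<open>h n \<le> I n\<close>, and steps in \<open>{0..a}\<close> keep mass at least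
  \<open>p\<close> after truncation.\<close>

lemma conv_pow_window_ratio_near_one:
  fixes F :: "real measure" and T :: ereal and b I h J :: "nat \<Rightarrow> real"
    and w :: "real \<Rightarrow> real"
  defines "w \<equiv> \<lambda>y. measure F (window T y)"
  assumes F: "real_distribution F" and T: "0 < T"
    and pos: "\<And>n. 1 \<le> n \<Longrightarrow> 0 < b n" "\<And>n. 1 \<le> n \<Longrightarrow> 0 < h n" "\<And>n. 1 \<le> n \<Longrightarrow> 0 < I n"
    and tight: "\<And>\<epsilon>. 0 < \<epsilon> \<Longrightarrow> \<exists>K>0. \<forall>n\<ge>1. measure (conv_pow F n) {s. K * b n < \<bar>s\<bar>} \<le> \<epsilon>"
    and char: "\<exists>t>0. \<forall>n\<ge>1. \<forall>s. \<bar>s\<bar> \<le> t / b n \<longrightarrow> norm (char F s ^ n - 1) \<le> 1 / 8"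
    and bI: "(\<lambda>n. b n / I n) \<longlonglongrightarrow> 0"
    and wI: "\<forall>\<^sub>F n in sequentially. \<forall>x\<ge>I n. 0 < w x"
    and insens: "\<And>\<epsilon>. 0 < \<epsilon> \<Longrightarrow> \<forall>\<^sub>F n in sequentially. \<forall>x\<ge>I n. \<forall>t\<in>{0..b n}. \<bar>w (x - t) / w x - 1\<bar> \<le> \<epsilon>"
    and wh: "\<forall>\<^sub>F n in sequentially. \<forall>x\<ge>h n. 0 < w x"
    and trunc: "\<And>\<epsilon>. 0 < \<epsilon> \<Longrightarrow> \<exists>K>0. \<forall>\<^sub>F n in sequentially. \<forall>x\<ge>h n.
      n * measure (conv_pow (restr F ({..< - K * b n} \<union> {h n<..})) 2) (window T x) \<le> \<epsilon> * w x"
    and small: "\<And>\<epsilon>. 0 < \<epsilon> \<Longrightarrow> \<forall>\<^sub>F n in sequentially. \<forall>x\<ge>J n. \<forall>z\<ge>x.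
      measure (conv_pow (restr F {..h n}) n) (window T z) \<le> \<epsilon> * (n * w x)"
    and hb: "\<exists>C>0. \<forall>\<^sub>F n in sequentially. h n \<le> C * b n"
    and hJ: "\<And>n. 1 \<le> n \<Longrightarrow> h n \<le> J n"
    and \<theta>: "0 < \<theta>" "\<theta> \<le> 1"
  shows "\<forall>\<^sub>F n in sequentially. \<forall>x\<ge>I n + J n. \<bar>measure (conv_pow F n) (window T x) / (n * w x) - 1\<bar> \<le> \<theta>"
proof -
  interpret real_distribution F by fact
  have fb: "finite_borel F" using finite_measure_axioms by (auto simp: finite_borel_def)
  have ge1: "\<forall>\<^sub>F n in sequentially. 1 \<le> n" by (rule eventually_ge_at_top)
  \<comment> \<open>A single index suffices for a point beyond which all windows have positive mass,
    and this makes every right tail of \<open>F\<close> positive.\<close>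
  obtain N x0 where x0: "1 \<le> N" "h N = x0" "0 < x0" "\<And>x. x0 \<le> x \<Longrightarrow> 0 < w x"
  proof -
    obtain N where "1 \<le> N" "\<forall>x\<ge>h N. 0 < w x"
      using eventually_conj[OF wh ge1] by (auto simp: eventually_sequentially)
    then show thesis using that[of N "h N"] pos by auto
  qed
  have tail_pos: "0 < measure F {A<..}" for A
  proof -
    have "0 < w (max A x0)" using x0(4)[of "max A x0"] by simp
    also have "\<dots> \<le> measure F {A<..}" unfolding w_def
      by (intro finite_measure_mono) (auto simp: mem_window)
    finally show ?thesis .
  qed
  obtain m :: nat where m: "0 < measure F {0..real m}"
  proof -
    have "(\<lambda>m. measure F {0..real m}) \<longlonglongrightarrow> measure F (\<Union>m. {0..real m})"
      by (intro finite_Lim_measure_incseq) (auto simp: incseq_def)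
    moreover have "measure F {0<..} \<le> measure F (\<Union>m. {0..real m})"
      using real_arch_simple by (intro finite_measure_mono) fastforce+
    then have "0 < measure F (\<Union>m. {0..real m})" using tail_pos[of 0] by simp
    ultimately have "\<forall>\<^sub>F m in sequentially. 0 < measure F {0..real m}" by (rule order_tendstoD)
    then show thesis using that by (auto simp: eventually_sequentially)
  qed
  \<comment> \<open>For finite \<open>T\<close> the length \<open>a\<close> is rounded up to a
    multiple of the window length, so that whole windows cover the widened ones; for infinite
    \<open>T\<close> nothing widens and \<open>q = 0\<close> works.\<close>
  obtain q :: nat and a :: real where qa: "real m \<le> a" "\<And>r. T = ereal r \<Longrightarrow> a = real q * r"
  proof (cases T)
    case (real r)
    then have "0 < r" using T by simp
    obtain q :: nat where "real m / r \<le> real q" using real_arch_simple by blast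
    then show thesis using that[of "real q * r" q] real \<open>0 < r\<close> by (simp add: field_simps)
  next
    case PInf
    then show thesis using that[of "real m" 0] by simp
  qed (use T in simp)
  define p where "p = measure F {0..a}"
  have "measure F {0..real m} \<le> p" unfolding p_def using qa by (intro finite_measure_mono) auto
  then have p: "0 < p" "p \<le> 1" using m by (auto simp: p_def)
  define c where "c = (1 + real q) / p"
  have c: "0 < c" using p by (simp add: c_def)
  define \<epsilon> where "\<epsilon> = min (\<theta> / 32) (1 / (16 * c))"
  have \<epsilon>: "0 < \<epsilon>" "\<epsilon> \<le> \<theta> / 32" "16 * c * \<epsilon> \<le> 1"
  proof -
    show "0 < \<epsilon>" "\<epsilon> \<le> \<theta> / 32" using c \<theta> by (auto simp: \<epsilon>_def)
    have "\<epsilon> \<le> 1 / (16 * c)" by (simp add: \<epsilon>_def)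
    then show "16 * c * \<epsilon> \<le> 1" using c by (simp add: field_simps)
  qed
  obtain K where K: "0 < K" and ev_pair: "\<forall>\<^sub>F n in sequentially. \<forall>x\<ge>h n.
      n * measure (conv_pow (restr F ({..< - K * b n} \<union> {h n<..})) 2) (window T x) \<le> \<epsilon> * w x"
    using trunc[OF \<epsilon>(1)] by blast
  obtain t0 where t0: "0 < t0" and char': "\<And>n s. 1 \<le> n \<Longrightarrow> \<bar>s\<bar> \<le> t0 / b n \<Longrightarrow> norm (char F s ^ n - 1) \<le> 1 / 8"
    using char by blast
  obtain C where C: "0 < C" and ev_hb: "\<forall>\<^sub>F n in sequentially. h n \<le> C * b n" using hb by blast
  define \<sigma> where "\<sigma> = min t0 (min (1 / K) (1 / C))"
  have \<sigma>: "0 < \<sigma>" "\<sigma> \<le> t0" "\<sigma> * K \<le> 1" "\<sigma> * C \<le> 1"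
  proof -
    show "0 < \<sigma>" "\<sigma> \<le> t0" using t0 K C by (auto simp: \<sigma>_def)
    have "\<sigma> \<le> 1 / K" "\<sigma> \<le> 1 / C" by (auto simp: \<sigma>_def)
    then show "\<sigma> * K \<le> 1" "\<sigma> * C \<le> 1" using K C by (auto simp: field_simps)
  qed
  obtain L where L: "0 < L" and L_tight: "\<And>n. 1 \<le> n \<Longrightarrow> measure (conv_pow F n) {s. L / 2 * b n < \<bar>s\<bar>} \<le> \<theta> / 32"
  proof -
    obtain L' where "0 < L'" "\<forall>n\<ge>1. measure (conv_pow F n) {s. L' * b n < \<bar>s\<bar>} \<le> \<theta> / 32"
      using tight[of "\<theta> / 32"] \<theta> by auto
    then show thesis using that[of "2 * L'"] by auto
  qed
  obtain \<eta> where \<eta>: "0 < \<eta>" "\<eta> \<le> \<sigma>" "\<eta> \<le> 1 / 2" "exp \<eta> * (1 + 6 * (\<eta> / \<sigma>)) \<le> 1 + \<theta> / 8"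
      "1 - \<theta> / 8 \<le> exp (- \<eta> * (L + 1))"
    using small_eta_exists[OF \<sigma>(1), of "\<theta> / 8" L] \<theta> by auto
  have exp2: "exp \<eta> \<le> 2"
  proof -
    have "exp \<eta> \<le> exp (1 / 2)" using \<eta> by simp
    also have "exp (1 / 2 :: real) \<le> 1 + 1 / 2 + (1 / 2)\<^sup>2" by (rule exp_bound) auto
    finally show ?thesis by (simp add: power2_eq_square)
  qed
  \<comment> \<open>The factor \<open>p\<close> compensates the \<open>1 / p\<close> in the error
    \<open>\<delta> * \<epsilon> / p\<close> of the lower bound.\<close>
  define \<delta> where "\<delta> = \<theta> * p / 16"
  have \<delta>: "0 < \<delta>" "\<delta> \<le> \<theta> / 16" "\<delta> / p \<le> \<theta> / 16"
    using p \<theta> by (auto simp: \<delta>_def mult_left_le)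
  \<comment> \<open>Proved for every bound, each with its own \<open>K\<close>: it is used at the
    fixed \<open>\<epsilon>\<close> and also at half a tail of \<open>F\<close>, which forces
    \<open>h n\<close> to be large.\<close>
  have ev_tail: "\<forall>\<^sub>F n in sequentially. n * measure F {h n<..} \<le> \<epsilon>" if \<epsilon>: "0 < \<epsilon>" for \<epsilon>
  proof -
    obtain K where K: "0 < K" and ev: "\<forall>\<^sub>F n in sequentially. \<forall>x\<ge>h n.
        n * measure (conv_pow (restr F ({..< - K * b n} \<union> {h n<..})) 2) (window T x) \<le> \<epsilon> * w x"
      using trunc[OF \<epsilon>] by blast
    from ev ge1 show ?thesis
    proof eventually_elim
      case (elim n)
      show ?case
        by (rule scaled_tail_le(2)[OF fb T _ _ _ _ refl, of n "K * b n"])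
           (use elim K \<epsilon> tail_pos[of "h n"] pos[of n] in \<open>auto simp: w_def\<close>)
    qed
  qed
  have h_large: "\<forall>\<^sub>F n in sequentially. A \<le> h n" for A
  proof -
    have A: "0 < measure F {A<..}" by (rule tail_pos)
    from ev_tail[of "measure F {A<..} / 2"] A
    have "\<forall>\<^sub>F n in sequentially. n * measure F {h n<..} \<le> measure F {A<..} / 2" by simp
    then show ?thesis using ge1
    proof eventually_elim
      case (elim n)
      have "1 * measure F {h n<..} \<le> n * measure F {h n<..}" using elim by (intro mult_right_mono) auto
      then have lt: "measure F {h n<..} < measure F {A<..}" using elim A by linarith
      show ?case
      proof (rule ccontr)
        assume "\<not> A \<le> h n"
        then have "measure F {A<..} \<le> measure F {h n<..}" by (intro finite_measure_mono) auto
        then show False using lt by simp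
      qed
    qed
  qed
  have b_large: "\<forall>\<^sub>F n in sequentially. A \<le> b n" for A
    using h_large[of "C * A"] ev_hb
  proof eventually_elim
    case (elim n)
    then have "C * A \<le> C * b n" by linarith
    then show ?case using C by simp
  qed
  have I_large: "\<forall>\<^sub>F n in sequentially. h n \<le> I n"
  proof -
    have "\<forall>\<^sub>F n in sequentially. b n / I n < 1 / C" using bI C by (auto elim!: order_tendstoD)
    then show ?thesis using ev_hb ge1
    proof eventually_elim
      case (elim n)
      then have "C * b n < I n" using C pos[of n] by (simp add: field_simps)
      then show ?case using elim by simp
    qed
  qed
  have half: "\<forall>\<^sub>F n in sequentially. 1 / 2 \<le> measure F {u. \<bar>u\<bar> \<le> L / 2 * b n}"
  proof -
    have "(\<lambda>m. measure F {u. \<bar>u\<bar> \<le> real m}) \<longlonglongrightarrow> measure F (\<Union>m. {u. \<bar>u\<bar> \<le> real m})"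
      by (intro finite_Lim_measure_incseq) (auto simp: incseq_def)
    moreover have "(\<Union>m. {u. \<bar>u\<bar> \<le> real m}) = space F" using real_arch_simple by fastforce
    ultimately have "(\<lambda>m. measure F {u. \<bar>u\<bar> \<le> real m}) \<longlonglongrightarrow> 1" using prob_space by simp
    then have "\<forall>\<^sub>F m in sequentially. 1 / 2 < measure F {u. \<bar>u\<bar> \<le> real m}" by (rule order_tendstoD) simp
    then obtain m where m: "1 / 2 < measure F {u. \<bar>u\<bar> \<le> real m}" by (auto simp: eventually_sequentially)
    show ?thesis using b_large[of "2 * real m / L"]
    proof eventually_elim
      case (elim n)
      then have "real m \<le> L / 2 * b n" using L by (simp add: field_simps)
      then have "measure F {u. \<bar>u\<bar> \<le> real m} \<le> measure F {u. \<bar>u\<bar> \<le> L / 2 * b n}"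
        by (intro finite_measure_mono) auto
      then show ?case using m by simp
    qed
  qed
  have p_le: "\<forall>\<^sub>F n in sequentially. p \<le> measure (restr F {..h n}) {0..a}"
    using h_large[of a]
  proof eventually_elim
    case (elim n)
    have "{..h n} \<inter> {0..a} = {0..a}" using elim by auto
    then have "emeasure (restr F {..h n}) {0..a} = emeasure F {0..a}"
      by (subst emeasure_restr[OF fb]) auto
    then show ?case by (simp add: p_def measure_def)
  qed
  have Tb: "\<forall>\<^sub>F n in sequentially. \<forall>r. T = ereal r \<longrightarrow> r \<le> b n"
    using b_large by (cases T) auto
  show ?thesis
    using ge1 wI insens[of "\<eta> / 2", simplified, OF \<eta>(1)] ev_pair small[OF \<delta>(1)] ev_hb
      ev_tail[OF \<epsilon>(1)] I_large half p_le Tb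
  proof eventually_elim
    case (elim n)
    have n: "1 \<le> n" and bn: "0 < b n" and hn: "0 < h n" and hJn: "h n \<le> J n"
      using elim(1) pos hJ by auto
    have step: "w (y - t) \<le> exp \<eta> * w y \<and> w y \<le> exp \<eta> * w (y - t)" if "I n \<le> y" "0 \<le> t" "t \<le> b n" for y t
      using that elim(2,3) \<eta> by (intro exp_step_of_ratio) auto
    have \<sigma>h: "\<sigma> * h n \<le> b n"
    proof -
      have "\<sigma> * h n \<le> \<sigma> * (C * b n)" using elim(6) \<sigma> by (intro mult_left_mono) auto
      also have "\<dots> \<le> 1 * b n" unfolding mult.assoc[symmetric] using \<sigma> bn by (intro mult_right_mono) auto
      finally show ?thesis by simp
    qed
    show ?case
    proof (intro allI impI)
      fix x assume x: "I n + J n \<le> x"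
      then have wx: "0 < w x" using elim(2) hJn hn by auto
      then have nw: "0 < n * w x" using n by simp
      have up: "measure (conv_pow F n) (window T x) \<le>
          n * (2 * \<delta> + exp \<eta> * (1 + 6 * (\<eta> / \<sigma>)) * (1 + 4 * \<epsilon>)) * w x"
        unfolding w_def
      proof (rule conv_pow_window_upper_bound[OF F T n bn hn hJn elim(8) x _ \<sigma>(1,3) \<sigma>h _ \<eta>(2) exp2 _ _ _ refl])
        show "norm (char F s ^ n - 1) \<le> 1 / 8" if "\<bar>s\<bar> \<le> \<sigma> / b n" for s
        proof (rule char'[OF n])
          have "\<sigma> / b n \<le> t0 / b n" using \<sigma> bn by (intro divide_right_mono) auto
          then show "\<bar>s\<bar> \<le> t0 / b n" using that by simp
        qed
        show "a = real q * r" if "T = ereal r" for r using qa(2)[OF that] .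
      qed (use K \<eta> step elim(4,5,10,11) tail_pos[of "h n"] p \<epsilon> \<delta> in \<open>auto simp: w_def c_def\<close>)
      have "n * (exp (- \<eta> * (L + 1)) * (1 - \<epsilon> - 2 * (\<theta> / 32) - \<delta> * \<epsilon> / p)) * measure F (window T x) \<le>
          measure (conv_pow F n) (window T x)"
      proof (rule conv_pow_window_lower_bound[OF F T n bn hn hJn elim(8) x _ _ _ p(1) elim(10) _ elim(7) L_tight[OF n] elim(9)])
      qed (use \<eta> \<delta> step elim(5) in \<open>auto simp: w_def\<close>)
      then have low: "n * (exp (- \<eta> * (L + 1)) * (1 - \<epsilon> - 2 * (\<theta> / 32) - \<delta> * \<epsilon> / p)) * w x \<le>
          measure (conv_pow F n) (window T x)" by (simp add: w_def)
      have cu: "2 * \<delta> + exp \<eta> * (1 + 6 * (\<eta> / \<sigma>)) * (1 + 4 * \<epsilon>) \<le> 1 + \<theta>"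
      proof -
        have "exp \<eta> * (1 + 6 * (\<eta> / \<sigma>)) * (1 + 4 * \<epsilon>) \<le> (1 + \<theta> / 8) * (1 + \<theta> / 8)"
          using \<eta>(4) \<epsilon> \<theta> by (intro mult_mono) auto
        also have "\<dots> = 1 + \<theta> / 4 + \<theta> * \<theta> / 64" by (simp add: field_simps)
        also have "\<theta> * \<theta> \<le> 1 * \<theta>" using \<theta> by (intro mult_right_mono) auto
        finally show ?thesis using \<delta>(2) \<theta> by simp
      qed
      have cl: "1 - \<theta> \<le> exp (- \<eta> * (L + 1)) * (1 - \<epsilon> - 2 * (\<theta> / 32) - \<delta> * \<epsilon> / p)"
      proof -
        have "\<delta> / p * \<epsilon> \<le> \<theta> / 16 * 1" using \<delta> \<epsilon> \<theta> p by (intro mult_mono) auto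
        then have "1 - \<theta> / 4 \<le> 1 - \<epsilon> - 2 * (\<theta> / 32) - \<delta> * \<epsilon> / p" using \<epsilon> \<theta> by simp
        then have "(1 - \<theta> / 8) * (1 - \<theta> / 4) \<le> exp (- \<eta> * (L + 1)) * (1 - \<epsilon> - 2 * (\<theta> / 32) - \<delta> * \<epsilon> / p)"
          using \<eta>(5) \<theta> by (intro mult_mono) auto
        moreover have "1 - \<theta> \<le> (1 - \<theta> / 8) * (1 - \<theta> / 4)"
        proof -
          have "(1 - \<theta> / 8) * (1 - \<theta> / 4) = 1 - 3 / 8 * \<theta> + \<theta> * \<theta> / 32" by (simp add: field_simps)
          moreover have "0 \<le> \<theta> * \<theta>" by simp
          ultimately show ?thesis using \<theta> by linarith
        qed
        ultimately show ?thesis by linarith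
      qed
      have "measure (conv_pow F n) (window T x) \<le> (1 + \<theta>) * (n * w x)"
        using up mult_right_mono[OF cu, of "n * w x"] nw by (simp add: mult_ac)
      moreover have "(1 - \<theta>) * (n * w x) \<le> measure (conv_pow F n) (window T x)"
        using low mult_right_mono[OF cl, of "n * w x"] nw by (simp add: mult_ac)
      ultimately have "measure (conv_pow F n) (window T x) / (n * w x) \<le> 1 + \<theta>"
        "1 - \<theta> \<le> measure (conv_pow F n) (window T x) / (n * w x)"
        using nw by (auto simp: pos_divide_le_eq pos_le_divide_eq)
      then show "\<bar>measure (conv_pow F n) (window T x) / (n * w x) - 1\<bar> \<le> \<theta>" by linarith
    qed
  qed
qed

text \<open>The integrand \<open>iexp (s * x) - 1\<close> has norm at most 1/16 for
  \<open>\<bar>x\<bar> \<le> R\<close> and at most 2 on the remaining mass 1/32; these add up to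
  1/8.\<close>

lemma char_near_one:
  assumes "real_distribution \<mu>" and far: "measure \<mu> {x. R < \<bar>x\<bar>} \<le> 1 / 32" and s: "\<bar>s\<bar> * R \<le> 1 / 16"
  shows "norm (char \<mu> s - 1) \<le> 1 / 8"
proof -
  interpret real_distribution \<mu> by fact
  have int: "integrable \<mu> (\<lambda>x. iexp (s * x))" by (rule integrable_iexp) auto
  have "char \<mu> s - 1 = (\<integral>x. iexp (s * x) - 1 \<partial>\<mu>)"
    unfolding char_def using int by (simp add: prob_space[unfolded space_eq_univ])
  also have "norm \<dots> \<le> (\<integral>x. norm (iexp (s * x) - 1) \<partial>\<mu>)" by (rule integral_norm_bound)
  also have "\<dots> \<le> (\<integral>x. 1 / 16 + 2 * indicator {x. R < \<bar>x\<bar>} x \<partial>\<mu>)"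
  proof (rule integral_mono)
    show "integrable \<mu> (\<lambda>x. norm (iexp (s * x) - 1))" using int by simp
    show "integrable \<mu> (\<lambda>x. 1 / 16 + 2 * indicator {x. R < \<bar>x\<bar>} x :: real)" 
      by (rule integrable_const_bound[of _ 3]) (auto split: split_indicator)
    fix x
    show "norm (iexp (s * x) - 1) \<le> 1 / 16 + 2 * indicator {x. R < \<bar>x\<bar>} x"
    proof (cases "R < \<bar>x\<bar>")
      case True
      have "norm (iexp (s * x) - 1) \<le> norm (iexp (s * x)) + norm (1 :: complex)" by (rule norm_triangle_ineq4)
      then show ?thesis using True by simp
    next
      case False
      have "norm (iexp (s * x) - 1) \<le> \<bar>s * x\<bar>" using iexp_approx1[of "s * x" 0] by simp
      also have "\<dots> \<le> \<bar>s\<bar> * R" using False by (simp add: abs_mult mult_left_mono)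
      finally show ?thesis using False s by simp
    qed
  qed
  also have "\<dots> = 1 / 16 + 2 * measure \<mu> {x. R < \<bar>x\<bar>}"
    by (subst Bochner_Integration.integral_add) (auto simp: emeasure_eq_measure prob_space[unfolded space_eq_univ])
  finally show ?thesis using far by simp
qed

section \<open>Suprema in the extended reals and translation of the hypotheses\<close>

lemma SUP_tendsto_zeroD:
  fixes f :: "nat \<Rightarrow> 'b \<Rightarrow> ereal"
  assumes lim: "(\<lambda>n. SUP x\<in>S n. f n x) \<longlonglongrightarrow> 0" and \<epsilon>: "(0::real) < \<epsilon>"
  shows "\<forall>\<^sub>F n in sequentially. \<forall>x\<in>S n. f n x \<le> ereal \<epsilon>"
proof -
  have "\<forall>\<^sub>F n in sequentially. (SUP x\<in>S n. f n x) < ereal \<epsilon>"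
    using order_tendstoD(2)[OF lim, of "ereal \<epsilon>"] \<epsilon> by simp
  then show ?thesis
    by eventually_elim (meson SUP_upper le_less_trans less_imp_le)
qed

lemma SUP_tendsto_zeroI:
  fixes f :: "nat \<Rightarrow> real \<Rightarrow> real" and c :: "nat \<Rightarrow> real"
  assumes small: "\<And>\<theta>. 0 < \<theta> \<Longrightarrow> \<theta> \<le> 1 \<Longrightarrow> \<forall>\<^sub>F n in sequentially. \<forall>x\<ge>c n. f n x \<le> \<theta>"
    and nonneg: "\<And>n x. 0 \<le> f n x"
  shows "(\<lambda>n. SUP x\<in>{c n..}. ereal (f n x)) \<longlonglongrightarrow> 0"
proof (rule order_tendstoI)
  fix y :: ereal assume "y < 0"
  show "\<forall>\<^sub>F n in sequentially. y < (SUP x\<in>{c n..}. ereal (f n x))"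
  proof (rule always_eventually, rule allI)
    fix n
    \<comment> \<open>The index set contains \<open>c n\<close>; over an empty set the supremum
      would be minus infinity.\<close>
    have "ereal (f n (c n)) \<le> (SUP x\<in>{c n..}. ereal (f n x))" by (rule SUP_upper) simp
    moreover have "0 \<le> ereal (f n (c n))" using nonneg by simp
    ultimately show "y < (SUP x\<in>{c n..}. ereal (f n x))" using \<open>y < 0\<close> by (meson less_le_trans order_trans)
  qed
next
  fix y :: ereal assume "0 < y"
  then obtain r where r: "0 < r" "ereal r < y" by (metis ereal_dense2 ereal_less(2) zero_ereal_def ereal_less_eq(3) less_ereal.simps(1))
  have "\<forall>\<^sub>F n in sequentially. \<forall>x\<ge>c n. f n x \<le> min r 1" using r by (intro small) auto
  then show "\<forall>\<^sub>F n in sequentially. (SUP x\<in>{c n..}. ereal (f n x)) < y"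
  proof eventually_elim
    case (elim n)
    have "(SUP x\<in>{c n..}. ereal (f n x)) \<le> ereal r" using elim by (intro SUP_least) auto
    then show ?case using r by simp
  qed
qed

theorem theorem2p1:
  fixes M :: "'a measure" and \<xi> :: "nat \<Rightarrow> 'a \<Rightarrow> real" and F :: "real measure"
    and T :: ereal and b I h J :: "nat \<Rightarrow> real"
  assumes "prob_space M"
    and "prob_space.indep_vars M (\<lambda>_. borel) \<xi> {1..}"
    and "\<And>i. i \<ge> 1 \<Longrightarrow> distr M borel (\<xi> i) = F"
    and "0 < T"
    and "natural_scale M \<xi> b"
    and "insensitivity_seq F T b I"
    and "truncation_seq M \<xi> F T b h"
    and "small_steps_seq M \<xi> F T h J"
    and "h \<in> O(b)"
    and "\<And>n. n \<ge> 1 \<Longrightarrow> h n \<le> J n"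
  shows "(\<lambda>n. SUP x\<in>{I n + J n..}.
            ereal \<bar>\<P>(\<omega> in M. partial_sum \<xi> n \<omega> \<in> window T x)
                   / (real n * measure F (window T x)) - 1\<bar>) \<longlonglongrightarrow> 0"
proof -
  interpret prob_space M by fact
  note ind = assms(2) and law = assms(3)
  have rv: "random_variable borel (\<xi> i)" if "1 \<le> i" for i
    using ind that by (auto simp: indep_vars_def)
  have F: "real_distribution F" using real_distribution_distr[OF rv[of 1]] law[of 1] by simp
  interpret F: real_distribution F by fact
  have fb: "finite_borel F" using F.finite_measure_axioms by (auto simp: finite_borel_def)
  have ps[measurable]: "partial_sum \<xi> n \<in> borel_measurable M" for n
    unfolding partial_sum_def using rv by (auto intro!: borel_measurable_sum)
  let ?w = "\<lambda>y. measure F (window T y)"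
  have sum_law: "\<P>(\<omega> in M. partial_sum \<xi> n \<omega> \<in> X) = measure (conv_pow F n) X"
    if "1 \<le> n" "X \<in> sets borel" for n X
    using partial_sum_law[OF ind law that(1), of UNIV X] that(2) by (simp add: restr_UNIV[OF fb])
  have pos_b: "0 < b n" if "1 \<le> n" for n
    using assms(5) that by (auto simp: natural_scale_def positive_seq_def)
  have tight: "\<exists>K>0. \<forall>n\<ge>1. measure (conv_pow F n) {s. K * b n < \<bar>s\<bar>} \<le> \<epsilon>" if \<epsilon>: "0 < \<epsilon>" for \<epsilon>
  proof -
    \<comment> \<open>The laws in \<open>tight\<close> are shifted by \<open>Suc\<close>, so the
      index \<open>n \<ge> 1\<close> is reached from \<open>n - 1\<close>.\<close>
    obtain u v where uv: "\<And>n. measure (distr M borel (\<lambda>\<omega>. partial_sum \<xi> (Suc n) \<omega> / b (Suc n))) {u<..v} > 1 - \<epsilon>"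
      using assms(5) \<epsilon> unfolding natural_scale_def tight_def by blast
    define K where "K = \<bar>u\<bar> + \<bar>v\<bar> + 1"
    have "measure (conv_pow F n) {s. K * b n < \<bar>s\<bar>} \<le> \<epsilon>" if n: "1 \<le> n" for n
    proof -
      have bn: "0 < b n" using pos_b[OF n] .
      let ?A = "{\<omega> \<in> space M. u < partial_sum \<xi> n \<omega> / b n \<and> partial_sum \<xi> n \<omega> / b n \<le> v}"
      have "1 - \<epsilon> < measure (distr M borel (\<lambda>\<omega>. partial_sum \<xi> n \<omega> / b n)) {u<..v}"
        using uv[of "n - 1"] n by simp
      also have "\<dots> = prob ?A"
        by (subst measure_distr) (auto intro!: arg_cong[of _ _ prob])
      finally have A: "1 - \<epsilon> < prob ?A" .
      have Am: "?A \<in> events" by measurable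
      have "measure (conv_pow F n) {s. K * b n < \<bar>s\<bar>} = \<P>(\<omega> in M. partial_sum \<xi> n \<omega> \<in> {s. K * b n < \<bar>s\<bar>})"
        by (rule sum_law[symmetric, OF n]) measurable
      also have "\<dots> \<le> prob (space M - ?A)"
      proof (intro finite_measure_mono)
        have "\<not> K * b n < \<bar>y\<bar>" if "u < y / b n" "y / b n \<le> v" for y
        proof -
          have "\<bar>y / b n\<bar> \<le> K" using that unfolding K_def by linarith
          then show ?thesis using bn by (simp add: abs_div field_simps)
        qed
        then show "{\<omega> \<in> space M. partial_sum \<xi> n \<omega> \<in> {s. K * b n < \<bar>s\<bar>}} \<subseteq> space M - ?A" by blast
      qed (use Am in auto)
      also have "\<dots> = 1 - prob ?A" by (rule prob_compl[OF Am])
      finally show ?thesis using A by simp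
    qed
    then show ?thesis by (intro exI[of _ K]) (auto simp: K_def)
  qed
  have char: "\<exists>t>0. \<forall>n\<ge>1. \<forall>s. \<bar>s\<bar> \<le> t / b n \<longrightarrow> norm (char F s ^ n - 1) \<le> 1 / 8"
  proof -
    obtain K where K: "0 < K" "\<And>n. 1 \<le> n \<Longrightarrow> measure (conv_pow F n) {s. K * b n < \<bar>s\<bar>} \<le> 1 / 32"
      using tight[of "1 / 32"] by auto
    have "norm (char F s ^ n - 1) \<le> 1 / 8" if n: "1 \<le> n" and s: "\<bar>s\<bar> \<le> (1 / (16 * K)) / b n" for n s
    proof -
      let ?\<mu> = "distr M borel (partial_sum \<xi> n)"
      have "measure ?\<mu> {s. K * b n < \<bar>s\<bar>} = \<P>(\<omega> in M. partial_sum \<xi> n \<omega> \<in> {s. K * b n < \<bar>s\<bar>})"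
        by (subst measure_distr) (auto intro!: arg_cong[of _ _ prob])
      also have "\<dots> = measure (conv_pow F n) {s. K * b n < \<bar>s\<bar>}" by (rule sum_law[OF n]) measurable
      also have "\<dots> \<le> 1 / 32" using K n by simp
      finally have far: "measure ?\<mu> {s. K * b n < \<bar>s\<bar>} \<le> 1 / 32" .
      \<comment> \<open>Independence turns the characteristic function of the sum into the
        \<open>n\<close>-th power of \<open>char F s\<close>, so tightness of the scaled sums is a
        statement about that power for \<open>s\<close> of order \<open>1 / b n\<close>.\<close>
      have "char ?\<mu> s = (\<Prod>i\<in>{1..n}. char (distr M borel (\<xi> i)) s)"
        unfolding partial_sum_def[abs_def]
        by (rule char_distr_sum) (rule indep_vars_subset[OF ind], auto)
      also have "\<dots> = (\<Prod>i\<in>{1..n}. char F s)" by (intro prod.cong) (auto simp: law)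
      finally have ch: "char ?\<mu> s = char F s ^ n" by simp
      have "\<bar>s\<bar> * (K * b n) \<le> 1 / 16"
        using s K pos_b[OF n] by (simp add: field_simps)
      from char_near_one[OF real_distribution_distr[OF ps] far this]
      show ?thesis unfolding ch .
    qed
    then show ?thesis using K by (intro exI[of _ "1 / (16 * K)"]) auto
  qed
  have core: "\<forall>\<^sub>F n in sequentially. \<forall>x\<ge>I n + J n. \<bar>measure (conv_pow F n) (window T x) / (n * ?w x) - 1\<bar> \<le> \<theta>"
    if \<theta>: "0 < \<theta>" "\<theta> \<le> 1" for \<theta>
  proof (rule conv_pow_window_ratio_near_one[OF F assms(4) pos_b _ _ tight char _ _ _ _ _ _ _ assms(10) \<theta>])
    show "0 < h n" "0 < I n" if "1 \<le> n" for n
      using assms(6,7) that by (auto simp: insensitivity_seq_def truncation_seq_def positive_seq_def)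
    show "(\<lambda>n. b n / I n) \<longlonglongrightarrow> 0" "\<forall>\<^sub>F n in sequentially. \<forall>x\<ge>I n. 0 < ?w x"
      using assms(6) by (auto simp: insensitivity_seq_def)
    show "\<forall>\<^sub>F n in sequentially. \<forall>x\<ge>h n. 0 < ?w x"
      using assms(7) by (auto simp: truncation_seq_def)
    show "\<exists>C>0. \<forall>\<^sub>F n in sequentially. h n \<le> C * b n"
    proof -
      obtain C where C: "0 < C" "\<forall>\<^sub>F n in sequentially. norm (h n) \<le> C * norm (b n)"
        using assms(9) by (auto elim!: landau_o.bigE)
      from C(2) eventually_ge_at_top[of 1] have "\<forall>\<^sub>F n in sequentially. h n \<le> C * b n"
        by eventually_elim (use pos_b in \<open>fastforce simp: abs_if split: if_splits\<close>)
      then show ?thesis using C by blast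
    qed
    fix \<epsilon> :: real assume \<epsilon>: "0 < \<epsilon>"
    show "\<forall>\<^sub>F n in sequentially. \<forall>x\<ge>I n. \<forall>t\<in>{0..b n}. \<bar>?w (x - t) / ?w x - 1\<bar> \<le> \<epsilon>"
    proof -
      have "\<forall>\<^sub>F n in sequentially. \<forall>x\<in>{I n..}. (SUP t\<in>{0..b n}. ereal \<bar>?w (x - t) / ?w x - 1\<bar>) \<le> ereal \<epsilon>"
        using assms(6) \<epsilon> unfolding insensitivity_seq_def by (intro SUP_tendsto_zeroD) auto
      then show ?thesis
        by eventually_elim (auto simp: SUP_le_iff)
    qed
    show "\<forall>\<^sub>F n in sequentially. \<forall>x\<ge>J n. \<forall>z\<ge>x.
        measure (conv_pow (restr F {..h n}) n) (window T z) \<le> \<epsilon> * (n * ?w x)"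
    proof -
      let ?P = "\<lambda>n z. \<P>(\<omega> in M. partial_sum \<xi> n \<omega> \<in> window T z \<and> (\<forall>i\<in>{1..n}. \<xi> i \<omega> \<le> h n))"
      have "\<forall>\<^sub>F n in sequentially. \<forall>x\<in>{J n..}. (SUP z\<in>{x..}. ereal (?P n z / (real n * ?w x))) \<le> ereal \<epsilon>"
        using assms(8) \<epsilon> unfolding small_steps_seq_def by (intro SUP_tendsto_zeroD) auto
      moreover have "\<forall>\<^sub>F n in sequentially. \<forall>x\<ge>J n. 0 < ?w x"
        using assms(8) by (auto simp: small_steps_seq_def)
      ultimately show ?thesis using eventually_ge_at_top[of 1]
      proof eventually_elim
        case (elim n)
        have "measure (conv_pow (restr F {..h n}) n) (window T z) = ?P n z" for z
          using partial_sum_law[OF ind law elim(3), of "{..h n}" "window T z"] by simp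
        then show ?case using elim by (auto simp: SUP_le_iff pos_divide_le_eq)
      qed
    qed
    show "\<exists>K>0. \<forall>\<^sub>F n in sequentially. \<forall>x\<ge>h n.
        n * measure (conv_pow (restr F ({..< - K * b n} \<union> {h n<..})) 2) (window T x) \<le> \<epsilon> * ?w x"
    proof -
      let ?D = "\<lambda>K n. {..< - K * b n} \<union> {h n <..}"
      let ?P = "\<lambda>K n x. \<P>(\<omega> in M. partial_sum \<xi> 2 \<omega> \<in> window T x \<and> \<xi> 1 \<omega> \<in> ?D K n \<and> \<xi> 2 \<omega> \<in> ?D K n)"
      have "\<forall>\<^sub>F K in at_top. limsup (\<lambda>n. SUP x\<in>{h n..}. ereal (real n * ?P K n x / ?w x)) < ereal \<epsilon>"
        using assms(7) \<epsilon> unfolding truncation_seq_def by (auto elim!: order_tendstoD)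
      then have "\<forall>\<^sub>F K in at_top. 0 < K \<and> limsup (\<lambda>n. SUP x\<in>{h n..}. ereal (real n * ?P K n x / ?w x)) < ereal \<epsilon>"
        using eventually_gt_at_top[of "0::real"] by eventually_elim auto
      \<comment> \<open>One large \<open>K\<close> is enough: its limsup below
        \<open>\<epsilon>\<close> bounds the supremum for all large \<open>n\<close>. Positivity is
        secured here because \<open>1 / K\<close> will bound the rate of the exponential
        moment.\<close>
      then obtain K :: real where K: "0 < K" "limsup (\<lambda>n. SUP x\<in>{h n..}. ereal (real n * ?P K n x / ?w x)) < ereal \<epsilon>"
        using eventually_happens[of _ "at_top :: real filter"] by (auto simp: trivial_limit_at_top_linorder)
      have "\<forall>\<^sub>F n in sequentially. \<forall>x\<ge>h n. 0 < ?w x"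
        using assms(7) by (auto simp: truncation_seq_def)
      with Limsup_lessD[OF K(2)]
      have "\<forall>\<^sub>F n in sequentially. \<forall>x\<ge>h n.
          n * measure (conv_pow (restr F (?D K n)) 2) (window T x) \<le> \<epsilon> * ?w x"
      proof eventually_elim
        case (elim n)
        have I2: "{1..2::nat} = {1, 2}" by auto
        have P: "measure (conv_pow (restr F (?D K n)) 2) (window T x) = ?P K n x" for x
          using partial_sum_law[OF ind law, of 2 "?D K n" "window T x"] unfolding I2 by simp
        show ?case
        proof (intro allI impI)
          fix x assume x: "h n \<le> x"
          have "ereal (real n * ?P K n x / ?w x) \<le> (SUP x\<in>{h n..}. ereal (real n * ?P K n x / ?w x))"
            using x by (intro SUP_upper) auto
          also have "\<dots> < ereal \<epsilon>" by (rule elim(1))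
          finally have "real n * ?P K n x / ?w x < \<epsilon>" by simp
          then show "n * measure (conv_pow (restr F (?D K n)) 2) (window T x) \<le> \<epsilon> * ?w x"
            unfolding P using elim(2) x by (simp add: pos_divide_less_eq)
        qed
      qed
      then show ?thesis using K(1) by blast
    qed
  qed
  show ?thesis
  proof (rule SUP_tendsto_zeroI)
    fix \<theta> :: real assume "0 < \<theta>" "\<theta> \<le> 1"
    from core[OF this] eventually_ge_at_top[of 1]
    show "\<forall>\<^sub>F n in sequentially. \<forall>x\<ge>I n + J n.
        \<bar>\<P>(\<omega> in M. partial_sum \<xi> n \<omega> \<in> window T x) / (real n * ?w x) - 1\<bar> \<le> \<theta>"
      by eventually_elim (simp add: sum_law)
  qed simp
qed

end
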